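(* Let $\Bbbk$ be a commutative ring and let $H$ be a Hopf $\Bbbk$-category. Then $\mathrm{alg}(H)$, with its canonical multiplication and comultiplication and with the map $S:\mathrm{alg}(H)\to\mathrm{alg}(H)$ induced by the antipode of $H$ as pseudo-antipode, is a counital quantum inverse semigroup, and its pseudo-antipode is anticomultiplicative, i.e. $\Delta\circ S=\tau\circ(S\otimes S)\circ\Delta$, where $\tau$ is the flip map.
   Context: Tensor products are over $\Bbbk$, and Sweedler notation is used. Category enriched over $\Bbbk$-coalgebras: such a (small) category $H$ over a set $X$ consists of a family $\{H_{x,y}\}_{x,y\in X}$ of $\Bbbk$-coalgebras (coassociative, counital) with structure maps $\Delta_{x,y}:H_{x,y}\to H_{x,y}\otimes H_{x,y}$ and $\varepsilon_{x,y}:H_{x,y}\to\Bbbk$, together with $\Bbbk$-linear maps $\mu_{x,y,z}:H_{x,y}\otimes H_{y,z}\to H_{x,z}$ and $\eta_x:\Bbbk\to H_{x,x}$ such that the multiplications are associative, $\mu_{x,y,t}\circ(H_{x,y}\otimes\mu_{y,z,t})=\mu_{x,z,t}\circ(\mu_{x,y,z}\otimes H_{z,t})$, and unital, $\mu_{x,x,y}\circ(\eta_x\otimes H_{x,y})=H_{x,y}=\mu_{x,y,y}\circ(H_{x,y}\otimes\eta_y)$ (an object's name denotes its identity map), and such that all $\mu_{x,y,z}$ and $\eta_x$ are coalgebra morphisms: $\Delta_{x,z}\circ\mu_{x,y,z}=(\mu_{x,y,z}\otimes\mu_{x,y,z})\circ(H_{x,y}\otimes\tau\otimes H_{y,z})\circ(\Delta_{x,y}\otimes\Delta_{y,z})$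 with $\tau(h\otimes k)=k\otimes h$, $\Delta_{x,x}\circ\eta_x=\eta_x\otimes\eta_x$, $\varepsilon_{x,z}\circ\mu_{x,y,z}=\varepsilon_{x,y}\otimes\varepsilon_{y,z}$ and $\varepsilon_{x,x}\circ\eta_x=\mathrm{id}_\Bbbk$. Hopf $\Bbbk$-category: such a category $H$ with an antipode, i.e. a family of $\Bbbk$-linear maps $S_{x,y}:H_{x,y}\to H_{y,x}$ such that, for all $x,y\in X$, $\mu_{x,y,x}\circ(H_{x,y}\otimes S_{x,y})\circ\Delta_{x,y}=\eta_x\circ\varepsilon_{x,y}$ and $\mu_{y,x,y}\circ(S_{x,y}\otimes H_{x,y})\circ\Delta_{x,y}=\eta_y\circ\varepsilon_{x,y}$. The algebra $\mathrm{alg}(H)$: as a $\Bbbk$-module, $\mathrm{alg}(H)=\bigoplus_{x,y\in X}H_{x,y}$. It is a coalgebra as a direct sum of coalgebras, with $\Delta$ and $\varepsilon$ given on $H_{x,y}$ by $\Delta_{x,y}$ and $\varepsilon_{x,y}$. Its multiplication is $\mu(a\otimes b)=\mu_{x,y,z}(a\otimes b)$ for $a\in H_{x,y}$, $b\in H_{y,z}$, and $\mu(a\otimes b)=0$ for $a\in H_{x,y}$, $b\in H_{w,z}$ with $y\ne w$. The map $S:\mathrm{alg}(H)\to\mathrm{alg}(H)$ is given on $H_{x,y}$ by $S_{x,y}$. Quantum inverse semigroup (QISG): a triple $(Q,\Delta,\mathcal S)$ in which (QISG1) $Q$ is a (not necessarily unital) associative $\Bbbk$-algebra; (QISG2) $\Delta:Q\to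 Q\otimes Q$ is $\Bbbk$-linear, multiplicative and coassociative; (QISG3) $\mathcal S:Q\to Q$ is a $\Bbbk$-linear map (the pseudo-antipode) such that (i) $\mathcal S(hk)=\mathcal S(k)\mathcal S(h)$ for all $h,k\in Q$, and (ii) $I\ast\mathcal S\ast I=I$ and $\mathcal S\ast I\ast\mathcal S=\mathcal S$ in the convolution algebra $\mathrm{End}_\Bbbk(Q)$, where $I$ is the identity map and $(f\ast g)(h)=f(h_{(1)})g(h_{(2)})$; (QISG4) for all $h,k\in Q$, $h_{(1)}\mathcal S(h_{(2)})\mathcal S(k_{(1)})k_{(2)}=\mathcal S(k_{(1)})k_{(2)}h_{(1)}\mathcal S(h_{(2)})$. A QISG is counital if $Q$ is a $\Bbbk$-coalgebra (with counit $\varepsilon$) and $\varepsilon\circ\mathcal S=\varepsilon$. *)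

theory Defs
  imports "HOL-Algebra.Module" "HOL-Algebra.AbelCoset"
begin

section \<open>Linear maps, quotients and free modules\<close>

text \<open>
  Modules over a commutative ring are those of HOL-Algebra. The record type \<open>('k, 'm) module\<close> extends
  \<open>'m ring\<close>, so the modules constructed below carry values for \<open>mult\<close> and \<open>one\<close> that have no meaning.
\<close>

definition linear_maps ::
  "('k, 'r) ring_scheme \<Rightarrow> ('k, 'm) module \<Rightarrow> ('k, 'n) module \<Rightarrow> ('m \<Rightarrow> 'n) set" where
  "linear_maps R M N = {f \<in> carrier M \<rightarrow> carrier N.
     (\<forall>a\<in>carrier M. \<forall>b\<in>carrier M. f (a \<oplus>\<^bsub>M\<^esub> b) = f a \<oplus>\<^bsub>N\<^esub> f b) \<and>
     (\<forall>r\<in>carrier R. \<forall>a\<in>carrier M. f (r \<odot>\<^bsub>M\<^esub> a) = r \<odot>\<^bsub>N\<^esub> f a)}"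

definition regular_module :: "('k, 'r) ring_scheme \<Rightarrow> ('k, 'k) module" where
  "regular_module R = \<lparr>carrier = carrier R, monoid.mult = mult R, one = one R,
     zero = zero R, add = add R, smult = mult R\<rparr>"

definition quotient_module :: "('k, 'm) module \<Rightarrow> 'm set \<Rightarrow> ('k, 'm set) module" where
  "quotient_module M K = \<lparr>carrier = a_rcosets\<^bsub>M\<^esub> K, monoid.mult = (\<lambda>_ _. K), one = K,
     zero = K, add = set_add M, smult = (\<lambda>r A. \<Union>a\<in>A. K +>\<^bsub>M\<^esub> (r \<odot>\<^bsub>M\<^esub> a))\<rparr>"

definition free_module :: "('k, 'r) ring_scheme \<Rightarrow> 's set \<Rightarrow> ('k, 's \<Rightarrow> 'k) module" where
  "free_module R A = \<lparr>carrier = {f. (\<forall>s. f s \<in> carrier R) \<and> finite {s. f s \<noteq> \<zero>\<^bsub>R\<^esub>}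
                                 \<and> {s. f s \<noteq> \<zero>\<^bsub>R\<^esub>} \<subseteq> A},
     monoid.mult = (\<lambda>_ _ _. \<zero>\<^bsub>R\<^esub>), one = (\<lambda>_. \<zero>\<^bsub>R\<^esub>),
     zero = (\<lambda>_. \<zero>\<^bsub>R\<^esub>), add = (\<lambda>f g s. f s \<oplus>\<^bsub>R\<^esub> g s), smult = (\<lambda>r f s. r \<otimes>\<^bsub>R\<^esub> f s)\<rparr>"

definition free_gen :: "('k, 'r) ring_scheme \<Rightarrow> 's \<Rightarrow> 's \<Rightarrow> 'k" where
  "free_gen R s = (\<lambda>t. if t = s then \<one>\<^bsub>R\<^esub> else \<zero>\<^bsub>R\<^esub>)"


section \<open>Tensor products\<close>

definition tensor_relations ::
  "('k, 'r) ring_scheme \<Rightarrow> ('k, 'm) module \<Rightarrow> ('k, 'n) module \<Rightarrow> ('m \<times> 'n \<Rightarrow> 'k) set" where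
  "tensor_relations R M N =
    (let F = free_module R (carrier M \<times> carrier N); \<delta> = (\<lambda>m n. free_gen R (m, n)) in
      {\<delta> (m \<oplus>\<^bsub>M\<^esub> m') n \<ominus>\<^bsub>F\<^esub> (\<delta> m n \<oplus>\<^bsub>F\<^esub> \<delta> m' n) | m m' n.
         m \<in> carrier M \<and> m' \<in> carrier M \<and> n \<in> carrier N} \<union>
      {\<delta> m (n \<oplus>\<^bsub>N\<^esub> n') \<ominus>\<^bsub>F\<^esub> (\<delta> m n \<oplus>\<^bsub>F\<^esub> \<delta> m n') | m n n'.
         m \<in> carrier M \<and> n \<in> carrier N \<and> n' \<in> carrier N} \<union>
      {\<delta> (r \<odot>\<^bsub>M\<^esub> m) n \<ominus>\<^bsub>F\<^esub> (r \<odot>\<^bsub>F\<^esub> \<delta> m n) | r m n.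
         r \<in> carrier R \<and> m \<in> carrier M \<and> n \<in> carrier N} \<union>
      {\<delta> m (r \<odot>\<^bsub>N\<^esub> n) \<ominus>\<^bsub>F\<^esub> (r \<odot>\<^bsub>F\<^esub> \<delta> m n) | r m n.
         r \<in> carrier R \<and> m \<in> carrier M \<and> n \<in> carrier N})"

definition tensor_kernel ::
  "('k, 'r) ring_scheme \<Rightarrow> ('k, 'm) module \<Rightarrow> ('k, 'n) module \<Rightarrow> ('m \<times> 'n \<Rightarrow> 'k) set" where
  "tensor_kernel R M N =
    \<Inter>{K. submodule K R (free_module R (carrier M \<times> carrier N)) \<and> tensor_relations R M N \<subseteq> K}"

definition tensor ::
  "('k, 'r) ring_scheme \<Rightarrow> ('k, 'm) module \<Rightarrow> ('k, 'n) module
   \<Rightarrow> ('k, ('m \<times> 'n \<Rightarrow> 'k) set) module" where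
  "tensor R M N = quotient_module (free_module R (carrier M \<times> carrier N)) (tensor_kernel R M N)"

definition tensor_elt ::
  "('k, 'r) ring_scheme \<Rightarrow> ('k, 'm) module \<Rightarrow> ('k, 'n) module
   \<Rightarrow> 'm \<Rightarrow> 'n \<Rightarrow> ('m \<times> 'n \<Rightarrow> 'k) set" where
  "tensor_elt R M N m n =
    tensor_kernel R M N +>\<^bsub>free_module R (carrier M \<times> carrier N)\<^esub> free_gen R (m, n)"

text \<open>
  The linear map out of a tensor product into \<open>P\<close> induced by a bilinear map \<open>b\<close>. Bilinearity of \<open>b\<close>
  is what makes the image of a coset a singleton.
\<close>

definition tensor_lift ::
  "('k, 'r) ring_scheme \<Rightarrow> ('k, 'p) module \<Rightarrow> ('m \<Rightarrow> 'n \<Rightarrow> 'p) \<Rightarrow> ('m \<times> 'n \<Rightarrow> 'k) set \<Rightarrow> 'p" where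
  "tensor_lift R P b A = the_elem
    ((\<lambda>f. finsum P (\<lambda>(m, n). f (m, n) \<odot>\<^bsub>P\<^esub> b m n) {s. f s \<noteq> \<zero>\<^bsub>R\<^esub>}) ` A)"

text \<open>\<open>f \<otimes> g\<close>; the two module arguments are the codomains of \<open>f\<close> and \<open>g\<close>.\<close>

definition tensor_map ::
  "('k, 'r) ring_scheme \<Rightarrow> ('k, 'p) module \<Rightarrow> ('k, 'q) module \<Rightarrow> ('m \<Rightarrow> 'p) \<Rightarrow> ('n \<Rightarrow> 'q)
   \<Rightarrow> ('m \<times> 'n \<Rightarrow> 'k) set \<Rightarrow> ('p \<times> 'q \<Rightarrow> 'k) set" where
  "tensor_map R P Q f g = tensor_lift R (tensor R P Q) (\<lambda>m n. tensor_elt R P Q (f m) (g n))"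

definition tensor_flip ::
  "('k, 'r) ring_scheme \<Rightarrow> ('k, 'm) module \<Rightarrow> ('k, 'n) module
   \<Rightarrow> ('m \<times> 'n \<Rightarrow> 'k) set \<Rightarrow> ('n \<times> 'm \<Rightarrow> 'k) set" where
  "tensor_flip R M N = tensor_lift R (tensor R N M) (\<lambda>m n. tensor_elt R N M n m)"

text \<open>\<open>(M \<otimes> N) \<otimes> P \<cong> M \<otimes> (N \<otimes> P)\<close>, in both directions.\<close>

definition tensor_assoc ::
  "('k, 'r) ring_scheme \<Rightarrow> ('k, 'm) module \<Rightarrow> ('k, 'n) module \<Rightarrow> ('k, 'p) module
   \<Rightarrow> (('m \<times> 'n \<Rightarrow> 'k) set \<times> 'p \<Rightarrow> 'k) set \<Rightarrow> ('m \<times> ('n \<times> 'p \<Rightarrow> 'k) set \<Rightarrow> 'k) set" where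
  "tensor_assoc R M N P =
    (let T = tensor R M (tensor R N P) in
      tensor_lift R T (\<lambda>t p. tensor_lift R T
        (\<lambda>m n. tensor_elt R M (tensor R N P) m (tensor_elt R N P n p)) t))"

definition tensor_assoc_inv ::
  "('k, 'r) ring_scheme \<Rightarrow> ('k, 'm) module \<Rightarrow> ('k, 'n) module \<Rightarrow> ('k, 'p) module
   \<Rightarrow> ('m \<times> ('n \<times> 'p \<Rightarrow> 'k) set \<Rightarrow> 'k) set \<Rightarrow> (('m \<times> 'n \<Rightarrow> 'k) set \<times> 'p \<Rightarrow> 'k) set" where
  "tensor_assoc_inv R M N P =
    (let T = tensor R (tensor R M N) P in
      tensor_lift R T (\<lambda>m t. tensor_lift R T
        (\<lambda>n p. tensor_elt R (tensor R M N) P (tensor_elt R M N m n) p) t))"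

text \<open>\<open>R \<otimes> M \<cong> M\<close> and \<open>M \<otimes> R \<cong> M\<close>.\<close>

definition tensor_lunit ::
  "('k, 'r) ring_scheme \<Rightarrow> ('k, 'm) module \<Rightarrow> ('k \<times> 'm \<Rightarrow> 'k) set \<Rightarrow> 'm" where
  "tensor_lunit R M = tensor_lift R M (\<lambda>r m. r \<odot>\<^bsub>M\<^esub> m)"

definition tensor_runit ::
  "('k, 'r) ring_scheme \<Rightarrow> ('k, 'm) module \<Rightarrow> ('m \<times> 'k \<Rightarrow> 'k) set \<Rightarrow> 'm" where
  "tensor_runit R M = tensor_lift R M (\<lambda>m r. r \<odot>\<^bsub>M\<^esub> m)"

text \<open>\<open>M \<otimes> \<tau> \<otimes> Q : (M \<otimes> N) \<otimes> (P \<otimes> Q) \<rightarrow> (M \<otimes> P) \<otimes> (N \<otimes> Q)\<close>, with the associators made explicit.\<close>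

definition tensor_middle_flip ::
  "('k, 'r) ring_scheme
   \<Rightarrow> ('k, 'm) module \<Rightarrow> ('k, 'n) module \<Rightarrow> ('k, 'p) module \<Rightarrow> ('k, 'q) module
   \<Rightarrow> (('m \<times> 'n \<Rightarrow> 'k) set \<times> ('p \<times> 'q \<Rightarrow> 'k) set \<Rightarrow> 'k) set
   \<Rightarrow> (('m \<times> 'p \<Rightarrow> 'k) set \<times> ('n \<times> 'q \<Rightarrow> 'k) set \<Rightarrow> 'k) set" where
  "tensor_middle_flip R M N P Q =
     tensor_assoc_inv R M P (tensor R N Q) \<circ>
     tensor_map R M (tensor R P (tensor R N Q)) id
       (tensor_assoc R P N Q \<circ>
        tensor_map R (tensor R P N) Q (tensor_flip R N P) id \<circ>
        tensor_assoc_inv R N P Q) \<circ>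
     tensor_assoc R M N (tensor R P Q)"


section \<open>Direct sums\<close>

definition direct_sum :: "'i set \<Rightarrow> ('i \<Rightarrow> ('k, 'm) module) \<Rightarrow> ('k, 'i \<Rightarrow> 'm) module" where
  "direct_sum I M = \<lparr>carrier = {f \<in> \<Pi>\<^sub>E i\<in>I. carrier (M i). finite {i \<in> I. f i \<noteq> \<zero>\<^bsub>M i\<^esub>}},
     monoid.mult = (\<lambda>_ _. \<lambda>i\<in>I. \<zero>\<^bsub>M i\<^esub>), one = (\<lambda>i\<in>I. \<zero>\<^bsub>M i\<^esub>),
     zero = (\<lambda>i\<in>I. \<zero>\<^bsub>M i\<^esub>), add = (\<lambda>f g. \<lambda>i\<in>I. f i \<oplus>\<^bsub>M i\<^esub> g i),
     smult = (\<lambda>r f. \<lambda>i\<in>I. r \<odot>\<^bsub>M i\<^esub> f i)\<rparr>"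

definition direct_sum_inj :: "'i set \<Rightarrow> ('i \<Rightarrow> ('k, 'm) module) \<Rightarrow> 'i \<Rightarrow> 'm \<Rightarrow> 'i \<Rightarrow> 'm" where
  "direct_sum_inj I M i m = (\<lambda>j\<in>I. if j = i then m else \<zero>\<^bsub>M j\<^esub>)"

text \<open>The linear map out of a direct sum into \<open>P\<close> that is given on the summand \<open>M i\<close> by \<open>\<phi> i\<close>.\<close>

definition direct_sum_lift ::
  "'i set \<Rightarrow> ('i \<Rightarrow> ('k, 'm) module) \<Rightarrow> ('k, 'p) module \<Rightarrow> ('i \<Rightarrow> 'm \<Rightarrow> 'p) \<Rightarrow> ('i \<Rightarrow> 'm) \<Rightarrow> 'p" where
  "direct_sum_lift I M P \<phi> f = finsum P (\<lambda>i. \<phi> i (f i)) {i \<in> I. f i \<noteq> \<zero>\<^bsub>M i\<^esub>}"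


section \<open>Coalgebras\<close>

locale coalgebra = module R C
  for R :: "('k, 'r) ring_scheme" and C :: "('k, 'm) module" +
  fixes \<Delta> :: "'m \<Rightarrow> ('m \<times> 'm \<Rightarrow> 'k) set" and \<epsilon> :: "'m \<Rightarrow> 'k"
  assumes comult_linear: "\<Delta> \<in> linear_maps R C (tensor R C C)"
    and counit_linear: "\<epsilon> \<in> linear_maps R C (regular_module R)"
    and coassoc: "\<And>c. c \<in> carrier C \<Longrightarrow>
      tensor_assoc R C C C (tensor_map R (tensor R C C) C \<Delta> id (\<Delta> c)) =
      tensor_map R C (tensor R C C) id \<Delta> (\<Delta> c)"
    and counit_left: "\<And>c. c \<in> carrier C \<Longrightarrow>
      tensor_lunit R C (tensor_map R (regular_module R) C \<epsilon> id (\<Delta> c)) = c"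
    and counit_right: "\<And>c. c \<in> carrier C \<Longrightarrow>
      tensor_runit R C (tensor_map R C (regular_module R) id \<epsilon> (\<Delta> c)) = c"


section \<open>Hopf categories\<close>

locale coalgebra_category = cring R
  for R :: "('k, 'r) ring_scheme" +
  fixes X :: "'x set" and H :: "'x \<Rightarrow> 'x \<Rightarrow> ('k, 'm) module"
    and \<Delta> :: "'x \<Rightarrow> 'x \<Rightarrow> 'm \<Rightarrow> ('m \<times> 'm \<Rightarrow> 'k) set" and \<epsilon> :: "'x \<Rightarrow> 'x \<Rightarrow> 'm \<Rightarrow> 'k"
    and \<mu> :: "'x \<Rightarrow> 'x \<Rightarrow> 'x \<Rightarrow> ('m \<times> 'm \<Rightarrow> 'k) set \<Rightarrow> 'm" and \<eta> :: "'x \<Rightarrow> 'k \<Rightarrow> 'm"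
  assumes hom_coalgebra: "\<And>x y. \<lbrakk>x \<in> X; y \<in> X\<rbrakk> \<Longrightarrow> coalgebra R (H x y) (\<Delta> x y) (\<epsilon> x y)"
    and comp_linear: "\<And>x y z. \<lbrakk>x \<in> X; y \<in> X; z \<in> X\<rbrakk> \<Longrightarrow>
      \<mu> x y z \<in> linear_maps R (tensor R (H x y) (H y z)) (H x z)"
    and unit_linear: "\<And>x. x \<in> X \<Longrightarrow> \<eta> x \<in> linear_maps R (regular_module R) (H x x)"
    and comp_assoc: "\<And>x y z w t. \<lbrakk>x \<in> X; y \<in> X; z \<in> X; w \<in> X;
        t \<in> carrier (tensor R (tensor R (H x y) (H y z)) (H z w))\<rbrakk> \<Longrightarrow>
      \<mu> x y w (tensor_map R (H x y) (H y w) id (\<mu> y z w)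
        (tensor_assoc R (H x y) (H y z) (H z w) t)) =
      \<mu> x z w (tensor_map R (H x z) (H z w) (\<mu> x y z) id t)"
    and unit_left: "\<And>x y t. \<lbrakk>x \<in> X; y \<in> X; t \<in> carrier (tensor R (regular_module R) (H x y))\<rbrakk> \<Longrightarrow>
      \<mu> x x y (tensor_map R (H x x) (H x y) (\<eta> x) id t) = tensor_lunit R (H x y) t"
    and unit_right: "\<And>x y t. \<lbrakk>x \<in> X; y \<in> X; t \<in> carrier (tensor R (H x y) (regular_module R))\<rbrakk> \<Longrightarrow>
      \<mu> x y y (tensor_map R (H x y) (H y y) id (\<eta> y) t) = tensor_runit R (H x y) t"
    and comult_comp: "\<And>x y z t. \<lbrakk>x \<in> X; y \<in> X; z \<in> X; t \<in> carrier (tensor R (H x y) (H y z))\<rbrakk> \<Longrightarrow>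
      \<Delta> x z (\<mu> x y z t) =
      tensor_map R (H x z) (H x z) (\<mu> x y z) (\<mu> x y z)
        (tensor_middle_flip R (H x y) (H x y) (H y z) (H y z)
          (tensor_map R (tensor R (H x y) (H x y)) (tensor R (H y z) (H y z)) (\<Delta> x y) (\<Delta> y z) t))"
    and comult_unit: "\<And>x t. \<lbrakk>x \<in> X; t \<in> carrier (tensor R (regular_module R) (regular_module R))\<rbrakk> \<Longrightarrow>
      \<Delta> x x (\<eta> x (tensor_lunit R (regular_module R) t)) = tensor_map R (H x x) (H x x) (\<eta> x) (\<eta> x) t"
    and counit_comp: "\<And>x y z t. \<lbrakk>x \<in> X; y \<in> X; z \<in> X; t \<in> carrier (tensor R (H x y) (H y z))\<rbrakk> \<Longrightarrow>
      \<epsilon> x z (\<mu> x y z t) =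
      tensor_lunit R (regular_module R)
        (tensor_map R (regular_module R) (regular_module R) (\<epsilon> x y) (\<epsilon> y z) t)"
    and counit_unit: "\<And>x r. \<lbrakk>x \<in> X; r \<in> carrier R\<rbrakk> \<Longrightarrow> \<epsilon> x x (\<eta> x r) = r"

locale hopf_category = coalgebra_category R X H \<Delta> \<epsilon> \<mu> \<eta>
  for R :: "('k, 'r) ring_scheme" and X :: "'x set" and H :: "'x \<Rightarrow> 'x \<Rightarrow> ('k, 'm) module"
    and \<Delta> \<epsilon> \<mu> \<eta> +
  fixes S :: "'x \<Rightarrow> 'x \<Rightarrow> 'm \<Rightarrow> 'm"
  assumes antipode_linear: "\<And>x y. \<lbrakk>x \<in> X; y \<in> X\<rbrakk> \<Longrightarrow> S x y \<in> linear_maps R (H x y) (H y x)"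
    and antipode_right: "\<And>x y h. \<lbrakk>x \<in> X; y \<in> X; h \<in> carrier (H x y)\<rbrakk> \<Longrightarrow>
      \<mu> x y x (tensor_map R (H x y) (H y x) id (S x y) (\<Delta> x y h)) = \<eta> x (\<epsilon> x y h)"
    and antipode_left: "\<And>x y h. \<lbrakk>x \<in> X; y \<in> X; h \<in> carrier (H x y)\<rbrakk> \<Longrightarrow>
      \<mu> y x y (tensor_map R (H y x) (H x y) (S x y) id (\<Delta> x y h)) = \<eta> y (\<epsilon> x y h)"


section \<open>The algebra and coalgebra of a Hopf category\<close>

definition alg :: "'x set \<Rightarrow> ('x \<Rightarrow> 'x \<Rightarrow> ('k, 'm) module) \<Rightarrow> ('k, 'x \<times> 'x \<Rightarrow> 'm) module" where
  "alg X H = direct_sum (X \<times> X) (\<lambda>(x, y). H x y)"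

definition alg_inj ::
  "'x set \<Rightarrow> ('x \<Rightarrow> 'x \<Rightarrow> ('k, 'm) module) \<Rightarrow> 'x \<Rightarrow> 'x \<Rightarrow> 'm \<Rightarrow> ('x \<times> 'x \<Rightarrow> 'm)" where
  "alg_inj X H x y = direct_sum_inj (X \<times> X) (\<lambda>(x, y). H x y) (x, y)"

definition alg_lift ::
  "'x set \<Rightarrow> ('x \<Rightarrow> 'x \<Rightarrow> ('k, 'm) module) \<Rightarrow> ('k, 'p) module
   \<Rightarrow> ('x \<Rightarrow> 'x \<Rightarrow> 'm \<Rightarrow> 'p) \<Rightarrow> ('x \<times> 'x \<Rightarrow> 'm) \<Rightarrow> 'p" where
  "alg_lift X H P \<phi> = direct_sum_lift (X \<times> X) (\<lambda>(x, y). H x y) P (\<lambda>(x, y). \<phi> x y)"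

definition alg_mult ::
  "('k, 'r) ring_scheme \<Rightarrow> 'x set \<Rightarrow> ('x \<Rightarrow> 'x \<Rightarrow> ('k, 'm) module)
   \<Rightarrow> ('x \<Rightarrow> 'x \<Rightarrow> 'x \<Rightarrow> ('m \<times> 'm \<Rightarrow> 'k) set \<Rightarrow> 'm)
   \<Rightarrow> (('x \<times> 'x \<Rightarrow> 'm) \<times> ('x \<times> 'x \<Rightarrow> 'm) \<Rightarrow> 'k) set \<Rightarrow> ('x \<times> 'x \<Rightarrow> 'm)" where
  "alg_mult R X H \<mu> = tensor_lift R (alg X H)
    (\<lambda>f g. alg_lift X H (alg X H)
      (\<lambda>x y a. alg_lift X H (alg X H)
        (\<lambda>w z b. if y = w then alg_inj X H x z (\<mu> x y z (tensor_elt R (H x y) (H y z) a b))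
                 else \<zero>\<^bsub>alg X H\<^esub>) g) f)"

definition alg_comult ::
  "('k, 'r) ring_scheme \<Rightarrow> 'x set \<Rightarrow> ('x \<Rightarrow> 'x \<Rightarrow> ('k, 'm) module)
   \<Rightarrow> ('x \<Rightarrow> 'x \<Rightarrow> 'm \<Rightarrow> ('m \<times> 'm \<Rightarrow> 'k) set)
   \<Rightarrow> ('x \<times> 'x \<Rightarrow> 'm) \<Rightarrow> (('x \<times> 'x \<Rightarrow> 'm) \<times> ('x \<times> 'x \<Rightarrow> 'm) \<Rightarrow> 'k) set" where
  "alg_comult R X H \<Delta> = alg_lift X H (tensor R (alg X H) (alg X H))
    (\<lambda>x y h. tensor_map R (alg X H) (alg X H) (alg_inj X H x y) (alg_inj X H x y) (\<Delta> x y h))"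

definition alg_counit ::
  "('k, 'r) ring_scheme \<Rightarrow> 'x set \<Rightarrow> ('x \<Rightarrow> 'x \<Rightarrow> ('k, 'm) module)
   \<Rightarrow> ('x \<Rightarrow> 'x \<Rightarrow> 'm \<Rightarrow> 'k) \<Rightarrow> ('x \<times> 'x \<Rightarrow> 'm) \<Rightarrow> 'k" where
  "alg_counit R X H \<epsilon> = alg_lift X H (regular_module R) \<epsilon>"

definition alg_antipode ::
  "'x set \<Rightarrow> ('x \<Rightarrow> 'x \<Rightarrow> ('k, 'm) module)
   \<Rightarrow> ('x \<Rightarrow> 'x \<Rightarrow> 'm \<Rightarrow> 'm) \<Rightarrow> ('x \<times> 'x \<Rightarrow> 'm) \<Rightarrow> ('x \<times> 'x \<Rightarrow> 'm)" where
  "alg_antipode X H S = alg_lift X H (alg X H) (\<lambda>x y h. alg_inj X H y x (S x y h))"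


section \<open>Quantum inverse semigroups\<close>

definition convolution ::
  "('k, 'r) ring_scheme \<Rightarrow> ('k, 'q) module \<Rightarrow> (('q \<times> 'q \<Rightarrow> 'k) set \<Rightarrow> 'q)
   \<Rightarrow> ('q \<Rightarrow> ('q \<times> 'q \<Rightarrow> 'k) set) \<Rightarrow> ('q \<Rightarrow> 'q) \<Rightarrow> ('q \<Rightarrow> 'q) \<Rightarrow> 'q \<Rightarrow> 'q" where
  "convolution R Q \<mu> \<Delta> f g h = \<mu> (tensor_map R Q Q f g (\<Delta> h))"

locale quantum_inverse_semigroup = module R Q
  for R :: "('k, 'r) ring_scheme" and Q :: "('k, 'q) module" +
  fixes \<mu> :: "('q \<times> 'q \<Rightarrow> 'k) set \<Rightarrow> 'q" and \<Delta> :: "'q \<Rightarrow> ('q \<times> 'q \<Rightarrow> 'k) set" and S :: "'q \<Rightarrow> 'q"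
  assumes mult_linear: "\<mu> \<in> linear_maps R (tensor R Q Q) Q"
    and mult_assoc: "\<And>t. t \<in> carrier (tensor R (tensor R Q Q) Q) \<Longrightarrow>
      \<mu> (tensor_map R Q Q id \<mu> (tensor_assoc R Q Q Q t)) = \<mu> (tensor_map R Q Q \<mu> id t)"
    and comult_linear: "\<Delta> \<in> linear_maps R Q (tensor R Q Q)"
    and comult_mult: "\<And>t. t \<in> carrier (tensor R Q Q) \<Longrightarrow>
      \<Delta> (\<mu> t) = tensor_map R Q Q \<mu> \<mu> (tensor_middle_flip R Q Q Q Q
        (tensor_map R (tensor R Q Q) (tensor R Q Q) \<Delta> \<Delta> t))"
    and comult_coassoc: "\<And>h. h \<in> carrier Q \<Longrightarrow>
      tensor_assoc R Q Q Q (tensor_map R (tensor R Q Q) Q \<Delta> id (\<Delta> h)) =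
      tensor_map R Q (tensor R Q Q) id \<Delta> (\<Delta> h)"
    and antipode_linear: "S \<in> linear_maps R Q Q"
    and antipode_antimult: "\<And>h k. \<lbrakk>h \<in> carrier Q; k \<in> carrier Q\<rbrakk> \<Longrightarrow>
      S (\<mu> (tensor_elt R Q Q h k)) = \<mu> (tensor_elt R Q Q (S k) (S h))"
    and id_antipode_id: "\<And>h. h \<in> carrier Q \<Longrightarrow>
      convolution R Q \<mu> \<Delta> (convolution R Q \<mu> \<Delta> id S) id h = h"
    and antipode_id_antipode: "\<And>h. h \<in> carrier Q \<Longrightarrow>
      convolution R Q \<mu> \<Delta> (convolution R Q \<mu> \<Delta> S id) S h = S h"
    \<comment> \<open>\<open>h\<^sub>(\<^sub>1\<^sub>) S(h\<^sub>(\<^sub>2\<^sub>)) S(k\<^sub>(\<^sub>1\<^sub>)) k\<^sub>(\<^sub>2\<^sub>)\<close> is the product of \<open>(id * S) h\<close> and \<open>(S * id) k\<close>.\<close>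
    and idempotents_commute: "\<And>h k. \<lbrakk>h \<in> carrier Q; k \<in> carrier Q\<rbrakk> \<Longrightarrow>
      \<mu> (tensor_elt R Q Q (convolution R Q \<mu> \<Delta> id S h) (convolution R Q \<mu> \<Delta> S id k)) =
      \<mu> (tensor_elt R Q Q (convolution R Q \<mu> \<Delta> S id k) (convolution R Q \<mu> \<Delta> id S h))"

locale counital_quantum_inverse_semigroup =
  quantum_inverse_semigroup R Q \<mu> \<Delta> S + coalgebra R Q \<Delta> \<epsilon>
  for R :: "('k, 'r) ring_scheme" and Q :: "('k, 'q) module" and \<mu> \<Delta> \<epsilon> S +
  assumes counit_antipode: "\<And>h. h \<in> carrier Q \<Longrightarrow> \<epsilon> (S h) = \<epsilon> h"

end

theory Submission
  imports Defs
begin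

text \<open>
  Write \<open>Q\<close> for the algebra of a Hopf category \<open>H\<close>. For \<open>h\<close> in \<open>H x y\<close> the antipode axioms say
  \<open>h\<^sub>1S(h\<^sub>2) = \<epsilon>(h)1\<^sub>x\<close> and \<open>S(h\<^sub>1)h\<^sub>2 = \<epsilon>(h)1\<^sub>y\<close>, where \<open>1\<^sub>x\<close> is the identity of the object \<open>x\<close>. Hence
  \<open>I \<star> S\<close> and \<open>S \<star> I\<close> take values in the span of the elements \<open>1\<^sub>x\<close> (\<open>conv_id_antipode\<close>,
  \<open>conv_antipode_id\<close>). These are orthogonal idempotents of \<open>Q\<close>, which gives the commutation axiom
  (\<open>alg_idempotents_commute\<close>), and they act as units on the relevant components, so the counit axiom
  yields \<open>I \<star> S \<star> I = I\<close> and \<open>S \<star> I \<star> S = S\<close> (\<open>conv_left_unit\<close>).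

  That \<open>S\<close> reverses products and coproducts is proved as for Hopf algebras, by uniqueness of
  convolution inverses, carried out one pair or triple of objects at a time (\<open>antipode_mul\<close>,
  \<open>sw_antipode\<close>). The algebra and coalgebra axioms of \<open>Q\<close> hold on homogeneous elements because they
  hold in \<open>H\<close> and products that do not compose vanish on both sides, and extend to \<open>Q\<close> by
  multilinearity (\<open>alg_ext\<close>, \<open>tensor_ext\<close>).

  Calculations are done with Sweedler sums. The sum \<open>F(c\<^sub>1, c\<^sub>2)\<close> is the value at \<open>\<Delta>(c)\<close> of the linear map
  that the bilinear map \<open>F\<close> induces on the tensor product; the axioms of a coalgebra then become
  rewrite rules for nested sums, whose side conditions are linearity in each variable
  (\<open>sweedler_coassoc\<close>, \<open>sweedler_counit_left\<close>, \<open>tensor_lift_swap\<close>, \<open>sw_mul\<close>). Making this precise requires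
  the universal properties of free modules, quotients, tensor products and direct sums.
\<close>

section \<open>Linear maps\<close>

lemma linear_mapsI:
  assumes "\<And>a. a \<in> carrier M \<Longrightarrow> f a \<in> carrier N"
    and "\<And>a b. \<lbrakk>a \<in> carrier M; b \<in> carrier M\<rbrakk> \<Longrightarrow> f (a \<oplus>\<^bsub>M\<^esub> b) = f a \<oplus>\<^bsub>N\<^esub> f b"
    and "\<And>r a. \<lbrakk>r \<in> carrier R; a \<in> carrier M\<rbrakk> \<Longrightarrow> f (r \<odot>\<^bsub>M\<^esub> a) = r \<odot>\<^bsub>N\<^esub> f a"
  shows "f \<in> linear_maps R M N"
  using assms by (auto simp: linear_maps_def)

lemma linear_mapsD:
  assumes "f \<in> linear_maps R M N"
  shows linear_closed: "a \<in> carrier M \<Longrightarrow> f a \<in> carrier N"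
    and linear_add: "\<lbrakk>a \<in> carrier M; b \<in> carrier M\<rbrakk> \<Longrightarrow> f (a \<oplus>\<^bsub>M\<^esub> b) = f a \<oplus>\<^bsub>N\<^esub> f b"
    and linear_smult: "\<lbrakk>r \<in> carrier R; a \<in> carrier M\<rbrakk> \<Longrightarrow> f (r \<odot>\<^bsub>M\<^esub> a) = r \<odot>\<^bsub>N\<^esub> f a"
  using assms by (auto simp: linear_maps_def)

lemma linear_zero:
  assumes "module R M" "module R N" "f \<in> linear_maps R M N"
  shows "f \<zero>\<^bsub>M\<^esub> = \<zero>\<^bsub>N\<^esub>"
proof -
  interpret M: module R M by fact
  interpret N: module R N by fact
  have "f (\<zero>\<^bsub>R\<^esub> \<odot>\<^bsub>M\<^esub> \<zero>\<^bsub>M\<^esub>) = \<zero>\<^bsub>R\<^esub> \<odot>\<^bsub>N\<^esub> f \<zero>\<^bsub>M\<^esub>"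
    by (simp add: linear_smult[OF assms(3)] del: M.smult_l_null M.smult_r_null N.smult_l_null)
  then show ?thesis by (simp add: linear_closed[OF assms(3)])
qed

lemma linear_neg:
  assumes "module R M" "module R N" "f \<in> linear_maps R M N" "a \<in> carrier M"
  shows "f (\<ominus>\<^bsub>M\<^esub> a) = \<ominus>\<^bsub>N\<^esub> f a"
proof -
  interpret M: module R M by fact
  interpret N: module R N by fact
  have "f (\<ominus>\<^bsub>M\<^esub> a) \<oplus>\<^bsub>N\<^esub> f a = \<zero>\<^bsub>N\<^esub>"
    using assms(4) linear_zero[OF assms(1-3)]
    by (metis M.M.a_inv_closed M.M.l_neg assms(3) linear_add)
  then show ?thesis
    using assms(4) linear_closed[OF assms(3)] by (metis M.M.a_inv_closed N.M.minus_equality)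
qed

lemma linear_cong:
  assumes M: "module R M" and g: "g \<in> linear_maps R M N"
    and eq: "\<And>a. a \<in> carrier M \<Longrightarrow> f a = g a"
  shows "f \<in> linear_maps R M N"
proof -
  interpret M: module R M by fact
  show ?thesis
    by (rule linear_mapsI)
       (simp_all add: eq linear_closed[OF g] linear_add[OF g] linear_smult[OF g])
qed

lemma linear_id: "(\<lambda>x. x) \<in> linear_maps R M M"
  by (auto simp: linear_maps_def)

lemma linear_comp:
  assumes "g \<in> linear_maps R N P" "f \<in> linear_maps R M N"
  shows "(\<lambda>x. g (f x)) \<in> linear_maps R M P"
  using assms by (auto simp: linear_maps_def Pi_iff)

lemma linear_const_zero:
  assumes "module R P"
  shows "(\<lambda>x. \<zero>\<^bsub>P\<^esub>) \<in> linear_maps R M P"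
proof -
  interpret P: module R P by fact
  show ?thesis by (auto simp: linear_maps_def)
qed

lemma linear_smult_left:
  assumes P: "module R P" and f: "f \<in> linear_maps R K (regular_module R)" and p: "p \<in> carrier P"
  shows "(\<lambda>x. f x \<odot>\<^bsub>P\<^esub> p) \<in> linear_maps R K P"
proof -
  interpret P: module R P by fact
  show ?thesis
    using f p by (auto simp: linear_maps_def regular_module_def Pi_iff P.smult_l_distr
        P.smult_assoc1)
qed

lemma linear_smult_right:
  assumes P: "module R P" and f: "f \<in> linear_maps R K P" and r: "r \<in> carrier R"
  shows "(\<lambda>x. r \<odot>\<^bsub>P\<^esub> f x) \<in> linear_maps R K P"
proof -
  interpret P: module R P by fact
  show ?thesis
    using f r by (auto simp: linear_maps_def Pi_iff P.smult_r_distr P.smult_assoc1[symmetric]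
        P.R.m_comm)
qed

lemma regular_module_is_module:
  assumes "cring R"
  shows "module R (regular_module R)"
proof -
  interpret cring R by fact
  show ?thesis
  proof (rule moduleI)
    show "abelian_group (regular_module R)"
      by (rule abelian_groupI)
         (auto simp: regular_module_def a_ac intro: bexI[of _ "\<ominus>\<^bsub>R\<^esub> x" for x] l_neg)
  qed (auto simp: regular_module_def l_distr r_distr m_assoc assms)
qed

section \<open>Free modules\<close>

lemma free_module_simps [simp]:
  "\<zero>\<^bsub>free_module R A\<^esub> = (\<lambda>_. \<zero>\<^bsub>R\<^esub>)"
  "f \<oplus>\<^bsub>free_module R A\<^esub> g = (\<lambda>s. f s \<oplus>\<^bsub>R\<^esub> g s)"
  "r \<odot>\<^bsub>free_module R A\<^esub> f = (\<lambda>s. r \<otimes>\<^bsub>R\<^esub> f s)"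
  by (auto simp: free_module_def)

lemma free_module_carrier:
  "f \<in> carrier (free_module R A) \<longleftrightarrow>
     (\<forall>s. f s \<in> carrier R) \<and> finite {s. f s \<noteq> \<zero>\<^bsub>R\<^esub>} \<and> {s. f s \<noteq> \<zero>\<^bsub>R\<^esub>} \<subseteq> A"
  by (auto simp: free_module_def)

lemma free_module_is_module:
  assumes "cring R"
  shows "module R (free_module R A)"
proof -
  interpret cring R by fact
  let ?F = "free_module R A"
  have add: "(\<lambda>s. f s \<oplus>\<^bsub>R\<^esub> g s) \<in> carrier ?F" if "f \<in> carrier ?F" "g \<in> carrier ?F" for f g
  proof -
    have "{s. f s \<oplus>\<^bsub>R\<^esub> g s \<noteq> \<zero>\<^bsub>R\<^esub>} \<subseteq> {s. f s \<noteq> \<zero>\<^bsub>R\<^esub>} \<union> {s. g s \<noteq> \<zero>\<^bsub>R\<^esub>}"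
      by auto
    then show ?thesis
      using that unfolding free_module_carrier
      by (meson a_closed finite_UnI finite_subset le_sup_iff order_trans)
  qed
  have smult: "(\<lambda>s. r \<otimes>\<^bsub>R\<^esub> f s) \<in> carrier ?F" if "r \<in> carrier R" "f \<in> carrier ?F" for r f
  proof -
    have "{s. r \<otimes>\<^bsub>R\<^esub> f s \<noteq> \<zero>\<^bsub>R\<^esub>} \<subseteq> {s. f s \<noteq> \<zero>\<^bsub>R\<^esub>}"
      using that by auto
    then show ?thesis
      using that unfolding free_module_carrier by (meson m_closed finite_subset order_trans)
  qed
  show ?thesis
  proof (rule moduleI)
    show "abelian_group ?F"
    proof (rule abelian_groupI)
      fix f assume f: "f \<in> carrier ?F"
      have "(\<lambda>s. \<ominus>\<^bsub>R\<^esub> f s) = (\<lambda>s. \<ominus>\<^bsub>R\<^esub> \<one>\<^bsub>R\<^esub> \<otimes>\<^bsub>R\<^esub> f s)"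
        using f by (auto simp: free_module_carrier l_minus)
      then have "(\<lambda>s. \<ominus>\<^bsub>R\<^esub> f s) \<in> carrier ?F"
        using smult[OF _ f, of "\<ominus>\<^bsub>R\<^esub> \<one>\<^bsub>R\<^esub>"] by simp
      then show "\<exists>g\<in>carrier ?F. g \<oplus>\<^bsub>?F\<^esub> f = \<zero>\<^bsub>?F\<^esub>"
        using f by (intro bexI[of _ "\<lambda>s. \<ominus>\<^bsub>R\<^esub> f s"]) (auto simp: free_module_carrier l_neg)
    qed (auto simp: add, auto simp: free_module_carrier a_ac)
  qed (use assms in \<open>auto simp: smult\<close>, auto simp: free_module_carrier l_distr r_distr m_assoc)
qed

lemma free_gen_carrier:
  assumes "cring R" "s \<in> A"
  shows "free_gen R s \<in> carrier (free_module R A)"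
proof -
  interpret cring R by fact
  have "{t. free_gen R s t \<noteq> \<zero>\<^bsub>R\<^esub>} \<subseteq> {s}" by (auto simp: free_gen_def)
  then show ?thesis
    using assms(2) unfolding free_module_carrier
    by (auto simp: free_gen_def finite_subset)
qed

lemma free_module_induct [consumes 2, case_names zero add gen]:
  assumes R: "cring R" and f: "f \<in> carrier (free_module R A)"
    and zero: "P (\<lambda>_. \<zero>\<^bsub>R\<^esub>)"
    and add: "\<And>f g. \<lbrakk>f \<in> carrier (free_module R A); g \<in> carrier (free_module R A); P f; P g\<rbrakk>
      \<Longrightarrow> P (\<lambda>s. f s \<oplus>\<^bsub>R\<^esub> g s)"
    and gen: "\<And>r s. \<lbrakk>r \<in> carrier R; s \<in> A\<rbrakk> \<Longrightarrow> P (\<lambda>t. r \<otimes>\<^bsub>R\<^esub> free_gen R s t)"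
  shows "P f"
proof -
  interpret cring R by fact
  have "P f" if "finite B" "f \<in> carrier (free_module R A)" "{s. f s \<noteq> \<zero>\<^bsub>R\<^esub>} \<subseteq> B" for B f
    using that
  proof (induction B arbitrary: f)
    case empty
    then have "f = (\<lambda>_. \<zero>\<^bsub>R\<^esub>)" by auto
    then show ?case using zero by simp
  next
    case (insert b B)
    show ?case
    proof (cases "f b = \<zero>\<^bsub>R\<^esub>")
      case True
      then show ?thesis using insert.IH[OF insert.prems(1)] insert.prems(2) by blast
    next
      case False
      let ?g = "\<lambda>t. f b \<otimes>\<^bsub>R\<^esub> free_gen R b t" and ?h = "f(b := \<zero>\<^bsub>R\<^esub>)"
      have b: "b \<in> A" "f b \<in> carrier R" using False insert.prems(1)
          by (auto simp: free_module_carrier)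
      have g: "?g \<in> carrier (free_module R A)"
        using module.smult_closed[OF free_module_is_module[OF R] b(2) free_gen_carrier[OF R b(1)]]
            by simp
      have "{s. ?h s \<noteq> \<zero>\<^bsub>R\<^esub>} \<subseteq> {s. f s \<noteq> \<zero>\<^bsub>R\<^esub>}" by auto
      then have h: "?h \<in> carrier (free_module R A)"
        using insert.prems(1) unfolding free_module_carrier by (auto intro: finite_subset)
      have "{s. ?h s \<noteq> \<zero>\<^bsub>R\<^esub>} \<subseteq> B" using insert.prems(2) by auto
      then have "P ?h" by (rule insert.IH[OF h])
      moreover have "f = (\<lambda>s. ?g s \<oplus>\<^bsub>R\<^esub> ?h s)"
        using insert.prems(1) by (auto simp: free_gen_def free_module_carrier)
      ultimately show ?thesis using add[OF g h gen[OF b(2,1)]] by metis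
    qed
  qed
  then show ?thesis using f by (auto simp: free_module_carrier)
qed

definition free_lift ::
  "('k, 'r) ring_scheme \<Rightarrow> ('k, 'p) module \<Rightarrow> ('s \<Rightarrow> 'p) \<Rightarrow> ('s \<Rightarrow> 'k) \<Rightarrow> 'p" where
  "free_lift R P g f = finsum P (\<lambda>s. f s \<odot>\<^bsub>P\<^esub> g s) {s. f s \<noteq> \<zero>\<^bsub>R\<^esub>}"

text \<open>
  Cancellation can make the support of a sum smaller than the union of the supports, so sums are
  compared over a common finite set that contains all of them.
\<close>

lemma free_lift_superset:
  assumes "module R P" "g \<in> A \<rightarrow> carrier P" "f \<in> carrier (free_module R A)"
    and "finite B" "{s. f s \<noteq> \<zero>\<^bsub>R\<^esub>} \<subseteq> B" "B \<subseteq> A"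
  shows "free_lift R P g f = finsum P (\<lambda>s. f s \<odot>\<^bsub>P\<^esub> g s) B"
proof -
  interpret P: module R P by fact
  show ?thesis
    unfolding free_lift_def
    using assms(4-) funcset_mem[OF assms(2)] assms(3)
    by (intro P.M.add.finprod_mono_neutral_cong_left) (auto simp: free_module_carrier subset_iff)
qed

lemma free_lift_linear:
  assumes P: "module R P" and g: "g \<in> A \<rightarrow> carrier P"
  shows "free_lift R P g \<in> linear_maps R (free_module R A) P"
proof -
  interpret P: module R P by fact
  interpret F: module R "free_module R A" by (rule free_module_is_module) (rule P.R.is_cring)
  have FR: "f s \<in> carrier R" if "f \<in> carrier (free_module R A)" for f s
    using that by (auto simp: free_module_carrier)
  have tm: "f s \<odot>\<^bsub>P\<^esub> g s \<in> carrier P" if "f \<in> carrier (free_module R A)" "s \<in> A" for f s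
    using that g FR by auto
  show ?thesis
  proof (rule linear_mapsI)
    fix f assume f: "f \<in> carrier (free_module R A)"
    then show "free_lift R P g f \<in> carrier P"
      unfolding free_lift_def by (intro P.M.finsum_closed) (auto simp: free_module_carrier intro!:
          P.smult_closed dest: funcset_mem[OF g])
    fix h assume h: "h \<in> carrier (free_module R A)"
    let ?B = "{s. f s \<noteq> \<zero>\<^bsub>R\<^esub>} \<union> {s. h s \<noteq> \<zero>\<^bsub>R\<^esub>}"
    have B: "finite ?B" "?B \<subseteq> A" using f h by (auto simp: free_module_carrier)
    have BA: "s \<in> A" if "s \<in> ?B" for s using B that by blast
    have "free_lift R P g (f \<oplus>\<^bsub>free_module R A\<^esub> h) =
        finsum P (\<lambda>s. (f \<oplus>\<^bsub>free_module R A\<^esub> h) s \<odot>\<^bsub>P\<^esub> g s) ?B"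
      using F.M.a_closed[OF f h] B by (intro free_lift_superset[OF P g]) auto
    also have "\<dots> = finsum P (\<lambda>s. f s \<odot>\<^bsub>P\<^esub> g s \<oplus>\<^bsub>P\<^esub> h s \<odot>\<^bsub>P\<^esub> g s) ?B"
      using f h BA[simplified] tm FR funcset_mem[OF g]
      by (intro P.M.finsum_cong' refl Pi_I) (simp_all add: P.smult_l_distr)
    also have "\<dots> = finsum P (\<lambda>s. f s \<odot>\<^bsub>P\<^esub> g s) ?B \<oplus>\<^bsub>P\<^esub> finsum P (\<lambda>s. h s \<odot>\<^bsub>P\<^esub> g s) ?B"
      using f h B tm by (intro P.M.finsum_addf) auto
    also have "\<dots> = free_lift R P g f \<oplus>\<^bsub>P\<^esub> free_lift R P g h"
      using f h B by (simp add: free_lift_superset[OF P g, of _ ?B])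
    finally show "free_lift R P g (f \<oplus>\<^bsub>free_module R A\<^esub> h) = free_lift R P g f
        \<oplus>\<^bsub>P\<^esub> free_lift R P g h" .
  next
    fix r f assume r: "r \<in> carrier R" and f: "f \<in> carrier (free_module R A)"
    let ?B = "{s. f s \<noteq> \<zero>\<^bsub>R\<^esub>}"
    have B: "finite ?B" "?B \<subseteq> A" using f by (auto simp: free_module_carrier)
    have "free_lift R P g (r \<odot>\<^bsub>free_module R A\<^esub> f) = finsum P (\<lambda>s. (r \<odot>\<^bsub>free_module R A\<^esub> f) s
        \<odot>\<^bsub>P\<^esub> g s) ?B"
      using F.smult_closed[OF r f] B r f by (intro free_lift_superset[OF P g]) auto
    also have "\<dots> = finsum P (\<lambda>s. r \<odot>\<^bsub>P\<^esub> (f s \<odot>\<^bsub>P\<^esub> g s)) ?B"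
      using f r B tm FR g by (intro P.M.finsum_cong') (auto simp: P.smult_assoc1 Pi_iff)
    also have "\<dots> = r \<odot>\<^bsub>P\<^esub> free_lift R P g f"
      unfolding free_lift_def using f r B tm by (subst P.finsum_smult_ldistr) auto
    finally show "free_lift R P g (r \<odot>\<^bsub>free_module R A\<^esub> f) = r \<odot>\<^bsub>P\<^esub> free_lift R P g f" .
  qed
qed

lemma free_lift_gen:
  assumes P: "module R P" and g: "g \<in> A \<rightarrow> carrier P" and s: "s \<in> A"
  shows "free_lift R P g (free_gen R s) = g s"
proof -
  interpret P: module R P by fact
  have "free_lift R P g (free_gen R s) = finsum P (\<lambda>t. free_gen R s t \<odot>\<^bsub>P\<^esub> g t) {s}"
    using s by (intro free_lift_superset[OF P g free_gen_carrier[OF P.R.is_cring s]])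
      (auto simp: free_gen_def)
  also have "\<dots> = g s"
    using g s by (auto simp: free_gen_def Pi_iff)
  finally show ?thesis .
qed

section \<open>Quotient modules\<close>

context
  fixes R :: "('k, 'r) ring_scheme" and M :: "('k, 'm) module" and K
  assumes M: "module R M" and K: "submodule K R M"
begin

interpretation M: module R M by (rule M)
interpretation K: submodule K R M by (rule K)
interpretation KS: abelian_subgroup K M
  by (rule abelian_subgroupI3)
     (auto intro: additive_subgroup.intro K.subgroup_axioms M.M.abelian_group_axioms)

lemma quotient_carrier: "carrier (quotient_module M K) = (\<lambda>a. K +>\<^bsub>M\<^esub> a) ` carrier M"
  by (auto simp: quotient_module_def A_RCOSETS_def')

lemma quotient_zero: "\<zero>\<^bsub>quotient_module M K\<^esub> = K +>\<^bsub>M\<^esub> \<zero>\<^bsub>M\<^esub>"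
  using KS.a_subset by (simp add: quotient_module_def)

lemma quotient_add:
  "\<lbrakk>a \<in> carrier M; b \<in> carrier M\<rbrakk> \<Longrightarrow>
     (K +>\<^bsub>M\<^esub> a) \<oplus>\<^bsub>quotient_module M K\<^esub> (K +>\<^bsub>M\<^esub> b) = K +>\<^bsub>M\<^esub> (a \<oplus>\<^bsub>M\<^esub> b)"
  by (simp add: quotient_module_def KS.a_rcos_sum)

lemma coset_subset: "a \<in> carrier M \<Longrightarrow> c \<in> K +>\<^bsub>M\<^esub> a \<Longrightarrow> \<exists>k\<in>K. c = k \<oplus>\<^bsub>M\<^esub> a"
  by (auto simp: a_r_coset_def')

lemma quotient_smult:
  assumes r: "r \<in> carrier R" and a: "a \<in> carrier M"
  shows "r \<odot>\<^bsub>quotient_module M K\<^esub> (K +>\<^bsub>M\<^esub> a) = K +>\<^bsub>M\<^esub> (r \<odot>\<^bsub>M\<^esub> a)"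
proof -
  have "K +>\<^bsub>M\<^esub> (r \<odot>\<^bsub>M\<^esub> c) = K +>\<^bsub>M\<^esub> (r \<odot>\<^bsub>M\<^esub> a)" if "c \<in> K +>\<^bsub>M\<^esub> a" for c
  proof -
    obtain k where k: "k \<in> K" "c = k \<oplus>\<^bsub>M\<^esub> a" using coset_subset[OF a \<open>c \<in> _\<close>] by blast
    then have "r \<odot>\<^bsub>M\<^esub> c = r \<odot>\<^bsub>M\<^esub> k \<oplus>\<^bsub>M\<^esub> r \<odot>\<^bsub>M\<^esub> a"
      using r a by (simp add: M.smult_r_distr)
    then have "r \<odot>\<^bsub>M\<^esub> c \<in> K +>\<^bsub>M\<^esub> (r \<odot>\<^bsub>M\<^esub> a)"
      using K.smult_closed[OF r k(1)] by (auto simp: a_r_coset_def')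
    then show ?thesis
      using r a M.M.a_repr_independence[OF _ _ K.subgroup_axioms] by (metis M.smult_closed)
  qed
  then have "(\<Union>c\<in>K +>\<^bsub>M\<^esub> a. K +>\<^bsub>M\<^esub> (r \<odot>\<^bsub>M\<^esub> c)) = (\<Union>c\<in>K +>\<^bsub>M\<^esub> a. K +>\<^bsub>M\<^esub> (r \<odot>\<^bsub>M\<^esub> a))"
    by (rule SUP_cong[OF refl])
  moreover have "K +>\<^bsub>M\<^esub> a \<noteq> {}" using KS.a_rcos_self[OF a] by blast
  ultimately show ?thesis unfolding quotient_module_def by simp
qed

lemma quotient_module_is_module: "module R (quotient_module M K)"
proof (rule moduleI)
  show "abelian_group (quotient_module M K)"
  proof (rule abelian_groupI)
    fix A assume "A \<in> carrier (quotient_module M K)"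
    then obtain a where a: "a \<in> carrier M" "A = K +>\<^bsub>M\<^esub> a" by (auto simp: quotient_carrier)
    then show "\<exists>B\<in>carrier (quotient_module M K). B \<oplus>\<^bsub>quotient_module M K\<^esub> A
        = \<zero>\<^bsub>quotient_module M K\<^esub>"
      by (auto simp: quotient_carrier quotient_add quotient_zero M.M.l_neg intro!: bexI[of _
          "\<ominus>\<^bsub>M\<^esub> a"])
  qed (simp_all add: quotient_carrier, auto simp: quotient_add quotient_zero M.M.a_ac)
qed (auto simp: quotient_carrier quotient_add quotient_smult M.R.is_cring
      M.smult_l_distr M.smult_r_distr M.smult_assoc1)

lemma quotient_map_linear: "(\<lambda>a. K +>\<^bsub>M\<^esub> a) \<in> linear_maps R M (quotient_module M K)"
  by (rule linear_mapsI) (auto simp: quotient_carrier quotient_add quotient_smult)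

lemma quotient_map_kernel: "k \<in> K \<Longrightarrow> K +>\<^bsub>M\<^esub> k = \<zero>\<^bsub>quotient_module M K\<^esub>"
  by (simp add: quotient_module_def KS.a_rcos_const)

text \<open>
  This is why \<open>the_elem\<close> in the definition of \<open>tensor_lift\<close> picks the value of a
  well-defined map on cosets.
\<close>

lemma linear_image_coset:
  assumes P: "module R P" and g: "g \<in> linear_maps R M P"
    and 0: "\<And>k. k \<in> K \<Longrightarrow> g k = \<zero>\<^bsub>P\<^esub>" and a: "a \<in> carrier M"
  shows "g ` (K +>\<^bsub>M\<^esub> a) = {g a}"
proof -
  interpret P: module R P by fact
  have "g c = g a" if "c \<in> K +>\<^bsub>M\<^esub> a" for c
  proof -
    obtain k where k: "k \<in> K" "c = k \<oplus>\<^bsub>M\<^esub> a" using coset_subset[OF a \<open>c \<in> _\<close>] by blast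
    then show ?thesis using a 0[OF k(1)] linear_closed[OF g] by (simp add: linear_add[OF g])
  qed
  moreover have "a \<in> K +>\<^bsub>M\<^esub> a" using a by (rule KS.a_rcos_self)
  ultimately show ?thesis by blast
qed

end

lemma linear_kernel_submodule:
  assumes M: "module R M" and P: "module R P" and g: "g \<in> linear_maps R M P"
  shows "submodule {a \<in> carrier M. g a = \<zero>\<^bsub>P\<^esub>} R M"
proof -
  interpret M: module R M by fact
  interpret P: module R P by fact
  show ?thesis
    by (rule M.submoduleI)
       (auto simp: linear_zero[OF M P g] linear_neg[OF M P g] linear_add[OF g] linear_smult[OF g])
qed

section \<open>Tensor products\<close>

lemma tensor_relations_carrier:
  assumes M: "module R M" and N: "module R N"
  shows "tensor_relations R M N \<subseteq> carrier (free_module R (carrier M \<times> carrier N))"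
proof -
  interpret M: module R M by fact
  interpret N: module R N by fact
  interpret F: module R "free_module R (carrier M \<times> carrier N)"
    by (rule free_module_is_module) (rule M.R.is_cring)
  have gen: "free_gen R (m, n) \<in> carrier (free_module R (carrier M \<times> carrier N))"
    if "m \<in> carrier M" "n \<in> carrier N" for m n
    using that by (intro free_gen_carrier M.R.is_cring) auto
  show ?thesis
    unfolding tensor_relations_def Let_def
    by (auto simp del: free_module_simps intro!: F.M.minus_closed F.M.a_closed F.smult_closed gen)
qed

lemma tensor_kernel_submodule:
  assumes M: "module R M" and N: "module R N"
  shows "submodule (tensor_kernel R M N) R (free_module R (carrier M \<times> carrier N))"
proof -
  let ?F = "free_module R (carrier M \<times> carrier N)"
  interpret M: module R M by fact
  interpret F: module R ?F
    by (rule free_module_is_module) (rule M.R.is_cring)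
  have 0: "submodule (carrier ?F) R ?F" by (rule F.carrier_is_submodule)
  have z: "\<zero>\<^bsub>?F\<^esub> \<in> K" if "submodule K R ?F" for K
    using submodule.axioms(1)[OF that] subgroup.one_closed by fastforce
  show ?thesis
    by (rule F.submoduleI)
       (use 0 tensor_relations_carrier[OF M N] in
         \<open>auto simp: tensor_kernel_def simp del: free_module_simps intro: z F.submoduleE\<close>)
qed

lemma tensor_kernel_relations: "tensor_relations R M N \<subseteq> tensor_kernel R M N"
  by (auto simp: tensor_kernel_def)

lemma tensor_kernel_least:
  "submodule K R (free_module R (carrier M \<times> carrier N)) \<Longrightarrow> tensor_relations R M N \<subseteq> K
    \<Longrightarrow> tensor_kernel R M N \<subseteq> K"
  by (auto simp: tensor_kernel_def)

lemma tensor_is_module: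
  assumes M: "module R M" and N: "module R N"
  shows "module R (tensor R M N)"
  unfolding tensor_def
  by (intro quotient_module_is_module free_module_is_module tensor_kernel_submodule assms)
     (rule module.axioms(1)[OF M])


lemma tensor_carrierE:
  assumes M: "module R M" and N: "module R N" and t: "t \<in> carrier (tensor R M N)"
  obtains f where "f \<in> carrier (free_module R (carrier M \<times> carrier N))"
    "t = tensor_kernel R M N +>\<^bsub>free_module R (carrier M \<times> carrier N)\<^esub> f"
proof -
  have "module R (free_module R (carrier M \<times> carrier N))"
    by (intro free_module_is_module module.axioms(1)[OF M])
  from quotient_carrier[OF this tensor_kernel_submodule[OF M N]] t that show ?thesis
    by (auto simp: tensor_def)
qed

definition bilinear ::
  "('k, 'r) ring_scheme \<Rightarrow> ('k, 'm) module \<Rightarrow> ('k, 'n) module \<Rightarrow> ('k, 'p) module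
   \<Rightarrow> ('m \<Rightarrow> 'n \<Rightarrow> 'p) \<Rightarrow> bool" where
  "bilinear R M N P b \<longleftrightarrow> (\<forall>m\<in>carrier M. b m \<in> linear_maps R N P) \<and>
     (\<forall>n\<in>carrier N. (\<lambda>m. b m n) \<in> linear_maps R M P)"

lemma bilinearI:
  assumes "\<And>m. m \<in> carrier M \<Longrightarrow> (\<lambda>n. b m n) \<in> linear_maps R N P"
    and "\<And>n. n \<in> carrier N \<Longrightarrow> (\<lambda>m. b m n) \<in> linear_maps R M P"
  shows "bilinear R M N P b"
  using assms by (simp add: bilinear_def)

lemma bilinearD:
  assumes "bilinear R M N P b"
  shows bilinear_right: "m \<in> carrier M \<Longrightarrow> (\<lambda>n. b m n) \<in> linear_maps R N P"
    and bilinear_left: "n \<in> carrier N \<Longrightarrow> (\<lambda>m. b m n) \<in> linear_maps R M P"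
  using assms by (simp_all add: bilinear_def)

lemma bilinear_closed:
  "\<lbrakk>bilinear R M N P b; m \<in> carrier M; n \<in> carrier N\<rbrakk> \<Longrightarrow> b m n \<in> carrier P"
  by (rule linear_closed[OF bilinear_right])

lemma tensor_elt_bilinear:
  assumes M: "module R M" and N: "module R N"
  shows "bilinear R M N (tensor R M N) (tensor_elt R M N)"
proof -
  let ?F = "free_module R (carrier M \<times> carrier N)" and ?K = "tensor_kernel R M N"
  let ?q = "\<lambda>f. ?K +>\<^bsub>?F\<^esub> f" and ?\<delta> = "\<lambda>m n. free_gen R (m, n)"
  have F: "module R ?F" by (intro free_module_is_module module.axioms(1)[OF M])
  interpret M: module R M by fact
  interpret N: module R N by fact
  interpret F: module R ?F by fact
  interpret T: module R "tensor R M N" by (rule tensor_is_module[OF M N])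
  have q: "?q \<in> linear_maps R ?F (tensor R M N)"
    unfolding tensor_def by (rule quotient_map_linear[OF F tensor_kernel_submodule[OF M N]])
  have gen: "?\<delta> m n \<in> carrier ?F" if "m \<in> carrier M" "n \<in> carrier N" for m n
    using that by (intro free_gen_carrier M.R.is_cring) auto
  have eq: "?q a = ?q b" if "a \<in> carrier ?F" "b \<in> carrier ?F" "a \<ominus>\<^bsub>?F\<^esub> b \<in> tensor_relations R M N"
      for a b
  proof -
    have "?q (a \<ominus>\<^bsub>?F\<^esub> b) = \<zero>\<^bsub>tensor R M N\<^esub>"
      unfolding tensor_def
      using that(3) tensor_kernel_relations
          by (intro quotient_map_kernel[OF F tensor_kernel_submodule[OF M N]]) blast
    moreover have "?q (a \<ominus>\<^bsub>?F\<^esub> b) = ?q a \<ominus>\<^bsub>tensor R M N\<^esub> ?q b"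
      unfolding F.M.minus_eq T.M.minus_eq
      using that linear_add[OF q, of a "\<ominus>\<^bsub>?F\<^esub> b"] linear_neg[OF F T.module_axioms q, of b] by simp
    ultimately show ?thesis
      using linear_closed[OF q that(1)] linear_closed[OF q that(2)]
      by (metis T.M.minus_eq T.M.add.inv_closed T.M.minus_equality T.M.minus_minus)
  qed
  have al: "?q (?\<delta> (m \<oplus>\<^bsub>M\<^esub> m') n) = ?q (?\<delta> m n \<oplus>\<^bsub>?F\<^esub> ?\<delta> m' n)"
    if "m \<in> carrier M" "m' \<in> carrier M" "n \<in> carrier N" for m m' n
    by (rule eq) (use that gen in \<open>simp_all del: free_module_simps\<close>,
        unfold tensor_relations_def Let_def, use that in blast)
  have ar: "?q (?\<delta> m (n \<oplus>\<^bsub>N\<^esub> n')) = ?q (?\<delta> m n \<oplus>\<^bsub>?F\<^esub> ?\<delta> m n')"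
    if "m \<in> carrier M" "n \<in> carrier N" "n' \<in> carrier N" for m n n'
    by (rule eq) (use that gen in \<open>simp_all del: free_module_simps\<close>,
        unfold tensor_relations_def Let_def, use that in blast)
  have sl: "?q (?\<delta> (r \<odot>\<^bsub>M\<^esub> m) n) = ?q (r \<odot>\<^bsub>?F\<^esub> ?\<delta> m n)"
    if "r \<in> carrier R" "m \<in> carrier M" "n \<in> carrier N" for r m n
    by (rule eq) (use that gen in \<open>simp_all del: free_module_simps\<close>,
        unfold tensor_relations_def Let_def, use that in blast)
  have sr: "?q (?\<delta> m (r \<odot>\<^bsub>N\<^esub> n)) = ?q (r \<odot>\<^bsub>?F\<^esub> ?\<delta> m n)"
    if "r \<in> carrier R" "m \<in> carrier M" "n \<in> carrier N" for r m n
    by (rule eq) (use that gen in \<open>simp_all del: free_module_simps\<close>,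
        unfold tensor_relations_def Let_def, use that in blast)
  show ?thesis
    unfolding bilinear_def tensor_elt_def
    by (auto simp: linear_closed[OF q] gen al ar sl sr linear_add[OF q] linear_smult[OF q]
        simp del: free_module_simps intro!: linear_mapsI)
qed

text \<open>
  The tensor relations express bilinearity, so the linear extension of a bilinear map to the free
  module kills them, hence kills the submodule they generate and is constant on its cosets.
\<close>

lemma tensor_lift_coset:
  assumes M: "module R M" and N: "module R N" and P: "module R P" and b: "bilinear R M N P b"
    and f: "f \<in> carrier (free_module R (carrier M \<times> carrier N))"
  shows "tensor_lift R P b (tensor_kernel R M N +>\<^bsub>free_module R (carrier M \<times> carrier N)\<^esub> f)
    = free_lift R P (\<lambda>(m, n). b m n) f"
proof -
  let ?F = "free_module R (carrier M \<times> carrier N)" and ?K = "tensor_kernel R M N"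
  let ?L = "free_lift R P (\<lambda>(m, n). b m n)" and ?\<delta> = "\<lambda>m n. free_gen R (m, n)"
  have F: "module R ?F" by (intro free_module_is_module module.axioms(1)[OF M])
  interpret M: module R M by fact
  interpret N: module R N by fact
  interpret P: module R P by fact
  interpret F: module R ?F by fact
  have bc: "(\<lambda>(m, n). b m n) \<in> carrier M \<times> carrier N \<rightarrow> carrier P"
    using bilinear_closed[OF b] by auto
  have L: "?L \<in> linear_maps R ?F P" by (rule free_lift_linear[OF P bc])
  have gen: "?\<delta> m n \<in> carrier ?F" if "m \<in> carrier M" "n \<in> carrier N" for m n
    using that by (intro free_gen_carrier M.R.is_cring) auto
  have Lg: "?L (?\<delta> m n) = b m n" if "m \<in> carrier M" "n \<in> carrier N" for m n
    using free_lift_gen[OF P bc] that by simp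
  have Lm: "?L (x \<ominus>\<^bsub>?F\<^esub> y) = ?L x \<ominus>\<^bsub>P\<^esub> ?L y" if "x \<in> carrier ?F" "y \<in> carrier ?F" for x y
    unfolding F.M.minus_eq P.M.minus_eq
    using that linear_add[OF L, of x "\<ominus>\<^bsub>?F\<^esub> y"] linear_neg[OF F P L, of y] by simp
  have Pm: "x \<ominus>\<^bsub>P\<^esub> x = \<zero>\<^bsub>P\<^esub>" if "x \<in> carrier P" for x
    using that by (simp add: P.M.minus_eq P.M.r_neg)
  have rel: "tensor_relations R M N \<subseteq> {a \<in> carrier ?F. ?L a = \<zero>\<^bsub>P\<^esub>}"
  proof
    fix a assume a: "a \<in> tensor_relations R M N"
    then have "a \<in> carrier ?F" using tensor_relations_carrier[OF M N] by blast
    moreover have "?L a = \<zero>\<^bsub>P\<^esub>"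
      using a unfolding tensor_relations_def Let_def
      by (elim UnE CollectE exE conjE)
         (simp_all add: Pm Lm gen Lg linear_add[OF L] linear_smult[OF L] bilinear_closed[OF b]
          linear_add[OF bilinear_left[OF b]] linear_add[OF bilinear_right[OF b]]
          linear_smult[OF bilinear_left[OF b]] linear_smult[OF bilinear_right[OF b]]
          del: free_module_simps)
    ultimately show "a \<in> {a \<in> carrier ?F. ?L a = \<zero>\<^bsub>P\<^esub>}" by simp
  qed
  have ker: "?L k = \<zero>\<^bsub>P\<^esub>" if "k \<in> ?K" for k
    using tensor_kernel_least[OF linear_kernel_submodule[OF F P L] rel] that by blast
  have "?L ` (?K +>\<^bsub>?F\<^esub> f) = {?L f}"
    by (rule linear_image_coset[OF F tensor_kernel_submodule[OF M N] P L ker f])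
  moreover have "?L = (\<lambda>f. finsum P (\<lambda>(m, n). f (m, n) \<odot>\<^bsub>P\<^esub> b m n) {s. f s \<noteq> \<zero>\<^bsub>R\<^esub>})"
    unfolding free_lift_def by (intro ext arg_cong2[where f = "finsum P"]) auto
  ultimately show ?thesis unfolding tensor_lift_def by simp
qed

lemma tensor_elt_closed:
  "\<lbrakk>module R M; module R N; m \<in> carrier M; n \<in> carrier N\<rbrakk>
    \<Longrightarrow> tensor_elt R M N m n \<in> carrier (tensor R M N)"
  by (rule bilinear_closed[OF tensor_elt_bilinear])

lemma tensor_lift_elt:
  assumes M: "module R M" and N: "module R N" and P: "module R P" and b: "bilinear R M N P b"
    and m: "m \<in> carrier M" and n: "n \<in> carrier N"
  shows "tensor_lift R P b (tensor_elt R M N m n) = b m n"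
proof -
  have bc: "(\<lambda>(m, n). b m n) \<in> carrier M \<times> carrier N \<rightarrow> carrier P"
    using bilinear_closed[OF b] by auto
  have "free_gen R (m, n) \<in> carrier (free_module R (carrier M \<times> carrier N))"
    using m n by (intro free_gen_carrier module.axioms(1)[OF M]) auto
  then show ?thesis
    unfolding tensor_elt_def tensor_lift_coset[OF M N P b \<open>free_gen R (m, n) \<in> _\<close>]
    using free_lift_gen[OF P bc, of "(m, n)"] m n by simp
qed

lemma tensor_lift_linear:
  assumes M: "module R M" and N: "module R N" and P: "module R P" and b: "bilinear R M N P b"
  shows "tensor_lift R P b \<in> linear_maps R (tensor R M N) P"
proof -
  let ?F = "free_module R (carrier M \<times> carrier N)"
  have F: "module R ?F" by (intro free_module_is_module module.axioms(1)[OF M])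
  interpret F: module R ?F by fact
  note K = tensor_kernel_submodule[OF M N]
  have bc: "(\<lambda>(m, n). b m n) \<in> carrier M \<times> carrier N \<rightarrow> carrier P"
    using bilinear_closed[OF b] by auto
  note L = free_lift_linear[OF P bc] and lc = tensor_lift_coset[OF M N P b]
  show ?thesis
  proof (rule linear_mapsI)
    fix s assume "s \<in> carrier (tensor R M N)"
    then obtain f where f: "f \<in> carrier ?F" "s = tensor_kernel R M N +>\<^bsub>?F\<^esub> f"
      by (rule tensor_carrierE[OF M N])
    then show "tensor_lift R P b s \<in> carrier P" by (simp add: lc linear_closed[OF L])
    show "tensor_lift R P b (r \<odot>\<^bsub>tensor R M N\<^esub> s) = r \<odot>\<^bsub>P\<^esub> tensor_lift R P b s" if "r \<in> carrier R"
        for r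
      using f that unfolding tensor_def
      by (simp add: quotient_smult[OF F K] lc linear_smult[OF L] F.smult_closed del:
          free_module_simps)
    fix t assume "t \<in> carrier (tensor R M N)"
    then obtain g where g: "g \<in> carrier ?F" "t = tensor_kernel R M N +>\<^bsub>?F\<^esub> g"
      by (rule tensor_carrierE[OF M N])
    show "tensor_lift R P b (s \<oplus>\<^bsub>tensor R M N\<^esub> t) = tensor_lift R P b s \<oplus>\<^bsub>P\<^esub> tensor_lift R P b t"
      using f g unfolding tensor_def
      by (simp add: quotient_add[OF F K] lc linear_add[OF L] F.M.a_closed del: free_module_simps)
  qed
qed

text \<open>
  A scalar multiple of a pure tensor is again pure, since the scalar can be absorbed into the left
  factor; hence sums of pure tensors exhaust the tensor product.
\<close>

lemma tensor_induct [consumes 3, case_names zero add elt]: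
  assumes M: "module R M" and N: "module R N" and t: "t \<in> carrier (tensor R M N)"
    and zero: "P \<zero>\<^bsub>tensor R M N\<^esub>"
    and add: "\<And>s t. \<lbrakk>s \<in> carrier (tensor R M N); t \<in> carrier (tensor R M N); P s; P t\<rbrakk>
      \<Longrightarrow> P (s \<oplus>\<^bsub>tensor R M N\<^esub> t)"
    and elt: "\<And>m n. \<lbrakk>m \<in> carrier M; n \<in> carrier N\<rbrakk> \<Longrightarrow> P (tensor_elt R M N m n)"
  shows "P t"
proof -
  let ?F = "free_module R (carrier M \<times> carrier N)" and ?K = "tensor_kernel R M N"
  let ?q = "\<lambda>f. ?K +>\<^bsub>?F\<^esub> f"
  have R: "cring R" by (rule module.axioms(1)[OF M])
  have F: "module R ?F" by (rule free_module_is_module[OF R])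
  interpret M: module R M by fact
  have q: "?q \<in> linear_maps R ?F (tensor R M N)"
    unfolding tensor_def by (rule quotient_map_linear[OF F tensor_kernel_submodule[OF M N]])
  obtain f where f: "f \<in> carrier ?F" "t = ?q f"
    using t by (rule tensor_carrierE[OF M N])
  have "P (?q f)"
    using R f(1)
  proof (induction f rule: free_module_induct)
    case zero
    show ?case
      using assms(4) linear_zero[OF F tensor_is_module[OF M N] q] by simp
  next
    case (add f g)
    then show ?case
      using assms(5)[of "?q f" "?q g"] linear_closed[OF q] linear_add[OF q, of f g] by simp
  next
    case (gen r s)
    obtain m n where s: "s = (m, n)" "m \<in> carrier M" "n \<in> carrier N" using gen(2) by auto
    have "?q (\<lambda>t. r \<otimes>\<^bsub>R\<^esub> free_gen R s t) = r \<odot>\<^bsub>tensor R M N\<^esub> ?q (free_gen R s)"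
      using linear_smult[OF q gen(1) free_gen_carrier[OF R gen(2)]] by simp
    also have "\<dots> = tensor_elt R M N (r \<odot>\<^bsub>M\<^esub> m) n"
      using linear_smult[OF bilinear_left[OF tensor_elt_bilinear[OF M N] s(3)] gen(1) s(2)]
      by (simp add: s(1) tensor_elt_def)
    finally show ?case using elt gen(1) s by simp
  qed
  then show ?thesis using f(2) by simp
qed

text \<open>
  The uniqueness half of the universal property. Identities between tensor expressions are reduced
  to pure tensors by it.
\<close>

lemma tensor_ext:
  assumes M: "module R M" and N: "module R N" and P: "module R P"
    and f: "f \<in> linear_maps R (tensor R M N) P" and g: "g \<in> linear_maps R (tensor R M N) P"
    and elt: "\<And>m n. \<lbrakk>m \<in> carrier M; n \<in> carrier N\<rbrakk> \<Longrightarrow> f (tensor_elt R M N m n)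
        = g (tensor_elt R M N m n)"
    and t: "t \<in> carrier (tensor R M N)"
  shows "f t = g t"
  using M N t
proof (induction t rule: tensor_induct)
  case zero
  show ?case
    using linear_zero[OF tensor_is_module[OF M N] P f] linear_zero[OF tensor_is_module[OF M N] P g]
    by simp
qed (simp_all add: elt linear_add[OF f] linear_add[OF g])

lemma bilinear_cong:
  assumes M: "module R M" and N: "module R N" and b': "bilinear R M N P b'"
    and eq: "\<And>m n. \<lbrakk>m \<in> carrier M; n \<in> carrier N\<rbrakk> \<Longrightarrow> b m n = b' m n"
  shows "bilinear R M N P b"
proof (rule bilinearI)
  fix m assume m: "m \<in> carrier M"
  show "(\<lambda>n. b m n) \<in> linear_maps R N P"
    by (rule linear_cong[OF N bilinear_right[OF b' m]]) (simp add: eq m)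
next
  fix n assume n: "n \<in> carrier N"
  show "(\<lambda>m. b m n) \<in> linear_maps R M P"
    by (rule linear_cong[OF M bilinear_left[OF b' n]]) (simp add: eq n)
qed

lemma tensor_lift_cong:
  assumes M: "module R M" and N: "module R N" and P: "module R P" and b': "bilinear R M N P b'"
    and t: "t \<in> carrier (tensor R M N)"
    and eq: "\<And>m n. \<lbrakk>m \<in> carrier M; n \<in> carrier N\<rbrakk> \<Longrightarrow> b m n = b' m n"
  shows "tensor_lift R P b t = tensor_lift R P b' t"
proof -
  interpret M: module R M by fact
  interpret N: module R N by fact
  have b: "bilinear R M N P b" by (rule bilinear_cong[OF M N b' eq])
  show ?thesis
    by (rule tensor_ext[OF M N P tensor_lift_linear[OF M N P b] tensor_lift_linear[OF M N P b'] _
        t])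
       (simp add: tensor_lift_elt[OF M N P b] tensor_lift_elt[OF M N P b'] eq)
qed


lemma linear_sum:
  assumes P: "module R P" and f: "f \<in> linear_maps R M P" and g: "g \<in> linear_maps R M P"
  shows "(\<lambda>x. f x \<oplus>\<^bsub>P\<^esub> g x) \<in> linear_maps R M P"
proof -
  interpret P: module R P by fact
  show ?thesis
    by (rule linear_mapsI)
       (simp_all add: linear_closed[OF f] linear_closed[OF g] linear_add[OF f] linear_add[OF g]
         linear_smult[OF f] linear_smult[OF g] P.smult_r_distr P.M.a_ac)
qed

lemma tensor_lift_closed:
  assumes "module R M" "module R N" "module R P" "bilinear R M N P b" "t \<in> carrier (tensor R M N)"
  shows "tensor_lift R P b t \<in> carrier P"
  using assms by (intro linear_closed[OF tensor_lift_linear])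

lemma linear_tensor_elt_left:
  assumes "module R M" "module R N" "f \<in> linear_maps R K M" "n \<in> carrier N"
  shows "(\<lambda>x. tensor_elt R M N (f x) n) \<in> linear_maps R K (tensor R M N)"
  by (rule linear_comp[OF bilinear_left[OF tensor_elt_bilinear] assms(3)]) fact+

lemma linear_tensor_elt_right:
  assumes "module R M" "module R N" "f \<in> linear_maps R K N" "m \<in> carrier M"
  shows "(\<lambda>x. tensor_elt R M N m (f x)) \<in> linear_maps R K (tensor R M N)"
  by (rule linear_comp[OF bilinear_right[OF tensor_elt_bilinear] assms(3)]) fact+

lemma linear_tensor_lift_arg:
  assumes "module R M" "module R N" "module R P" "bilinear R M N P b"
    and "f \<in> linear_maps R K (tensor R M N)"
  shows "(\<lambda>x. tensor_lift R P b (f x)) \<in> linear_maps R K P"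
  by (rule linear_comp[OF tensor_lift_linear[OF assms(1-4)] assms(5)])

text \<open>
  Sweedler sums are nested, so the linear dependence of a sum on a parameter of its summand is what
  makes the outer sum well-defined. An element \<open>t\<close> has no canonical expression by pure tensors;
  induction on \<open>t\<close> avoids choosing one.
\<close>

lemma linear_tensor_lift_param:
  assumes K: "module R K" and M: "module R M" and N: "module R N" and P: "module R P"
    and b: "\<And>x. x \<in> carrier K \<Longrightarrow> bilinear R M N P (b x)"
    and l: "\<And>m n. \<lbrakk>m \<in> carrier M; n \<in> carrier N\<rbrakk> \<Longrightarrow> (\<lambda>x. b x m n) \<in> linear_maps R K P"
    and t: "t \<in> carrier (tensor R M N)"
  shows "(\<lambda>x. tensor_lift R P (b x) t) \<in> linear_maps R K P"
  using M N t
proof (induction t rule: tensor_induct)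
  case zero
  show ?case
    by (rule linear_cong[OF K linear_const_zero[OF P]])
       (rule linear_zero[OF tensor_is_module[OF M N] P tensor_lift_linear[OF M N P b]])
next
  case (add s t)
  show ?case
    by (rule linear_cong[OF K linear_sum[OF P add(3,4)]])
       (rule linear_add[OF tensor_lift_linear[OF M N P b] add(1,2)])
next
  case (elt m n)
  show ?case
    by (rule linear_cong[OF K l[OF elt]]) (rule tensor_lift_elt[OF M N P b elt])
qed

lemma linear_tensor_lift:
  assumes M: "module R M" and N: "module R N" and P: "module R P" and Q: "module R Q"
    and b: "bilinear R M N P b" and f: "f \<in> linear_maps R P Q"
    and t: "t \<in> carrier (tensor R M N)"
  shows "f (tensor_lift R P b t) = tensor_lift R Q (\<lambda>m n. f (b m n)) t"
proof -
  have fb: "bilinear R M N Q (\<lambda>m n. f (b m n))"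
    by (intro bilinearI linear_comp[OF f] bilinearD[OF b])
  show ?thesis
    by (rule tensor_ext[OF M N Q linear_comp[OF f tensor_lift_linear[OF M N P b]]
        tensor_lift_linear[OF M N Q fb] _ t])
       (simp add: tensor_lift_elt[OF M N P b] tensor_lift_elt[OF M N Q fb])
qed

lemma tensor_map_bilinear:
  assumes "module R P" "module R Q" "f \<in> linear_maps R M P" "g \<in> linear_maps R N Q"
  shows "bilinear R M N (tensor R P Q) (\<lambda>m n. tensor_elt R P Q (f m) (g n))"
  using assms by (intro bilinearI linear_tensor_elt_left linear_tensor_elt_right linear_closed[of
      f] linear_closed[of g])

lemma tensor_map_linear:
  assumes "module R M" "module R N" "module R P" "module R Q"
    and "f \<in> linear_maps R M P" "g \<in> linear_maps R N Q"
  shows "tensor_map R P Q f g \<in> linear_maps R (tensor R M N) (tensor R P Q)"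
  unfolding tensor_map_def using assms
  by (intro tensor_lift_linear tensor_is_module tensor_map_bilinear)

lemma tensor_map_elt:
  assumes "module R M" "module R N" "module R P" "module R Q"
    and "f \<in> linear_maps R M P" "g \<in> linear_maps R N Q" "m \<in> carrier M" "n \<in> carrier N"
  shows "tensor_map R P Q f g (tensor_elt R M N m n) = tensor_elt R P Q (f m) (g n)"
  unfolding tensor_map_def using assms
  by (intro tensor_lift_elt tensor_is_module tensor_map_bilinear)

lemma tensor_map_closed:
  assumes "module R M" "module R N" "module R P" "module R Q"
    and "f \<in> linear_maps R M P" "g \<in> linear_maps R N Q" "t \<in> carrier (tensor R M N)"
  shows "tensor_map R P Q f g t \<in> carrier (tensor R P Q)"
  by (rule linear_closed[OF tensor_map_linear[OF assms(1-6)] assms(7)])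

lemma tensor_lift_tensor_map:
  assumes M: "module R M" and N: "module R N" and P: "module R P" and Q: "module R Q"
    and L: "module R L" and f: "f \<in> linear_maps R M P" and g: "g \<in> linear_maps R N Q"
    and b: "bilinear R P Q L b" and t: "t \<in> carrier (tensor R M N)"
  shows "tensor_lift R L b (tensor_map R P Q f g t) = tensor_lift R L (\<lambda>m n. b (f m) (g n)) t"
proof -
  have "tensor_lift R L b (tensor_map R P Q f g t) =
    tensor_lift R L (\<lambda>m n. tensor_lift R L b (tensor_elt R P Q (f m) (g n))) t"
    unfolding tensor_map_def
    by (rule linear_tensor_lift[OF M N tensor_is_module[OF P Q] L tensor_map_bilinear[OF P Q f g]
        tensor_lift_linear[OF P Q L b] t])
  also have "\<dots> = tensor_lift R L (\<lambda>m n. b (f m) (g n)) t"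
  proof (rule tensor_lift_cong[OF M N L _ t])
    show "bilinear R M N L (\<lambda>m n. b (f m) (g n))"
      by (intro bilinearI linear_comp[OF bilinear_left[OF b] f] linear_comp[OF bilinear_right[OF
          b] g]
          linear_closed[OF f] linear_closed[OF g])
  qed (simp add: tensor_lift_elt[OF P Q L b] linear_closed[OF f] linear_closed[OF g])
  finally show ?thesis .
qed

text \<open>
  Fubini for double sums over two independent tensors: both sides are linear in \<open>t\<close>, and for a pure
  tensor \<open>t\<close> the sum over \<open>t\<close> disappears.
\<close>

lemma tensor_lift_swap:
  assumes M: "module R M" and N: "module R N" and M': "module R M'" and N': "module R N'"
    and P: "module R P"
    and b: "\<And>m n. \<lbrakk>m \<in> carrier M; n \<in> carrier N\<rbrakk> \<Longrightarrow> bilinear R M' N' P (b m n)"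
    and b': "\<And>m' n'. \<lbrakk>m' \<in> carrier M'; n' \<in> carrier N'\<rbrakk> \<Longrightarrow> bilinear R M N P (\<lambda>m n. b m n m' n')"
    and s: "s \<in> carrier (tensor R M N)" and t: "t \<in> carrier (tensor R M' N')"
  shows "tensor_lift R P (\<lambda>m n. tensor_lift R P (b m n) t) s =
    tensor_lift R P (\<lambda>m' n'. tensor_lift R P (\<lambda>m n. b m n m' n') s) t"
proof -
  have l1: "bilinear R M N P (\<lambda>m n. tensor_lift R P (b m n) t)" if "t \<in> carrier (tensor R M' N')"
      for t
    by (intro bilinearI linear_tensor_lift_param[OF _ M' N' P] M N b bilinearD[OF b'] that)
  have l2: "bilinear R M' N' P (\<lambda>m' n'. tensor_lift R P (\<lambda>m n. b m n m' n') s)"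
    by (intro bilinearI linear_tensor_lift_param[OF _ M N P] M' N' b' bilinearD[OF b] s)
  have hopf_intros: "(\<lambda>t. tensor_lift R P (\<lambda>m n. tensor_lift R P (b m n) t) s)
      \<in> linear_maps R (tensor R M' N') P"
    by (intro linear_tensor_lift_param[OF tensor_is_module[OF M' N'] M N P] l1
        tensor_lift_linear[OF M' N' P] b s)
  show ?thesis
  proof (rule tensor_ext[OF M' N' P hopf_intros tensor_lift_linear[OF M' N' P l2] _ t])
    fix m' n' assume mn: "m' \<in> carrier M'" "n' \<in> carrier N'"
    have "tensor_lift R P (\<lambda>m n. tensor_lift R P (b m n) (tensor_elt R M' N' m' n')) s =
      tensor_lift R P (\<lambda>m n. b m n m' n') s"
      by (rule tensor_lift_cong[OF M N P b'[OF mn] s]) (rule tensor_lift_elt[OF M' N' P b mn])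
    also have "\<dots> = tensor_lift R P (\<lambda>m' n'. tensor_lift R P (\<lambda>m n. b m n m' n') s) (tensor_elt R
        M' N' m' n')"
      by (rule tensor_lift_elt[OF M' N' P l2 mn, symmetric])
    finally show "tensor_lift R P (\<lambda>m n. tensor_lift R P (b m n) (tensor_elt R M' N' m' n')) s =
      tensor_lift R P (\<lambda>m' n'. tensor_lift R P (\<lambda>m n. b m n m' n') s) (tensor_elt R M' N' m' n')" .
  qed
qed

lemma tensor_eta:
  assumes M: "module R M" and N: "module R N" and t: "t \<in> carrier (tensor R M N)"
  shows "tensor_lift R (tensor R M N) (tensor_elt R M N) t = t"
  by (rule tensor_ext[OF M N tensor_is_module[OF M N]
      tensor_lift_linear[OF M N tensor_is_module[OF M N] tensor_elt_bilinear[OF M N]] linear_id _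
          t])
     (rule tensor_lift_elt[OF M N tensor_is_module[OF M N] tensor_elt_bilinear[OF M N]])

section \<open>Flip, associator and middle flip on pure tensors\<close>

lemma
  assumes M: "module R M"
  shows tensor_lunit_bilinear: "bilinear R (regular_module R) M M (\<lambda>r m. r \<odot>\<^bsub>M\<^esub> m)"
    and tensor_runit_bilinear: "bilinear R M (regular_module R) M (\<lambda>m r. r \<odot>\<^bsub>M\<^esub> m)"
  by (intro bilinearI linear_smult_left linear_smult_right M linear_id; simp add:
      regular_module_def)+

context
  fixes R :: "('k, 'r) ring_scheme" and M :: "('k, 'm) module" and N :: "('k, 'n) module"
  assumes M: "module R M" and N: "module R N"
begin

lemma tensor_flip_bilinear: "bilinear R M N (tensor R N M) (\<lambda>m n. tensor_elt R N M n m)"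
  by (intro bilinearI linear_tensor_elt_left linear_tensor_elt_right M N linear_id)

lemma tensor_flip_linear: "tensor_flip R M N \<in> linear_maps R (tensor R M N) (tensor R N M)"
  unfolding tensor_flip_def
  by (intro tensor_lift_linear tensor_is_module M N tensor_flip_bilinear)

lemma tensor_flip_elt:
  "\<lbrakk>m \<in> carrier M; n \<in> carrier N\<rbrakk>
    \<Longrightarrow> tensor_flip R M N (tensor_elt R M N m n) = tensor_elt R N M n m"
  unfolding tensor_flip_def
  by (intro tensor_lift_elt tensor_is_module M N tensor_flip_bilinear)

lemma tensor_assoc_param:
  assumes P: "module R P" and p: "p \<in> carrier P"
  shows "bilinear R M N (tensor R M (tensor R N P))
    (\<lambda>m n. tensor_elt R M (tensor R N P) m (tensor_elt R N P n p))"
  by (intro bilinearI linear_tensor_elt_left linear_tensor_elt_right M N P tensor_is_module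
      tensor_elt_closed linear_id p)

lemma tensor_assoc_bilinear:
  assumes P: "module R P"
  shows "bilinear R (tensor R M N) P (tensor R M (tensor R N P))
    (\<lambda>t p. tensor_lift R (tensor R M (tensor R N P))
      (\<lambda>m n. tensor_elt R M (tensor R N P) m (tensor_elt R N P n p)) t)"
  by (intro bilinearI tensor_lift_linear linear_tensor_lift_param[OF _ M N] M N P tensor_is_module
      tensor_assoc_param linear_tensor_elt_right linear_id)

lemma tensor_assoc_linear:
  assumes P: "module R P"
  shows "tensor_assoc R M N P \<in> linear_maps R (tensor R (tensor R M N) P) (tensor R M (tensor R N
      P))"
  unfolding tensor_assoc_def Let_def
  by (intro tensor_lift_linear tensor_is_module M N P tensor_assoc_bilinear)

lemma tensor_assoc_elt:
  assumes P: "module R P" and m: "m \<in> carrier M" and n: "n \<in> carrier N" and p: "p \<in> carrier P"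
  shows "tensor_assoc R M N P (tensor_elt R (tensor R M N) P (tensor_elt R M N m n) p)
    = tensor_elt R M (tensor R N P) m (tensor_elt R N P n p)"
  unfolding tensor_assoc_def Let_def
  by (simp add: tensor_lift_elt[OF _ P _ tensor_assoc_bilinear[OF P]] tensor_is_module M N P
      tensor_elt_closed m n p tensor_lift_elt[OF M N _ tensor_assoc_param[OF P p]])

lemma tensor_assoc_inv_param:
  assumes P: "module R P" and m: "m \<in> carrier M"
  shows "bilinear R N P (tensor R (tensor R M N) P)
    (\<lambda>n p. tensor_elt R (tensor R M N) P (tensor_elt R M N m n) p)"
  by (intro bilinearI linear_tensor_elt_left linear_tensor_elt_right M N P tensor_is_module
      tensor_elt_closed linear_id m)

lemma tensor_assoc_inv_bilinear:
  assumes P: "module R P"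
  shows "bilinear R M (tensor R N P) (tensor R (tensor R M N) P)
    (\<lambda>m t. tensor_lift R (tensor R (tensor R M N) P)
      (\<lambda>n p. tensor_elt R (tensor R M N) P (tensor_elt R M N m n) p) t)"
  by (intro bilinearI tensor_lift_linear linear_tensor_lift_param[OF _ N P] M N P tensor_is_module
      tensor_assoc_inv_param linear_tensor_elt_left linear_id)

lemma tensor_assoc_inv_linear:
  assumes P: "module R P"
  shows "tensor_assoc_inv R M N P \<in> linear_maps R (tensor R M (tensor R N P)) (tensor R (tensor R
      M N) P)"
  unfolding tensor_assoc_inv_def Let_def
  by (intro tensor_lift_linear tensor_is_module M N P tensor_assoc_inv_bilinear)

lemma tensor_assoc_inv_elt:
  assumes P: "module R P" and m: "m \<in> carrier M" and n: "n \<in> carrier N" and p: "p \<in> carrier P"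
  shows "tensor_assoc_inv R M N P (tensor_elt R M (tensor R N P) m (tensor_elt R N P n p))
    = tensor_elt R (tensor R M N) P (tensor_elt R M N m n) p"
  unfolding tensor_assoc_inv_def Let_def
  by (simp add: tensor_lift_elt[OF M _ _ tensor_assoc_inv_bilinear[OF P]] tensor_is_module M N P
      tensor_elt_closed m n p tensor_lift_elt[OF N P _ tensor_assoc_inv_param[OF P m]])

end

lemma tensor_flip_middle_linear:
  assumes "module R N" "module R P" "module R Q"
  shows "tensor_assoc R P N Q \<circ> tensor_map R (tensor R P N) Q (tensor_flip R N P) id \<circ>
      tensor_assoc_inv R N P Q
    \<in> linear_maps R (tensor R N (tensor R P Q)) (tensor R P (tensor R N Q))"
proof -
  have f: "tensor_map R (tensor R P N) Q (tensor_flip R N P) id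
    \<in> linear_maps R (tensor R (tensor R N P) Q) (tensor R (tensor R P N) Q)"
    unfolding id_def by (intro tensor_map_linear tensor_is_module tensor_flip_linear linear_id
        assms)
  show ?thesis
    unfolding comp_def
    by (rule linear_comp[OF linear_comp[OF tensor_assoc_linear f] tensor_assoc_inv_linear])
       (intro assms)+
qed

lemma tensor_middle_flip_linear:
  assumes "module R M" "module R N" "module R P" "module R Q"
  shows "tensor_middle_flip R M N P Q \<in>
    linear_maps R (tensor R (tensor R M N) (tensor R P Q)) (tensor R (tensor R M P) (tensor R N Q))"
proof -
  note g = tensor_flip_middle_linear[OF assms(2-4)]
  have h: "tensor_map R M (tensor R P (tensor R N Q)) id
      (tensor_assoc R P N Q \<circ> tensor_map R (tensor R P N) Q (tensor_flip R N P) id \<circ>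
        tensor_assoc_inv R N P Q)
    \<in> linear_maps R (tensor R M (tensor R N (tensor R P Q))) (tensor R M (tensor R P (tensor R N
        Q)))"
    unfolding id_def by (intro tensor_map_linear[OF _ _ _ _ _ g[unfolded id_def]] tensor_is_module
        linear_id assms)
  show ?thesis
    unfolding tensor_middle_flip_def comp_def
    by (rule linear_comp[OF linear_comp[OF tensor_assoc_inv_linear h[unfolded comp_def]]
        tensor_assoc_linear])
       (intro assms tensor_is_module)+
qed

lemma tensor_middle_flip_elt:
  assumes MNPQ: "module R M" "module R N" "module R P" "module R Q"
    and c: "m \<in> carrier M" "n \<in> carrier N" "p \<in> carrier P" "q \<in> carrier Q"
  shows "tensor_middle_flip R M N P Q
      (tensor_elt R (tensor R M N) (tensor R P Q) (tensor_elt R M N m n) (tensor_elt R P Q p q))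
    = tensor_elt R (tensor R M P) (tensor R N Q) (tensor_elt R M P m p) (tensor_elt R N Q n q)"
proof -
  note T = tensor_is_module and E = tensor_elt_closed
  let ?g = "tensor_assoc R P N Q \<circ> tensor_map R (tensor R P N) Q (tensor_flip R N P) id \<circ>
        tensor_assoc_inv R N P Q"
  note g = tensor_flip_middle_linear[OF MNPQ(2-4)]
  have 1: "?g (tensor_elt R N (tensor R P Q) n (tensor_elt R P Q p q)) =
    tensor_elt R P (tensor R N Q) p (tensor_elt R N Q n q)"
    using MNPQ c
    by (simp add: tensor_assoc_inv_elt tensor_assoc_elt tensor_flip_elt T E
        tensor_map_elt[OF T _ T _ tensor_flip_linear] linear_id[folded id_def])
  show ?thesis
    unfolding tensor_middle_flip_def comp_apply[of "_ \<circ> _" "tensor_assoc R M N _"]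
      comp_apply[of "tensor_assoc_inv R M P _"]
    using MNPQ c g 1
    by (simp add: tensor_assoc_inv_elt tensor_assoc_elt T E tensor_map_elt[OF _ T _ T _ g]
        linear_id[folded id_def] del: comp_apply)
qed

section \<open>Direct sums\<close>

lemma direct_sum_simps [simp]:
  "\<zero>\<^bsub>direct_sum I M\<^esub> = (\<lambda>i\<in>I. \<zero>\<^bsub>M i\<^esub>)"
  "f \<oplus>\<^bsub>direct_sum I M\<^esub> g = (\<lambda>i\<in>I. f i \<oplus>\<^bsub>M i\<^esub> g i)"
  "r \<odot>\<^bsub>direct_sum I M\<^esub> f = (\<lambda>i\<in>I. r \<odot>\<^bsub>M i\<^esub> f i)"
  by (simp_all add: direct_sum_def)

lemma direct_sum_carrier:
  "f \<in> carrier (direct_sum I M) \<longleftrightarrow>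
     f \<in> (\<Pi>\<^sub>E i\<in>I. carrier (M i)) \<and> finite {i \<in> I. f i \<noteq> \<zero>\<^bsub>M i\<^esub>}"
  by (simp add: direct_sum_def)

lemma direct_sum_component: "\<lbrakk>f \<in> carrier (direct_sum I M); i \<in> I\<rbrakk> \<Longrightarrow> f i \<in> carrier (M i)"
  by (auto simp: direct_sum_carrier)

context
  fixes R :: "('k, 'r) ring_scheme" and I :: "'i set" and M :: "'i \<Rightarrow> ('k, 'm) module"
  assumes R: "cring R" and M: "\<And>i. i \<in> I \<Longrightarrow> module R (M i)"
begin

lemma direct_sum_is_module: "module R (direct_sum I M)"
proof -
  interpret cring R by (rule R)
  let ?D = "direct_sum I M"
  have ag: "abelian_group (M i)" if "i \<in> I" for i using module.axioms(2)[OF M[OF that]] .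
  have add: "(\<lambda>i\<in>I. f i \<oplus>\<^bsub>M i\<^esub> g i) \<in> carrier ?D" if "f \<in> carrier ?D" "g \<in> carrier ?D" for f g
  proof -
    have "{i \<in> I. (\<lambda>i\<in>I. f i \<oplus>\<^bsub>M i\<^esub> g i) i \<noteq> \<zero>\<^bsub>M i\<^esub>}
        \<subseteq> {i \<in> I. f i \<noteq> \<zero>\<^bsub>M i\<^esub>} \<union> {i \<in> I. g i \<noteq> \<zero>\<^bsub>M i\<^esub>}"
      using abelian_monoid.l_zero[OF abelian_group.axioms(1)[OF ag]]
        abelian_monoid.zero_closed[OF abelian_group.axioms(1)[OF ag]] by auto
    then have "finite {i \<in> I. (\<lambda>i\<in>I. f i \<oplus>\<^bsub>M i\<^esub> g i) i \<noteq> \<zero>\<^bsub>M i\<^esub>}"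
      using that unfolding direct_sum_carrier by (meson finite_UnI finite_subset)
    then show ?thesis
      using that direct_sum_component[OF that(1)] direct_sum_component[OF that(2)]
        abelian_monoid.a_closed[OF abelian_group.axioms(1)[OF ag]]
      by (simp add: direct_sum_carrier restrict_PiE_iff)
  qed
  have smult: "(\<lambda>i\<in>I. r \<odot>\<^bsub>M i\<^esub> f i) \<in> carrier ?D" if "r \<in> carrier R" "f \<in> carrier ?D" for r f
  proof -
    have "{i \<in> I. (\<lambda>i\<in>I. r \<odot>\<^bsub>M i\<^esub> f i) i \<noteq> \<zero>\<^bsub>M i\<^esub>} \<subseteq> {i \<in> I. f i \<noteq> \<zero>\<^bsub>M i\<^esub>}"
      using that module.smult_r_null[OF M] by auto
    then have "finite {i \<in> I. (\<lambda>i\<in>I. r \<odot>\<^bsub>M i\<^esub> f i) i \<noteq> \<zero>\<^bsub>M i\<^esub>}"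
      using that unfolding direct_sum_carrier by (meson finite_subset)
    then show ?thesis
      using that module.smult_closed[OF M]
      by (auto simp: direct_sum_carrier intro!: restrict_PiE_iff[THEN iffD2])
  qed
  have zero: "(\<lambda>i\<in>I. \<zero>\<^bsub>M i\<^esub>) \<in> carrier ?D"
    using abelian_monoid.zero_closed[OF abelian_group.axioms(1)[OF ag]]
    by (auto simp: direct_sum_carrier)
  have comp: "f i \<in> carrier (M i)" if "f \<in> carrier ?D" "i \<in> I" for f i
    using that by (rule direct_sum_component)
  have ext: "f \<in> extensional I" if "f \<in> carrier ?D" for f
    using that by (auto simp: direct_sum_carrier PiE_iff)
  have eqI: "f = g" if "f \<in> extensional I" "g \<in> extensional I" "\<And>i. i \<in> I \<Longrightarrow> f i = g i"
      for f g :: "'i \<Rightarrow> 'm"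
    using that by (rule extensionalityI)
  show ?thesis
  proof (rule moduleI)
    show "abelian_group ?D"
    proof (rule abelian_groupI)
      fix f assume f: "f \<in> carrier ?D"
      have "(\<lambda>i\<in>I. (\<ominus>\<^bsub>R\<^esub> \<one>\<^bsub>R\<^esub>) \<odot>\<^bsub>M i\<^esub> f i) \<oplus>\<^bsub>?D\<^esub> f = \<zero>\<^bsub>?D\<^esub>"
      proof (rule eqI)
        fix i assume i: "i \<in> I"
        interpret Mi: module R "M i" by (rule M[OF i])
        show "((\<lambda>i\<in>I. (\<ominus>\<^bsub>R\<^esub> \<one>\<^bsub>R\<^esub>) \<odot>\<^bsub>M i\<^esub> f i) \<oplus>\<^bsub>?D\<^esub> f) i = \<zero>\<^bsub>?D\<^esub> i"
          using comp[OF f i] i by (simp add: Mi.smult_l_minus Mi.M.l_neg)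
      qed auto
      then show "\<exists>g\<in>carrier ?D. g \<oplus>\<^bsub>?D\<^esub> f = \<zero>\<^bsub>?D\<^esub>"
        using smult[OF _ f, of "\<ominus>\<^bsub>R\<^esub> \<one>\<^bsub>R\<^esub>"] by blast
      show "\<zero>\<^bsub>?D\<^esub> \<oplus>\<^bsub>?D\<^esub> f = f"
        using abelian_monoid.l_zero[OF abelian_group.axioms(1)[OF ag]]
        by (intro eqI) (auto simp: comp f ext)
      fix g assume g: "g \<in> carrier ?D"
      show "f \<oplus>\<^bsub>?D\<^esub> g \<in> carrier ?D" using add f g by simp
      show "f \<oplus>\<^bsub>?D\<^esub> g = g \<oplus>\<^bsub>?D\<^esub> f"
        using abelian_monoid.a_comm[OF abelian_group.axioms(1)[OF ag]]
        by (intro eqI) (auto simp: comp f g)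
      fix h assume h: "h \<in> carrier ?D"
      show "f \<oplus>\<^bsub>?D\<^esub> g \<oplus>\<^bsub>?D\<^esub> h = f \<oplus>\<^bsub>?D\<^esub> (g \<oplus>\<^bsub>?D\<^esub> h)"
        using abelian_monoid.a_assoc[OF abelian_group.axioms(1)[OF ag]]
        by (intro eqI) (auto simp: comp f g h)
    qed (use zero in simp)
  next
    fix f assume f: "f \<in> carrier ?D"
    show "\<one>\<^bsub>R\<^esub> \<odot>\<^bsub>?D\<^esub> f = f"
      by (intro eqI) (auto simp: comp f ext module.smult_one[OF M])
    fix a assume a: "a \<in> carrier R"
    show "a \<odot>\<^bsub>?D\<^esub> f \<in> carrier ?D" using smult a f by simp
    show "a \<odot>\<^bsub>?D\<^esub> (f \<oplus>\<^bsub>?D\<^esub> g) = a \<odot>\<^bsub>?D\<^esub> f \<oplus>\<^bsub>?D\<^esub> a \<odot>\<^bsub>?D\<^esub> g" if "g \<in> carrier ?D" for g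
      by (intro eqI) (auto simp: comp f that a module.smult_r_distr[OF M])
    fix b assume b: "b \<in> carrier R"
    show "(a \<oplus>\<^bsub>R\<^esub> b) \<odot>\<^bsub>?D\<^esub> f = a \<odot>\<^bsub>?D\<^esub> f \<oplus>\<^bsub>?D\<^esub> b \<odot>\<^bsub>?D\<^esub> f"
      by (intro eqI) (auto simp: comp f a b module.smult_l_distr[OF M])
    show "(a \<otimes>\<^bsub>R\<^esub> b) \<odot>\<^bsub>?D\<^esub> f = a \<odot>\<^bsub>?D\<^esub> (b \<odot>\<^bsub>?D\<^esub> f)"
      by (intro eqI) (auto simp: comp f a b module.smult_assoc1[OF M])
  qed (rule R)
qed

lemma direct_sum_inj_linear:
  assumes i: "i \<in> I"
  shows "direct_sum_inj I M i \<in> linear_maps R (M i) (direct_sum I M)"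
proof (rule linear_mapsI)
  have Z: "\<zero>\<^bsub>M j\<^esub> \<in> carrier (M j)" "\<zero>\<^bsub>M j\<^esub> \<oplus>\<^bsub>M j\<^esub> \<zero>\<^bsub>M j\<^esub> = \<zero>\<^bsub>M j\<^esub>" if "j \<in> I" for j
  proof -
    interpret Mj: module R "M j" by (rule M[OF that])
    show "\<zero>\<^bsub>M j\<^esub> \<in> carrier (M j)" "\<zero>\<^bsub>M j\<^esub> \<oplus>\<^bsub>M j\<^esub> \<zero>\<^bsub>M j\<^esub> = \<zero>\<^bsub>M j\<^esub>" by auto
  qed
  fix a assume a: "a \<in> carrier (M i)"
  have "{j \<in> I. direct_sum_inj I M i a j \<noteq> \<zero>\<^bsub>M j\<^esub>} \<subseteq> {i}" by (auto simp: direct_sum_inj_def)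
  then show "direct_sum_inj I M i a \<in> carrier (direct_sum I M)"
    using a Z by (auto simp: direct_sum_carrier direct_sum_inj_def intro: finite_subset)
  show "direct_sum_inj I M i (r \<odot>\<^bsub>M i\<^esub> a) = r \<odot>\<^bsub>direct_sum I M\<^esub> direct_sum_inj I M i a"
    if "r \<in> carrier R" for r
    using that module.smult_r_null[OF M] by (auto simp: direct_sum_inj_def)
  show "direct_sum_inj I M i (a \<oplus>\<^bsub>M i\<^esub> b) = direct_sum_inj I M i a
      \<oplus>\<^bsub>direct_sum I M\<^esub> direct_sum_inj I M i b" for b
    using Z by (auto simp: direct_sum_inj_def)
qed

text \<open>
  The uniqueness half of the universal property in its inductive form: splitting off one
  component at a time shortens the support.
\<close>

lemma direct_sum_induct [consumes 1, case_names zero add inj]: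
  assumes f: "f \<in> carrier (direct_sum I M)"
    and zero: "P \<zero>\<^bsub>direct_sum I M\<^esub>"
    and add: "\<And>f g. \<lbrakk>f \<in> carrier (direct_sum I M); g \<in> carrier (direct_sum I M); P f; P g\<rbrakk>
      \<Longrightarrow> P (f \<oplus>\<^bsub>direct_sum I M\<^esub> g)"
    and inj: "\<And>i a. \<lbrakk>i \<in> I; a \<in> carrier (M i)\<rbrakk> \<Longrightarrow> P (direct_sum_inj I M i a)"
  shows "P f"
proof -
  let ?D = "direct_sum I M"
  have "P f" if "finite B" "f \<in> carrier ?D" "{i \<in> I. f i \<noteq> \<zero>\<^bsub>M i\<^esub>} \<subseteq> B" for B f
    using that
  proof (induction B arbitrary: f)
    case empty
    then have "f = \<zero>\<^bsub>?D\<^esub>"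
      by (intro extensionalityI[of _ I]) (auto simp: direct_sum_carrier PiE_iff)
    then show ?case using zero by (simp only:)
  next
    case (insert b B)
    show ?case
    proof (cases "b \<in> I \<and> f b \<noteq> \<zero>\<^bsub>M b\<^esub>")
      case False
      then show ?thesis using insert.IH[OF insert.prems(1)] insert.prems(2) by blast
    next
      case True
      let ?h = "f(b := \<zero>\<^bsub>M b\<^esub>)"
      have b: "b \<in> I" "f b \<in> carrier (M b)" using True direct_sum_component[OF insert.prems(1)]
          by auto
      interpret Mb: module R "M b" by (rule M[OF b(1)])
      have supp: "{i \<in> I. ?h i \<noteq> \<zero>\<^bsub>M i\<^esub>} \<subseteq> {i \<in> I. f i \<noteq> \<zero>\<^bsub>M i\<^esub>}" by auto
      have h: "?h \<in> carrier ?D"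
        using insert.prems(1) b finite_subset[OF supp] unfolding direct_sum_carrier
        by (simp add: PiE_iff extensional_def)
      have "{i \<in> I. ?h i \<noteq> \<zero>\<^bsub>M i\<^esub>} \<subseteq> B" using insert.prems(2) by auto
      then have Ph: "P ?h" by (rule insert.IH[OF h])
      have "f = direct_sum_inj I M b (f b) \<oplus>\<^bsub>?D\<^esub> ?h"
      proof (rule extensionalityI[of _ I])
        show "f \<in> extensional I" using insert.prems(1) by (auto simp: direct_sum_carrier PiE_iff)
        fix i assume i: "i \<in> I"
        interpret Mi: module R "M i" by (rule M[OF i])
        show "f i = (direct_sum_inj I M b (f b) \<oplus>\<^bsub>?D\<^esub> ?h) i"
          using i b direct_sum_component[OF insert.prems(1) i] by (auto simp: direct_sum_inj_def)
      qed simp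
      then show ?thesis
        using add[OF linear_closed[OF direct_sum_inj_linear[OF b(1)] b(2)] h inj[OF b] Ph] by metis
    qed
  qed
  then show ?thesis using f by (auto simp: direct_sum_carrier)
qed

lemma direct_sum_ext:
  assumes P: "module R P" and f: "f \<in> linear_maps R (direct_sum I M) P"
    and g: "g \<in> linear_maps R (direct_sum I M) P"
    and eq: "\<And>i a. \<lbrakk>i \<in> I; a \<in> carrier (M i)\<rbrakk> \<Longrightarrow> f (direct_sum_inj I M i a)
        = g (direct_sum_inj I M i a)"
    and a: "a \<in> carrier (direct_sum I M)"
  shows "f a = g a"
  using a
proof (induction a rule: direct_sum_induct)
  case zero
  show ?case
    by (simp only: linear_zero[OF direct_sum_is_module P f] linear_zero[OF direct_sum_is_module P
        g])
qed (simp_all add: eq linear_add[OF f] linear_add[OF g] del: direct_sum_simps)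

context
  fixes P :: "('k, 'p) module" and \<phi>
  assumes P: "module R P" and \<phi>: "\<And>i. i \<in> I \<Longrightarrow> \<phi> i \<in> linear_maps R (M i) P"
begin

interpretation P: module R P by (rule P)

lemma direct_sum_lift_superset:
  assumes f: "f \<in> carrier (direct_sum I M)" and B: "finite B" "{i \<in> I. f i \<noteq> \<zero>\<^bsub>M i\<^esub>} \<subseteq> B" "B \<subseteq> I"
  shows "direct_sum_lift I M P \<phi> f = finsum P (\<lambda>i. \<phi> i (f i)) B"
proof -
  have "\<phi> i (f i) \<in> carrier P" if "i \<in> B" for i
  proof -
    have i: "i \<in> I" using that B by blast
    show ?thesis by (rule linear_closed[OF \<phi>[OF i] direct_sum_component[OF f i]])
  qed
  moreover have "\<phi> i (f i) = \<zero>\<^bsub>P\<^esub>" if "i \<in> B - {i \<in> I. f i \<noteq> \<zero>\<^bsub>M i\<^esub>}" for i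
    using that B linear_zero[OF M P \<phi>] by auto
  ultimately show ?thesis
    unfolding direct_sum_lift_def
    using B by (intro P.M.add.finprod_mono_neutral_cong_left) auto
qed

lemma direct_sum_lift_linear: "direct_sum_lift I M P \<phi> \<in> linear_maps R (direct_sum I M) P"
proof (rule linear_mapsI)
  let ?D = "direct_sum I M"
  interpret D: module R ?D by (rule direct_sum_is_module)
  have tm: "\<phi> i (f i) \<in> carrier P" if "f \<in> carrier ?D" "i \<in> I" for f i
    by (rule linear_closed[OF \<phi>[OF that(2)] direct_sum_component[OF that]])
  fix f assume f: "f \<in> carrier ?D"
  let ?B = "{i \<in> I. f i \<noteq> \<zero>\<^bsub>M i\<^esub>}"
  have B: "finite ?B" using f by (simp add: direct_sum_carrier)
  show "direct_sum_lift I M P \<phi> f \<in> carrier P"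
    unfolding direct_sum_lift_def using tm[OF f] by (intro P.M.finsum_closed) auto
  show "direct_sum_lift I M P \<phi> (r \<odot>\<^bsub>?D\<^esub> f) = r \<odot>\<^bsub>P\<^esub> direct_sum_lift I M P \<phi> f"
      if r: "r \<in> carrier R" for r
  proof -
    have "direct_sum_lift I M P \<phi> (r \<odot>\<^bsub>?D\<^esub> f) = finsum P (\<lambda>i. \<phi> i ((r \<odot>\<^bsub>?D\<^esub> f) i)) ?B"
      using D.smult_closed[OF r f] B r module.smult_r_null[OF M]
      by (intro direct_sum_lift_superset) auto
    also have "\<dots> = finsum P (\<lambda>i. r \<odot>\<^bsub>P\<^esub> \<phi> i (f i)) ?B"
      using tm[OF f] r direct_sum_component[OF f]
      by (intro P.M.finsum_cong' refl Pi_I) (simp_all add: linear_smult[OF \<phi>])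
    also have "\<dots> = r \<odot>\<^bsub>P\<^esub> direct_sum_lift I M P \<phi> f"
      unfolding direct_sum_lift_def using tm[OF f] r B by (subst P.finsum_smult_ldistr) auto
    finally show ?thesis .
  qed
  fix g assume g: "g \<in> carrier ?D"
  let ?B = "{i \<in> I. f i \<noteq> \<zero>\<^bsub>M i\<^esub>} \<union> {i \<in> I. g i \<noteq> \<zero>\<^bsub>M i\<^esub>}"
  have B: "finite ?B" "?B \<subseteq> I" using f g by (auto simp: direct_sum_carrier)
  have z: "\<zero>\<^bsub>M i\<^esub> \<oplus>\<^bsub>M i\<^esub> \<zero>\<^bsub>M i\<^esub> = \<zero>\<^bsub>M i\<^esub>" if "i \<in> I" for i
  proof -
    interpret Mi: module R "M i" by (rule M[OF that])
    show ?thesis by simp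
  qed
  have "direct_sum_lift I M P \<phi> (f \<oplus>\<^bsub>?D\<^esub> g) = finsum P (\<lambda>i. \<phi> i ((f \<oplus>\<^bsub>?D\<^esub> g) i)) ?B"
    using D.M.a_closed[OF f g] B z by (intro direct_sum_lift_superset) auto
  also have "\<dots> = finsum P (\<lambda>i. \<phi> i (f i) \<oplus>\<^bsub>P\<^esub> \<phi> i (g i)) ?B"
    using tm[OF f] tm[OF g] direct_sum_component[OF f] direct_sum_component[OF g]
    by (intro P.M.finsum_cong' refl Pi_I) (auto simp: linear_add[OF \<phi>])
  also have "\<dots> = finsum P (\<lambda>i. \<phi> i (f i)) ?B \<oplus>\<^bsub>P\<^esub> finsum P (\<lambda>i. \<phi> i (g i)) ?B"
    using tm[OF f] tm[OF g] by (intro P.M.finsum_addf) auto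
  also have "\<dots> = direct_sum_lift I M P \<phi> f \<oplus>\<^bsub>P\<^esub> direct_sum_lift I M P \<phi> g"
    using f g B by (simp add: direct_sum_lift_superset[of _ ?B])
  finally show "direct_sum_lift I M P \<phi> (f \<oplus>\<^bsub>?D\<^esub> g) = direct_sum_lift I M P \<phi> f
      \<oplus>\<^bsub>P\<^esub> direct_sum_lift I M P \<phi> g" .
qed

lemma direct_sum_lift_inj:
  assumes i: "i \<in> I" and a: "a \<in> carrier (M i)"
  shows "direct_sum_lift I M P \<phi> (direct_sum_inj I M i a) = \<phi> i a"
proof -
  have "direct_sum_lift I M P \<phi> (direct_sum_inj I M i a) =
      finsum P (\<lambda>j. \<phi> j (direct_sum_inj I M i a j)) {i}"
    using i by (intro direct_sum_lift_superset linear_closed[OF direct_sum_inj_linear[OF i] a])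
      (auto simp: direct_sum_inj_def)
  also have "\<dots> = \<phi> i a"
    using i linear_closed[OF \<phi>[OF i] a] by (simp add: direct_sum_inj_def)
  finally show ?thesis .
qed

end

lemma linear_direct_sum_lift_param:
  assumes K: "module R K" and P: "module R P"
    and \<phi>: "\<And>x i. \<lbrakk>x \<in> carrier K; i \<in> I\<rbrakk> \<Longrightarrow> \<phi> x i \<in> linear_maps R (M i) P"
    and l: "\<And>i a. \<lbrakk>i \<in> I; a \<in> carrier (M i)\<rbrakk> \<Longrightarrow> (\<lambda>x. \<phi> x i a) \<in> linear_maps R K P"
    and f: "f \<in> carrier (direct_sum I M)"
  shows "(\<lambda>x. direct_sum_lift I M P (\<phi> x) f) \<in> linear_maps R K P"
  using f
proof (induction f rule: direct_sum_induct)
  case zero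
  show ?case
    by (rule linear_cong[OF K linear_const_zero[OF P]])
       (rule linear_zero[OF direct_sum_is_module P direct_sum_lift_linear[OF P \<phi>]])
next
  case (add f g)
  show ?case
    by (rule linear_cong[OF K linear_sum[OF P add(3,4)]])
       (rule linear_add[OF direct_sum_lift_linear[OF P \<phi>] add(1,2)])
next
  case (inj i a)
  show ?case
    by (rule linear_cong[OF K l[OF inj]]) (rule direct_sum_lift_inj[OF P \<phi> inj])
qed

end

section \<open>Sweedler sums\<close>

text \<open>
  The sum \<open>F(c\<^sub>1, c\<^sub>2)\<close> of Sweedler notation, for \<open>F\<close> bilinear. Iterated coproducts appear as nested
  sums, in which the second sum ranges over the coproduct of a variable bound by the first.
\<close>

definition sweedler ::
  "('k, 'r) ring_scheme \<Rightarrow> ('m \<Rightarrow> ('m \<times> 'm \<Rightarrow> 'k) set) \<Rightarrow> ('k, 'p) module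
   \<Rightarrow> ('m \<Rightarrow> 'm \<Rightarrow> 'p) \<Rightarrow> 'm \<Rightarrow> 'p" where
  "sweedler R \<Delta> P F c = tensor_lift R P F (\<Delta> c)"

context coalgebra
begin

lemma coalgebra_module: "module R C" ..

lemma comult_closed: "c \<in> carrier C \<Longrightarrow> \<Delta> c \<in> carrier (tensor R C C)"
  by (rule linear_closed[OF comult_linear])

lemma sweedler_cong:
  assumes P: "module R P" and F': "bilinear R C C P F'" and c: "c \<in> carrier C"
    and eq: "\<And>a b. \<lbrakk>a \<in> carrier C; b \<in> carrier C\<rbrakk> \<Longrightarrow> F a b = F' a b"
  shows "sweedler R \<Delta> P F c = sweedler R \<Delta> P F' c"
  unfolding sweedler_def
  by (rule tensor_lift_cong[OF coalgebra_module coalgebra_module P F' comult_closed[OF c] eq])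

lemma linear_sweedler_arg:
  assumes "module R P" "bilinear R C C P F" "f \<in> linear_maps R K C"
  shows "(\<lambda>x. sweedler R \<Delta> P F (f x)) \<in> linear_maps R K P"
  unfolding sweedler_def
  by (intro linear_tensor_lift_arg[OF coalgebra_module coalgebra_module] linear_comp[OF
      comult_linear] assms)

lemma linear_sweedler_param:
  assumes "module R K" "module R P" "\<And>x. x \<in> carrier K \<Longrightarrow> bilinear R C C P (F x)"
    and "\<And>a b. \<lbrakk>a \<in> carrier C; b \<in> carrier C\<rbrakk> \<Longrightarrow> (\<lambda>x. F x a b) \<in> linear_maps R K P"
    and "c \<in> carrier C"
  shows "(\<lambda>x. sweedler R \<Delta> P (F x) c) \<in> linear_maps R K P"
  unfolding sweedler_def
  by (intro linear_tensor_lift_param[OF assms(1) coalgebra_module coalgebra_module] comult_closed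
      assms)

lemma sweedler_closed:
  "\<lbrakk>module R P; bilinear R C C P F; c \<in> carrier C\<rbrakk> \<Longrightarrow> sweedler R \<Delta> P F c \<in> carrier P"
  unfolding sweedler_def
  by (intro tensor_lift_closed[OF coalgebra_module coalgebra_module] comult_closed)

lemma linear_sweedler:
  assumes "module R P" "module R Q" "bilinear R C C P F" "f \<in> linear_maps R P Q" "c \<in> carrier C"
  shows "f (sweedler R \<Delta> P F c) = sweedler R \<Delta> Q (\<lambda>a b. f (F a b)) c"
  unfolding sweedler_def
  by (intro linear_tensor_lift[OF coalgebra_module coalgebra_module] comult_closed assms)

text \<open>
  Coassociativity is an equation in a triple tensor product; applying to it the linear map induced by
  \<open>T\<close> turns it into a rule for rebracketing nested sums.
\<close>

lemma sweedler_coassoc: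
  assumes P: "module R P"
    and T1: "\<And>q r. \<lbrakk>q \<in> carrier C; r \<in> carrier C\<rbrakk> \<Longrightarrow> (\<lambda>p. T p q r) \<in> linear_maps R C P"
    and T2: "\<And>p r. \<lbrakk>p \<in> carrier C; r \<in> carrier C\<rbrakk> \<Longrightarrow> (\<lambda>q. T p q r) \<in> linear_maps R C P"
    and T3: "\<And>p q. \<lbrakk>p \<in> carrier C; q \<in> carrier C\<rbrakk> \<Longrightarrow> (\<lambda>r. T p q r) \<in> linear_maps R C P"
    and c: "c \<in> carrier C"
  shows "sweedler R \<Delta> P (\<lambda>a r. sweedler R \<Delta> P (\<lambda>p q. T p q r) a) c =
    sweedler R \<Delta> P (\<lambda>p b. sweedler R \<Delta> P (\<lambda>q r. T p q r) b) c"
proof -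
  note C = coalgebra_module
  note CC = tensor_is_module[OF C C]
  let ?L = "tensor_lift R P (\<lambda>p t. tensor_lift R P (\<lambda>q r. T p q r) t)"
  let ?L' = "tensor_lift R P (\<lambda>t r. tensor_lift R P (\<lambda>p q. T p q r) t)"
  have b1: "bilinear R C C P (\<lambda>q r. T p q r)" if "p \<in> carrier C" for p
    by (intro bilinearI T2 T3 that)
  have b2: "bilinear R C C P (\<lambda>p q. T p q r)" if "r \<in> carrier C" for r
    by (intro bilinearI T1 T2 that)
  have B: "bilinear R C (tensor R C C) P (\<lambda>p t. tensor_lift R P (\<lambda>q r. T p q r) t)"
    by (intro bilinearI tensor_lift_linear linear_tensor_lift_param[OF _ C C] C P b1 T1)
  have B': "bilinear R (tensor R C C) C P (\<lambda>t r. tensor_lift R P (\<lambda>p q. T p q r) t)"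
    by (intro bilinearI tensor_lift_linear linear_tensor_lift_param[OF _ C C] C P b2 T3)
  have L: "?L \<in> linear_maps R (tensor R C (tensor R C C)) P"
      by (rule tensor_lift_linear[OF C CC P B])
  have L': "?L' \<in> linear_maps R (tensor R (tensor R C C) C) P"
      by (rule tensor_lift_linear[OF CC C P B'])
  have assoc: "?L (tensor_assoc R C C C t) = ?L' t" if "t \<in> carrier (tensor R (tensor R C C) C)"
      for t
  proof (rule tensor_ext[OF CC C P linear_comp[OF L tensor_assoc_linear[OF C C C]] L' _ that])
    fix s r assume s: "s \<in> carrier (tensor R C C)" and r: "r \<in> carrier C"
    have l: "(\<lambda>s. ?L (tensor_assoc R C C C (tensor_elt R (tensor R C C) C s r)))
        \<in> linear_maps R (tensor R C C) P"
      by (intro linear_comp[OF L] linear_comp[OF tensor_assoc_linear[OF C C C]]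
          linear_tensor_elt_left[OF CC C linear_id r])
    have l': "(\<lambda>s. ?L' (tensor_elt R (tensor R C C) C s r)) \<in> linear_maps R (tensor R C C) P"
      by (intro linear_comp[OF L'] linear_tensor_elt_left[OF CC C linear_id r])
    show "?L (tensor_assoc R C C C (tensor_elt R (tensor R C C) C s r))
        = ?L' (tensor_elt R (tensor R C C) C s r)"
      by (rule tensor_ext[OF C C P l l' _ s])
         (simp add: tensor_assoc_elt[OF C C C] tensor_lift_elt[OF C CC P B] tensor_lift_elt[OF CC
             C P B']
           tensor_elt_closed C r tensor_lift_elt[OF C C P b1] tensor_lift_elt[OF C C P b2])
  qed
  have id: "id \<in> linear_maps R C C" unfolding id_def by (rule linear_id)
  have m: "tensor_map R (tensor R C C) C \<Delta> id (\<Delta> c) \<in> carrier (tensor R (tensor R C C) C)"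
    by (rule tensor_map_closed[OF C C CC C comult_linear id comult_closed[OF c]])
  have "?L' (tensor_map R (tensor R C C) C \<Delta> id (\<Delta> c)) = ?L (tensor_map R C (tensor R C C) id \<Delta>
      (\<Delta> c))"
    using assoc[OF m] coassoc[OF c] by simp
  then show ?thesis
    unfolding sweedler_def
    by (simp add: tensor_lift_tensor_map[OF C C CC C P comult_linear id B' comult_closed[OF c]]
        tensor_lift_tensor_map[OF C C C CC P id comult_linear B comult_closed[OF c]])
qed

lemma
  assumes P: "module R P" and f: "f \<in> linear_maps R C P" and c: "c \<in> carrier C"
  shows sweedler_counit_left: "sweedler R \<Delta> P (\<lambda>a b. \<epsilon> a \<odot>\<^bsub>P\<^esub> f b) c = f c"
    and sweedler_counit_right: "sweedler R \<Delta> P (\<lambda>a b. \<epsilon> b \<odot>\<^bsub>P\<^esub> f a) c = f c"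
proof -
  note C = coalgebra_module and K = regular_module_is_module[OF R.is_cring]
  interpret P: module R P by (rule P)
  have id: "id \<in> linear_maps R C C" unfolding id_def by (rule linear_id)
  have \<epsilon>c: "\<epsilon> a \<in> carrier R" if "a \<in> carrier C" for a
    using linear_closed[OF counit_linear that] by (simp add: regular_module_def)
  have Bl: "bilinear R C C C (\<lambda>a b. \<epsilon> a \<odot>\<^bsub>C\<^esub> b)" and Br: "bilinear R C C C (\<lambda>a b. \<epsilon> b \<odot>\<^bsub>C\<^esub> a)"
    by (intro bilinearI linear_smult_left linear_smult_right C counit_linear linear_id \<epsilon>c;
        assumption)+
  have Bl': "bilinear R C C P (\<lambda>a b. \<epsilon> a \<odot>\<^bsub>P\<^esub> f b)" and Br': "bilinear R C C P (\<lambda>a b. \<epsilon> b \<odot>\<^bsub>P\<^esub> f a)"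
    by (intro bilinearI linear_smult_left linear_smult_right P counit_linear f linear_closed[OF f]
        \<epsilon>c; assumption)+
  have l: "sweedler R \<Delta> C (\<lambda>a b. \<epsilon> a \<odot>\<^bsub>C\<^esub> b) c = c"
    using counit_left[OF c] tensor_lift_tensor_map[OF C C K C C counit_linear id
        tensor_lunit_bilinear[OF C] comult_closed[OF c]]
    by (simp add: sweedler_def tensor_lunit_def)
  have r: "sweedler R \<Delta> C (\<lambda>a b. \<epsilon> b \<odot>\<^bsub>C\<^esub> a) c = c"
    using counit_right[OF c] tensor_lift_tensor_map[OF C C C K C id counit_linear
        tensor_runit_bilinear[OF C] comult_closed[OF c]]
    by (simp add: sweedler_def tensor_runit_def)
  have "sweedler R \<Delta> P (\<lambda>a b. \<epsilon> a \<odot>\<^bsub>P\<^esub> f b) c = sweedler R \<Delta> P (\<lambda>a b. f (\<epsilon> a \<odot>\<^bsub>C\<^esub> b)) c"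
    by (rule sweedler_cong[OF P _ c, symmetric]) (simp_all add: linear_smult[OF f] \<epsilon>c Bl')
  also have "\<dots> = f (sweedler R \<Delta> C (\<lambda>a b. \<epsilon> a \<odot>\<^bsub>C\<^esub> b) c)"
    by (rule linear_sweedler[OF C P Bl f c, symmetric])
  finally show "sweedler R \<Delta> P (\<lambda>a b. \<epsilon> a \<odot>\<^bsub>P\<^esub> f b) c = f c" by (simp only: l)
  have "sweedler R \<Delta> P (\<lambda>a b. \<epsilon> b \<odot>\<^bsub>P\<^esub> f a) c = sweedler R \<Delta> P (\<lambda>a b. f (\<epsilon> b \<odot>\<^bsub>C\<^esub> a)) c"
    by (rule sweedler_cong[OF P _ c, symmetric]) (simp_all add: linear_smult[OF f] \<epsilon>c Br')
  also have "\<dots> = f (sweedler R \<Delta> C (\<lambda>a b. \<epsilon> b \<odot>\<^bsub>C\<^esub> a) c)"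
    by (rule linear_sweedler[OF C P Br f c, symmetric])
  finally show "sweedler R \<Delta> P (\<lambda>a b. \<epsilon> b \<odot>\<^bsub>P\<^esub> f a) c = f c" by (simp only: r)
qed

end

text \<open>
  Evaluates the comultiplication of a product: in \<open>\<Delta>(ab) = a\<^sub>1b\<^sub>1 \<otimes> a\<^sub>2b\<^sub>2\<close> the middle flip only pairs the
  factors, so a sum over \<open>\<Delta>(ab)\<close> becomes a double sum over \<open>\<Delta>(a)\<close> and \<open>\<Delta>(b)\<close>.
\<close>

lemma tensor_lift_middle_flip:
  assumes M: "module R M" and N: "module R N" and P: "module R P" and Q: "module R Q"
      and L: "module R L"
    and b: "bilinear R (tensor R M P) (tensor R N Q) L b"
    and s: "s \<in> carrier (tensor R M N)" and t: "t \<in> carrier (tensor R P Q)"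
  shows "tensor_lift R L b (tensor_middle_flip R M N P Q (tensor_elt R (tensor R M N) (tensor R P
      Q) s t)) =
    tensor_lift R L (\<lambda>m n. tensor_lift R L (\<lambda>p q. b (tensor_elt R M P m p) (tensor_elt R N Q n q))
        t) s"
proof -
  note T = tensor_is_module
  let ?f = "\<lambda>s t. tensor_lift R L b (tensor_middle_flip R M N P Q (tensor_elt R (tensor R M N)
      (tensor R P Q) s t))"
  let ?g = "\<lambda>s t. tensor_lift R L (\<lambda>m n. tensor_lift R L (\<lambda>p q. b (tensor_elt R M P m p)
      (tensor_elt R N Q n q)) t) s"
  have lm: "(\<lambda>m. b (tensor_elt R M P m p) (tensor_elt R N Q n q)) \<in> linear_maps R M L"
    if "n \<in> carrier N" "p \<in> carrier P" "q \<in> carrier Q" for n p q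
    by (intro linear_comp[OF bilinear_left[OF b]] tensor_elt_closed linear_tensor_elt_left
        linear_id M N P Q that)
  have ln: "(\<lambda>n. b (tensor_elt R M P m p) (tensor_elt R N Q n q)) \<in> linear_maps R N L"
    if "m \<in> carrier M" "p \<in> carrier P" "q \<in> carrier Q" for m p q
    by (intro linear_comp[OF bilinear_right[OF b]] tensor_elt_closed linear_tensor_elt_left
        linear_id M N P Q that)
  have lp: "(\<lambda>p. b (tensor_elt R M P m p) (tensor_elt R N Q n q)) \<in> linear_maps R P L"
    if "m \<in> carrier M" "n \<in> carrier N" "q \<in> carrier Q" for m n q
    by (intro linear_comp[OF bilinear_left[OF b]] tensor_elt_closed linear_tensor_elt_right
        linear_id M N P Q that)
  have lq: "(\<lambda>q. b (tensor_elt R M P m p) (tensor_elt R N Q n q)) \<in> linear_maps R Q L"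
    if "m \<in> carrier M" "n \<in> carrier N" "p \<in> carrier P" for m n p
    by (intro linear_comp[OF bilinear_right[OF b]] tensor_elt_closed linear_tensor_elt_right
        linear_id M N P Q that)
  have bpq: "bilinear R P Q L (\<lambda>p q. b (tensor_elt R M P m p) (tensor_elt R N Q n q))"
    if "m \<in> carrier M" "n \<in> carrier N" for m n
    by (intro bilinearI lp lq that)
  have bmn: "bilinear R M N L (\<lambda>m n. tensor_lift R L (\<lambda>p q. b (tensor_elt R M P m p) (tensor_elt R
      N Q n q)) t)"
    if "t \<in> carrier (tensor R P Q)" for t
    by (intro bilinearI linear_tensor_lift_param[OF _ P Q L] M N bpq lm ln that)
  have fl: "(\<lambda>s. ?f s t) \<in> linear_maps R (tensor R M N) L" if "t \<in> carrier (tensor R P Q)" for t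
    by (intro linear_comp[OF tensor_lift_linear[OF _ _ L b]] linear_comp[OF
        tensor_middle_flip_linear]
        linear_tensor_elt_left T M N P Q linear_id that)
  have fr: "(\<lambda>t. ?f s t) \<in> linear_maps R (tensor R P Q) L" if "s \<in> carrier (tensor R M N)" for s
    by (intro linear_comp[OF tensor_lift_linear[OF _ _ L b]] linear_comp[OF
        tensor_middle_flip_linear]
        linear_tensor_elt_right T M N P Q linear_id that)
  have gr: "(\<lambda>t. ?g s t) \<in> linear_maps R (tensor R P Q) L" if "s \<in> carrier (tensor R M N)" for s
    by (intro linear_tensor_lift_param[OF T[OF P Q] M N L bmn] tensor_lift_linear[OF P Q L bpq]
        that)
  show ?thesis
  proof (rule tensor_ext[OF M N L fl[OF t] tensor_lift_linear[OF M N L bmn[OF t]] _ s])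
    fix m n assume mn: "m \<in> carrier M" "n \<in> carrier N"
    note E = tensor_elt_closed[OF M N mn]
    show "?f (tensor_elt R M N m n) t = ?g (tensor_elt R M N m n) t"
    proof (rule tensor_ext[OF P Q L fr[OF E] gr[OF E] _ t])
      fix p q assume pq: "p \<in> carrier P" "q \<in> carrier Q"
      show "?f (tensor_elt R M N m n) (tensor_elt R P Q p q)
          = ?g (tensor_elt R M N m n) (tensor_elt R P Q p q)"
        by (simp add: tensor_middle_flip_elt[OF M N P Q mn pq] tensor_lift_elt[OF _ _ L b] T M N P
            Q mn pq
            tensor_elt_closed tensor_lift_elt[OF M N L bmn] tensor_lift_elt[OF P Q L bpq])
    qed
  qed
qed

section \<open>Coalgebra categories\<close>

context coalgebra_category
begin

definition mul :: "'x \<Rightarrow> 'x \<Rightarrow> 'x \<Rightarrow> 'm \<Rightarrow> 'm \<Rightarrow> 'm" where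
  "mul x y z a b = \<mu> x y z (tensor_elt R (H x y) (H y z) a b)"

definition unit :: "'x \<Rightarrow> 'm" where
  "unit x = \<eta> x \<one>\<^bsub>R\<^esub>"

abbreviation sw where "sw x y \<equiv> sweedler R (\<Delta> x y)"

lemma H_module: "\<lbrakk>x \<in> X; y \<in> X\<rbrakk> \<Longrightarrow> module R (H x y)"
  using coalgebra.coalgebra_module[OF hom_coalgebra] .

lemma K_module: "module R (regular_module R)"
  by (rule regular_module_is_module[OF is_cring])

lemma linear_mul_left:
  assumes "x \<in> X" "y \<in> X" "z \<in> X" "f \<in> linear_maps R K (H x y)" "b \<in> carrier (H y z)"
  shows "(\<lambda>k. mul x y z (f k) b) \<in> linear_maps R K (H x z)"
  unfolding mul_def by (intro linear_comp[OF comp_linear] linear_tensor_elt_left H_module assms)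

lemma linear_mul_right:
  assumes "x \<in> X" "y \<in> X" "z \<in> X" "f \<in> linear_maps R K (H y z)" "a \<in> carrier (H x y)"
  shows "(\<lambda>k. mul x y z a (f k)) \<in> linear_maps R K (H x z)"
  unfolding mul_def by (intro linear_comp[OF comp_linear] linear_tensor_elt_right H_module assms)

lemma mul_closed:
  "\<lbrakk>x \<in> X; y \<in> X; z \<in> X; a \<in> carrier (H x y); b \<in> carrier (H y z)\<rbrakk> \<Longrightarrow> mul x y z a b
      \<in> carrier (H x z)"
  unfolding mul_def by (intro linear_closed[OF comp_linear] tensor_elt_closed H_module)

lemma linear_counit:
  "\<lbrakk>x \<in> X; y \<in> X; f \<in> linear_maps R K (H x y)\<rbrakk> \<Longrightarrow> (\<lambda>k. \<epsilon> x y (f k))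
      \<in> linear_maps R K (regular_module R)"
  by (rule linear_comp[OF coalgebra.counit_linear[OF hom_coalgebra]])

lemma counit_closed: "\<lbrakk>x \<in> X; y \<in> X; a \<in> carrier (H x y)\<rbrakk> \<Longrightarrow> \<epsilon> x y a \<in> carrier R"
  using linear_closed[OF coalgebra.counit_linear[OF hom_coalgebra], of x y a]
  by (simp add: regular_module_def)

lemma unit_closed: "x \<in> X \<Longrightarrow> unit x \<in> carrier (H x x)"
  unfolding unit_def by (rule linear_closed[OF unit_linear]) (simp_all add: regular_module_def)

lemma eta_eq: "\<lbrakk>x \<in> X; r \<in> carrier R\<rbrakk> \<Longrightarrow> \<eta> x r = r \<odot>\<^bsub>H x x\<^esub> unit x"
  using linear_smult[OF unit_linear, of x r "\<one>\<^bsub>R\<^esub>"] by (simp add: unit_def regular_module_def)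

lemma mul_assoc:
  assumes "x \<in> X" "y \<in> X" "z \<in> X" "w \<in> X"
    and "a \<in> carrier (H x y)" "b \<in> carrier (H y z)" "c \<in> carrier (H z w)"
  shows "mul x z w (mul x y z a b) c = mul x y w a (mul y z w b c)"
proof -
  have 1: "tensor_elt R (tensor R (H x y) (H y z)) (H z w) (tensor_elt R (H x y) (H y z) a b) c
      \<in> carrier (tensor R (tensor R (H x y) (H y z)) (H z w))"
    using assms by (intro tensor_elt_closed tensor_is_module H_module)
  have id: "id \<in> linear_maps R M M" for M :: "('k, 'm) module" unfolding id_def by (rule linear_id)
  have "\<mu> x z w (tensor_map R (H x z) (H z w) (\<mu> x y z) id
      (tensor_elt R (tensor R (H x y) (H y z)) (H z w) (tensor_elt R (H x y) (H y z) a b) c))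
    = mul x z w (mul x y z a b) c"
    unfolding mul_def using assms
    by (subst tensor_map_elt[OF _ _ _ _ comp_linear id])
       (simp_all add: tensor_elt_closed tensor_is_module H_module)
  moreover have "\<mu> x y w (tensor_map R (H x y) (H y w) id (\<mu> y z w)
        (tensor_assoc R (H x y) (H y z) (H z w)
      (tensor_elt R (tensor R (H x y) (H y z)) (H z w) (tensor_elt R (H x y) (H y z) a b) c)))
    = mul x y w a (mul y z w b c)"
    unfolding mul_def using assms
    by (simp add: tensor_assoc_elt H_module)
       (subst tensor_map_elt[OF _ _ _ _ id comp_linear];
        simp add: tensor_elt_closed tensor_is_module H_module)
  ultimately show ?thesis using comp_assoc[OF assms(1-4) 1] by simp
qed

lemma
  assumes x: "x \<in> X" and y: "y \<in> X" and a: "a \<in> carrier (H x y)"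
  shows mul_unit_left: "mul x x y (unit x) a = a" and mul_unit_right: "mul x y y a (unit y) = a"
proof -
  have id: "id \<in> linear_maps R M M" for M :: "('k, 'm) module" unfolding id_def by (rule linear_id)
  have o: "\<one>\<^bsub>R\<^esub> \<in> carrier (regular_module R)" by (simp add: regular_module_def)
  interpret H: module R "H x y" by (rule H_module[OF x y])
  have "mul x x y (unit x) a = tensor_lunit R (H x y) (tensor_elt R (regular_module R) (H x y)
      \<one>\<^bsub>R\<^esub> a)"
    unfolding mul_def unit_def
    using unit_left[OF x y tensor_elt_closed[OF K_module H_module[OF x y] o a]] x y a o
    by (simp add: tensor_map_elt[OF K_module _ _ _ unit_linear id] H_module)
  also have "\<dots> = a"
    unfolding tensor_lunit_def
    using x y a o by (simp add: tensor_lift_elt[OF K_module _ _ tensor_lunit_bilinear] H_module)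
  finally show "mul x x y (unit x) a = a" .
  have "mul x y y a (unit y) = tensor_runit R (H x y) (tensor_elt R (H x y) (regular_module R) a
      \<one>\<^bsub>R\<^esub>)"
    unfolding mul_def unit_def
    using unit_right[OF x y tensor_elt_closed[OF H_module[OF x y] K_module a o]] x y a o
    by (simp add: tensor_map_elt[OF _ K_module _ _ id unit_linear] H_module)
  also have "\<dots> = a"
    unfolding tensor_runit_def
    using x y a o by (simp add: tensor_lift_elt[OF _ K_module _ tensor_runit_bilinear] H_module)
  finally show "mul x y y a (unit y) = a" .
qed

lemma counit_mul:
  assumes "x \<in> X" "y \<in> X" "z \<in> X" "a \<in> carrier (H x y)" "b \<in> carrier (H y z)"
  shows "\<epsilon> x z (mul x y z a b) = \<epsilon> x y a \<otimes>\<^bsub>R\<^esub> \<epsilon> y z b"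
proof -
  have s: "r \<odot>\<^bsub>regular_module R\<^esub> s = r \<otimes>\<^bsub>R\<^esub> s" for r s by (simp add: regular_module_def)
  have c: "\<epsilon> x y a \<in> carrier (regular_module R)" "\<epsilon> y z b \<in> carrier (regular_module R)"
    using assms counit_closed by (simp_all add: regular_module_def)
  have "\<epsilon> x z (mul x y z a b) = tensor_lunit R (regular_module R)
        (tensor_map R (regular_module R) (regular_module R) (\<epsilon> x y) (\<epsilon> y z) (tensor_elt R (H x y)
            (H y z) a b))"
    unfolding mul_def using assms by (intro counit_comp tensor_elt_closed H_module)
  also have "tensor_map R (regular_module R) (regular_module R) (\<epsilon> x y) (\<epsilon> y z) (tensor_elt R
      (H x y) (H y z) a b)
    = tensor_elt R (regular_module R) (regular_module R) (\<epsilon> x y a) (\<epsilon> y z b)"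
    using assms by (intro tensor_map_elt K_module H_module coalgebra.counit_linear[OF
        hom_coalgebra])
  also have "tensor_lunit R (regular_module R) \<dots> = \<epsilon> x y a \<otimes>\<^bsub>R\<^esub> \<epsilon> y z b"
    unfolding tensor_lunit_def s[symmetric]
    by (rule tensor_lift_elt[OF K_module K_module K_module tensor_lunit_bilinear[OF K_module] c])
  finally show ?thesis .
qed

lemma sw_mul:
  assumes x: "x \<in> X" and y: "y \<in> X" and z: "z \<in> X" and a: "a \<in> carrier (H x y)"
      and b: "b \<in> carrier (H y z)"
    and P: "module R P" and F: "bilinear R (H x z) (H x z) P F"
  shows "sw x z P F (mul x y z a b) =
    sw x y P (\<lambda>a1 a2. sw y z P (\<lambda>b1 b2. F (mul x y z a1 b1) (mul x y z a2 b2)) b) a"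
proof -
  note M = H_module[OF x y] and N = H_module[OF y z] and L = H_module[OF x z]
      and T = tensor_is_module
  note m = comp_linear[OF x y z]
  note da = coalgebra.comult_linear[OF hom_coalgebra[OF x y]]
      and db = coalgebra.comult_linear[OF hom_coalgebra[OF y z]]
  have B: "bilinear R (tensor R (H x y) (H y z)) (tensor R (H x y) (H y z)) P (\<lambda>s t. F (\<mu> x y z s)
      (\<mu> x y z t))"
    by (intro bilinearI linear_comp[OF bilinear_left[OF F]] linear_comp[OF bilinear_right[OF F]] m
        linear_closed[OF m])
  have E: "tensor_map R (tensor R (H x y) (H x y)) (tensor R (H y z) (H y z)) (\<Delta> x y) (\<Delta> y z)
      (tensor_elt R (H x y) (H y z) a b) =
    tensor_elt R (tensor R (H x y) (H x y)) (tensor R (H y z) (H y z)) (\<Delta> x y a) (\<Delta> y z b)"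
    by (intro tensor_map_elt M N T da db a b)
  have c: "tensor_middle_flip R (H x y) (H x y) (H y z) (H y z)
      (tensor_elt R (tensor R (H x y) (H x y)) (tensor R (H y z) (H y z)) (\<Delta> x y a) (\<Delta> y z b))
    \<in> carrier (tensor R (tensor R (H x y) (H y z)) (tensor R (H x y) (H y z)))"
    by (intro linear_closed[OF tensor_middle_flip_linear] M N T tensor_elt_closed linear_closed[OF
        da] linear_closed[OF db] a b)
  have "\<Delta> x z (mul x y z a b) = tensor_map R (H x z) (H x z) (\<mu> x y z) (\<mu> x y z)
        (tensor_middle_flip R (H x y) (H x y) (H y z) (H y z)
      (tensor_elt R (tensor R (H x y) (H x y)) (tensor R (H y z) (H y z)) (\<Delta> x y a) (\<Delta> y z b)))"
    unfolding mul_def using comult_comp[OF x y z tensor_elt_closed[OF M N a b]] by (simp only: E)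
  then have "sw x z P F (mul x y z a b) = tensor_lift R P (\<lambda>s t. F (\<mu> x y z s) (\<mu> x y z t))
        (tensor_middle_flip R (H x y) (H x y) (H y z) (H y z)
      (tensor_elt R (tensor R (H x y) (H x y)) (tensor R (H y z) (H y z)) (\<Delta> x y a) (\<Delta> y z b)))"
    unfolding sweedler_def by (simp add: tensor_lift_tensor_map[OF T T L L P m m F c] M N)
  also have "\<dots> = sw x y P (\<lambda>a1 a2. sw y z P (\<lambda>b1 b2. F (mul x y z a1 b1) (mul x y z a2 b2)) b) a"
    unfolding sweedler_def mul_def
    by (rule tensor_lift_middle_flip[OF M M N N P B linear_closed[OF da a] linear_closed[OF db b]])
  finally show ?thesis .
qed

lemma sw_unit:
  assumes x: "x \<in> X" and P: "module R P" and F: "bilinear R (H x x) (H x x) P F"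
  shows "sw x x P F (unit x) = F (unit x) (unit x)"
proof -
  note H = H_module[OF x x] and K = K_module
  have o: "\<one>\<^bsub>R\<^esub> \<in> carrier (regular_module R)" by (simp add: regular_module_def)
  have l: "tensor_lunit R (regular_module R) (tensor_elt R (regular_module R) (regular_module R)
      \<one>\<^bsub>R\<^esub> \<one>\<^bsub>R\<^esub>) = \<one>\<^bsub>R\<^esub>"
    unfolding tensor_lunit_def
    using o by (subst tensor_lift_elt[OF K K K tensor_lunit_bilinear[OF K]]) (simp_all add:
        regular_module_def)
  have "\<Delta> x x (unit x) = tensor_elt R (H x x) (H x x) (unit x) (unit x)"
    using comult_unit[OF x tensor_elt_closed[OF K K o o]]
    by (simp add: l unit_def tensor_map_elt[OF K K H H unit_linear[OF x] unit_linear[OF x] o o])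
  then show ?thesis
    unfolding sweedler_def by (simp add: tensor_lift_elt[OF H H P F] unit_closed x)
qed

lemma linear_sw_arg:
  assumes "x \<in> X" "y \<in> X" "module R P" "bilinear R (H x y) (H x y) P F"
      "f \<in> linear_maps R K (H x y)"
  shows "(\<lambda>k. sw x y P F (f k)) \<in> linear_maps R K P"
  using coalgebra.linear_sweedler_arg[OF hom_coalgebra] assms by blast

lemma linear_sw_param:
  assumes "x \<in> X" "y \<in> X" "module R K" "module R P"
    and "\<And>k. k \<in> carrier K \<Longrightarrow> bilinear R (H x y) (H x y) P (F k)"
    and "\<And>a b. \<lbrakk>a \<in> carrier (H x y); b \<in> carrier (H x y)\<rbrakk> \<Longrightarrow> (\<lambda>k. F k a b) \<in> linear_maps R K P"
    and "h \<in> carrier (H x y)"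
  shows "(\<lambda>k. sw x y P (F k) h) \<in> linear_maps R K P"
  by (rule coalgebra.linear_sweedler_param[OF hom_coalgebra[OF assms(1,2)] assms(3-7)])

lemma sw_closed:
  "\<lbrakk>x \<in> X; y \<in> X; module R P; bilinear R (H x y) (H x y) P F; h \<in> carrier (H x y)\<rbrakk>
    \<Longrightarrow> sw x y P F h \<in> carrier P"
  by (rule coalgebra.sweedler_closed[OF hom_coalgebra])

lemmas sw_cong = coalgebra.sweedler_cong[OF hom_coalgebra]
lemmas sw_coassoc = coalgebra.sweedler_coassoc[OF hom_coalgebra]
lemmas sw_counit_left = coalgebra.sweedler_counit_left[OF hom_coalgebra]
lemmas sw_counit_right = coalgebra.sweedler_counit_right[OF hom_coalgebra]
lemmas linear_sw = coalgebra.linear_sweedler[OF hom_coalgebra]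

lemma sw_swap:
  assumes xy: "x \<in> X" "y \<in> X" and zw: "z \<in> X" "w \<in> X" and P: "module R P"
    and "\<And>m n. \<lbrakk>m \<in> carrier (H x y); n \<in> carrier (H x y)\<rbrakk> \<Longrightarrow> bilinear R (H z w) (H z w) P (F m n)"
    and "\<And>m' n'. \<lbrakk>m' \<in> carrier (H z w); n' \<in> carrier (H z w)\<rbrakk>
        \<Longrightarrow> bilinear R (H x y) (H x y) P (\<lambda>m n. F m n m' n')"
    and "a \<in> carrier (H x y)" "b \<in> carrier (H z w)"
  shows "sw x y P (\<lambda>m n. sw z w P (F m n) b) a = sw z w P (\<lambda>m' n'. sw x y P (\<lambda>m n. F m n m' n') a)
      b"
  unfolding sweedler_def
  by (rule tensor_lift_swap[OF H_module[OF xy] H_module[OF xy] H_module[OF zw] H_module[OF zw] P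
      assms(6,7)])
     (assumption | intro coalgebra.comult_closed[OF hom_coalgebra] xy zw assms(8,9))+

lemma smult_mem: "\<lbrakk>module R P; r \<in> carrier R; p \<in> carrier P\<rbrakk> \<Longrightarrow> r \<odot>\<^bsub>P\<^esub> p \<in> carrier P"
  by (rule module.smult_closed)

text \<open>
  Every use of a sum rule asks for the summand to be linear in each variable. The summands are built
  from products, antipodes, counits, scalars and sums, so these rules decide such questions by
  following the syntax.
\<close>

lemmas multilinear_intros = bilinearI linear_id linear_mul_left linear_mul_right mul_closed
  linear_counit counit_closed unit_closed linear_sw_arg linear_sw_param sw_closed
  linear_smult_left linear_smult_right smult_mem H_module K_module tensor_is_module

end

section \<open>The antipode of a Hopf category\<close>

context hopf_category
begin

lemma linear_antipode:
  "\<lbrakk>x \<in> X; y \<in> X; f \<in> linear_maps R K (H x y)\<rbrakk> \<Longrightarrow> (\<lambda>k. S x y (f k)) \<in> linear_maps R K (H y x)"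
  by (rule linear_comp[OF antipode_linear])

lemma antipode_closed: "\<lbrakk>x \<in> X; y \<in> X; h \<in> carrier (H x y)\<rbrakk> \<Longrightarrow> S x y h \<in> carrier (H y x)"
  by (rule linear_closed[OF antipode_linear])

lemmas hopf_intros = multilinear_intros linear_antipode antipode_closed

lemma
  assumes x: "x \<in> X" and y: "y \<in> X" and P: "module R P" and h: "h \<in> carrier (H x y)"
  shows sw_cancel_right: "g \<in> linear_maps R (H x x) P \<Longrightarrow>
      sw x y P (\<lambda>a b. g (mul x y x a (S x y b))) h = \<epsilon> x y h \<odot>\<^bsub>P\<^esub> g (unit x)" (is "_ \<Longrightarrow> ?r")
    and sw_cancel_left: "g \<in> linear_maps R (H y y) P \<Longrightarrow>
      sw x y P (\<lambda>a b. g (mul y x y (S x y a) b)) h = \<epsilon> x y h \<odot>\<^bsub>P\<^esub> g (unit y)" (is "_ \<Longrightarrow> ?l")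
proof -
  {
    assume g: "g \<in> linear_maps R (H x x) P"
    have B: "bilinear R (H x y) (H x y) (H x x) (\<lambda>a b. mul x y x a (S x y b))"
      using x y by (intro hopf_intros)
    have "sw x y (H x x) (\<lambda>a b. mul x y x a (S x y b)) h =
        \<mu> x y x (sw x y (tensor R (H x y) (H y x)) (\<lambda>a b. tensor_elt R (H x y) (H y x) a
            (S x y b)) h)"
      unfolding mul_def
      by (rule linear_sw[symmetric, OF x y _ H_module[OF x x] _ comp_linear[OF x y x] h])
         (intro bilinearI linear_tensor_elt_left linear_tensor_elt_right hopf_intros x y)+
    also have "\<dots> = \<epsilon> x y h \<odot>\<^bsub>H x x\<^esub> unit x"
      using antipode_right[OF x y h] unfolding tensor_map_def sweedler_def
      by (simp add: eta_eq x y h counit_closed)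
    finally have "sw x y (H x x) (\<lambda>a b. mul x y x a (S x y b)) h = \<epsilon> x y h \<odot>\<^bsub>H x x\<^esub> unit x" .
    then show ?r
      using linear_sw[OF x y H_module[OF x x] P B g h]
      by (simp add: linear_smult[OF g] counit_closed x y h unit_closed)
  next
    assume g: "g \<in> linear_maps R (H y y) P"
    have B: "bilinear R (H x y) (H x y) (H y y) (\<lambda>a b. mul y x y (S x y a) b)"
      using x y by (intro hopf_intros)
    have "sw x y (H y y) (\<lambda>a b. mul y x y (S x y a) b) h =
        \<mu> y x y (sw x y (tensor R (H y x) (H x y)) (\<lambda>a b. tensor_elt R (H y x) (H x y) (S x y a)
            b) h)"
      unfolding mul_def
      by (rule linear_sw[symmetric, OF x y _ H_module[OF y y] _ comp_linear[OF y x y] h])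
         (intro bilinearI linear_tensor_elt_left linear_tensor_elt_right hopf_intros x y)+
    also have "\<dots> = \<epsilon> x y h \<odot>\<^bsub>H y y\<^esub> unit y"
      using antipode_left[OF x y h] unfolding tensor_map_def sweedler_def
      by (simp add: eta_eq x y h counit_closed)
    finally have "sw x y (H y y) (\<lambda>a b. mul y x y (S x y a) b) h = \<epsilon> x y h \<odot>\<^bsub>H y y\<^esub> unit y" .
    then show ?l
      using linear_sw[OF x y H_module[OF y y] P B g h]
      by (simp add: linear_smult[OF g] counit_closed x y h unit_closed)
  }
qed

text \<open>
  In Sweedler notation \<open>G(S(h\<^sub>1)h\<^sub>2, h\<^sub>3) = G(\<epsilon>(h\<^sub>1)1, h\<^sub>2) = G(1, h)\<close>. The proofs of \<open>antipode_mul\<close>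
  and \<open>sw_antipode\<close> each end by applying this twice.
\<close>

lemma sw_absorb_left:
  assumes x: "x \<in> X" and y: "y \<in> X" and P: "module R P" and h: "h \<in> carrier (H x y)"
    and G: "bilinear R (H y y) (H x y) P G"
  shows "sw x y P (\<lambda>p q. sw x y P (\<lambda>r s. G (mul y x y (S x y p) r) s) q) h = G (unit y) h"
proof -
  have "sw x y P (\<lambda>p q. sw x y P (\<lambda>r s. G (mul y x y (S x y p) r) s) q) h =
    sw x y P (\<lambda>c s. sw x y P (\<lambda>p r. G (mul y x y (S x y p) r) s) c) h"
    by (rule sw_coassoc[symmetric, OF x y P _ _ _ h])
       (intro linear_comp[OF bilinear_left[OF G]] bilinear_right[OF G] hopf_intros x y; assumption)+
  also have "\<dots> = sw x y P (\<lambda>c s. \<epsilon> x y c \<odot>\<^bsub>P\<^esub> G (unit y) s) h"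
  proof (rule sw_cong[OF x y P _ h])
    show "bilinear R (H x y) (H x y) P (\<lambda>c s. \<epsilon> x y c \<odot>\<^bsub>P\<^esub> G (unit y) s)"
      using x y P by (intro hopf_intros bilinear_right[OF G] bilinear_closed[OF G])
    show "sw x y P (\<lambda>p r. G (mul y x y (S x y p) r) s) c = \<epsilon> x y c \<odot>\<^bsub>P\<^esub> G (unit y) s"
      if "c \<in> carrier (H x y)" "s \<in> carrier (H x y)" for c s
      by (rule sw_cancel_left[OF x y P that(1) bilinear_left[OF G that(2)]])
  qed
  also have "\<dots> = G (unit y) h"
    by (rule sw_counit_left[OF x y P bilinear_right[OF G unit_closed[OF y]] h])
  finally show ?thesis .
qed

text \<open>
  \<open>\<epsilon>(S(h)) = \<epsilon>(h\<^sub>1)\<epsilon>(S(h\<^sub>2)) = \<epsilon>(h\<^sub>1S(h\<^sub>2)) = \<epsilon>(h)\<close>, because \<open>\<epsilon>\<close> is multiplicative.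
\<close>

lemma counit_antipode:
  assumes x: "x \<in> X" and y: "y \<in> X" and h: "h \<in> carrier (H x y)"
  shows "\<epsilon> y x (S x y h) = \<epsilon> x y h"
proof -
  let ?K = "regular_module R"
  have l: "(\<lambda>b. \<epsilon> y x (S x y b)) \<in> linear_maps R (H x y) ?K" using x y by (intro hopf_intros)
  have "\<epsilon> y x (S x y h) = sw x y ?K (\<lambda>a b. \<epsilon> x y a \<odot>\<^bsub>?K\<^esub> \<epsilon> y x (S x y b)) h"
    by (rule sw_counit_left[symmetric, OF x y K_module l h])
  also have "\<dots> = sw x y ?K (\<lambda>a b. \<epsilon> x x (mul x y x a (S x y b))) h"
  proof (rule sw_cong[OF x y K_module _ h])
    show "bilinear R (H x y) (H x y) ?K (\<lambda>a b. \<epsilon> x x (mul x y x a (S x y b)))"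
      using x y by (intro hopf_intros)
  qed (use x y in \<open>simp add: counit_mul antipode_closed regular_module_def\<close>)
  also have "\<dots> = \<epsilon> x y h \<odot>\<^bsub>?K\<^esub> \<epsilon> x x (unit x)"
    by (rule sw_cancel_right[OF x y K_module h]) (use x in \<open>intro hopf_intros\<close>)
  also have "\<dots> = \<epsilon> x y h"
    using x y h by (simp add: unit_def counit_unit counit_closed regular_module_def)
  finally show ?thesis .
qed

text \<open>
  On the coalgebra \<open>H x y \<otimes> H y z\<close>, the map \<open>a \<otimes> b \<mapsto> S(ab)\<close> is a right convolution inverse of the
  multiplication and \<open>a \<otimes> b \<mapsto> S(b)S(a)\<close> a left one. Written out, the expression
  \<open>S(b\<^sub>1)S(a\<^sub>1) \<cdot> a\<^sub>2b\<^sub>2 \<cdot> S(a\<^sub>3b\<^sub>3)\<close> equals \<open>S(b)S(a)\<close>, because \<open>(a\<^sub>2b\<^sub>2) S(a\<^sub>3b\<^sub>3)\<close> is the antipode axiom for the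
  element \<open>a\<^sub>2b\<^sub>2\<close>; and it equals \<open>S(ab)\<close>, because \<open>S(a\<^sub>1)a\<^sub>2\<close> and then \<open>S(b\<^sub>1)b\<^sub>2\<close> can be absorbed.
\<close>

lemma antipode_mul:
  assumes x: "x \<in> X" and y: "y \<in> X" and z: "z \<in> X" and a: "a \<in> carrier (H x y)"
      and b: "b \<in> carrier (H y z)"
  shows "S x z (mul x y z a b) = mul z y x (S y z b) (S x y a)"
proof -
  let ?P = "H z x"
  note P = H_module[OF z x]
  \<comment> \<open>Both normal forms of one product: the left one exposes the antipode axiom for \<open>a\<^sub>2b\<^sub>2\<close>, the right
     one exposes the factor \<open>S(a\<^sub>1)a\<^sub>2\<close>.\<close>
  have reassoc: "mul z x x (mul z y x (S y z b1) (S x y a1)) (mul x z x (mul x y z a2 b2) c) =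
      mul z z x (mul z y z (S y z b1) (mul y y z (mul y x y (S x y a1) a2) b2)) c"
    if "a1 \<in> carrier (H x y)" "a2 \<in> carrier (H x y)" "b1 \<in> carrier (H y z)" "b2 \<in> carrier (H y z)"
      "c \<in> carrier (H z x)" for a1 a2 b1 b2 c
  proof -
    have "mul z x x (mul z y x (S y z b1) (S x y a1)) (mul x z x (mul x y z a2 b2) c) =
        mul z y x (S y z b1) (mul y z x (mul y x z (S x y a1) (mul x y z a2 b2)) c)"
      using x y z that by (simp add: mul_assoc mul_closed antipode_closed)
    also have "\<dots> = mul z z x (mul z y z (S y z b1) (mul y y z (mul y x y (S x y a1) a2) b2)) c"
      using x y z that by (simp add: mul_assoc mul_closed antipode_closed)
    finally show ?thesis .
  qed
  \<comment> \<open>The central expression of the proof as a function of the components of \<open>a\<close> and \<open>b\<close>.\<close>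
  define T where "T a1 b1 a3 b3 a4 b4 =
    mul z z x (mul z y z (S y z b1) (mul y y z (mul y x y (S x y a1) a3) b3)) (S x z (mul x y z a4
        b4))"
    for a1 b1 a3 b3 a4 b4
  have "mul z y x (S y z b) (S x y a) = sw x y ?P (\<lambda>a1 a2. \<epsilon> x y a2
      \<odot>\<^bsub>?P\<^esub> mul z y x (S y z b) (S x y a1)) a"
    by (rule sw_counit_right[symmetric, OF x y P _ a]) (intro hopf_intros x y z b)
  also have "\<dots> = sw x y ?P (\<lambda>a1 a2. sw y z ?P (\<lambda>b1 b2. \<epsilon> y z b2 \<odot>\<^bsub>?P\<^esub>
      (\<epsilon> x y a2 \<odot>\<^bsub>?P\<^esub> mul z y x (S y z b1) (S x y a1))) b) a"
  proof (rule sw_cong[OF x y P _ a], goal_cases)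
    case 1
    then show ?case by (intro hopf_intros x y z b; assumption)
  next
    case (2 a1 a2)
    show ?case
      by (rule sw_counit_right[symmetric, OF y z P _ b,
            of "\<lambda>b. \<epsilon> x y a2 \<odot>\<^bsub>?P\<^esub> mul z y x (S y z b) (S x y a1)"])
         (intro hopf_intros x y z 2)
  qed
  also have "\<dots> = sw x y ?P (\<lambda>a1 a2. sw y z ?P (\<lambda>b1 b2.
      sw x y ?P (\<lambda>a3 a4. sw y z ?P (\<lambda>b3 b4. T a1 b1 a3 b3 a4 b4) b2) a2) b) a"
  proof (rule sw_cong[OF x y P _ a], goal_cases)
    case 1
    then show ?case unfolding T_def by (intro hopf_intros x y z b; assumption)
  next
    case (2 a1 a2)
    note a12 = 2
    show ?case
    proof (rule sw_cong[OF y z P _ b], goal_cases)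
      case 1
      then show ?case unfolding T_def by (intro hopf_intros x y z a12; assumption)
    next
      case (2 b1 b2)
      interpret P: module R ?P by (rule P)
      let ?u = "mul z y x (S y z b1) (S x y a1)"
      have u: "?u \<in> carrier ?P" by (intro hopf_intros x y z a12 2)
      have ab: "mul x y z a2 b2 \<in> carrier (H x z)" by (intro hopf_intros x y z a12 2)
      have "\<epsilon> y z b2 \<odot>\<^bsub>?P\<^esub> (\<epsilon> x y a2 \<odot>\<^bsub>?P\<^esub> ?u) = \<epsilon> x z (mul x y z a2 b2)
          \<odot>\<^bsub>?P\<^esub> mul z x x ?u (unit x)"
        using x y z a12 2 u
        by (simp add: counit_mul mul_unit_right P.smult_assoc1[symmetric] counit_closed m_comm)
      also have "\<dots> = sw x z ?P (\<lambda>c d. mul z x x ?u (mul x z x c (S x z d))) (mul x y z a2 b2)"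
        by (rule sw_cancel_right[symmetric, OF x z P ab]) (intro hopf_intros x y z u)
      also have "\<dots> = sw x y ?P (\<lambda>a3 a4. sw y z ?P (\<lambda>b3 b4.
          mul z x x ?u (mul x z x (mul x y z a3 b3) (S x z (mul x y z a4 b4)))) b2) a2"
        by (rule sw_mul[OF x y z _ _ P]) (intro hopf_intros x y z u a12 2; assumption)+
      also have "\<dots> = sw x y ?P (\<lambda>a3 a4. sw y z ?P (\<lambda>b3 b4. T a1 b1 a3 b3 a4 b4) b2) a2"
      proof (rule sw_cong[OF x y P _ a12(2)], goal_cases)
        case 1
        then show ?case unfolding T_def by (intro hopf_intros x y z a12 2; assumption)
      next
        case (2 a3 a4)
        show ?case
        proof (rule sw_cong[OF y z P _ \<open>b2 \<in> _\<close>], goal_cases)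
          case 1
          then show ?case unfolding T_def by (intro hopf_intros x y z a12 2 \<open>b1 \<in> _\<close>; assumption)
        next
          case (2 b3 b4)
          show ?case unfolding T_def by (intro reassoc hopf_intros x y z a12 2 \<open>b1 \<in> _\<close> \<open>a3 \<in> _\<close>
              \<open>a4 \<in> _\<close>)
        qed
      qed
      finally show ?case .
    qed
  qed
  also have "\<dots> = sw x y ?P (\<lambda>a1 a2. sw x y ?P (\<lambda>a3 a4. sw y z ?P (\<lambda>b1 b2.
      sw y z ?P (\<lambda>b3 b4. T a1 b1 a3 b3 a4 b4) b2) b) a2) a"
  proof (rule sw_cong[OF x y P _ a], goal_cases)
    case 1
    then show ?case unfolding T_def by (intro hopf_intros x y z b; assumption)
  next
    case (2 a1 a2)
    show ?case unfolding T_def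
      by (rule sw_swap[OF y z x y P, where F = "\<lambda>b1 b2 a3 a4. sw y z ?P (\<lambda>b3 b4.
            mul z z x (mul z y z (S y z b1) (mul y y z (mul y x y (S x y a1) a3) b3))
              (S x z (mul x y z a4 b4))) b2"])
         (intro hopf_intros x y z b 2; assumption)+
  qed
  also have "\<dots> = sw y z ?P (\<lambda>b1 b2. sw y z ?P (\<lambda>b3 b4.
      mul z z x (mul z y z (S y z b1) (mul y y z (unit y) b3)) (S x z (mul x y z a b4))) b2) b"
    unfolding T_def by (rule sw_absorb_left[OF x y P a]) (intro hopf_intros x y z b; assumption)
  also have "\<dots> = sw y z ?P (\<lambda>b1 b2. sw y z ?P (\<lambda>b3 b4.
      mul z z x (mul z y z (S y z b1) b3) (S x z (mul x y z a b4))) b2) b"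
  proof (rule sw_cong[OF y z P _ b], goal_cases)
    case 1
    then show ?case by (intro hopf_intros x y z a; assumption)
  next
    case (2 b1 b2)
    show ?case
    proof (rule sw_cong[OF y z P _ \<open>b2 \<in> _\<close>], goal_cases)
      case 1
      then show ?case by (intro hopf_intros x y z a 2; assumption)
    qed (simp add: mul_unit_left y z)
  qed
  also have "\<dots> = mul z z x (unit z) (S x z (mul x y z a b))"
    by (rule sw_absorb_left[OF y z P b]) (intro hopf_intros x y z a; assumption)
  also have "\<dots> = S x z (mul x y z a b)"
    by (intro mul_unit_left hopf_intros x y z a b)
  finally show ?thesis ..
qed

text \<open>
  This is \<open>\<Delta>(S(h)) = S(h\<^sub>2) \<otimes> S(h\<^sub>1)\<close>, tested against a bilinear \<open>F\<close> so that no multiplication on a tensor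
  product is required. Both sides are convolution inverses of \<open>\<Delta>\<close>: the expression
  \<open>(S(h\<^sub>2) \<otimes> S(h\<^sub>1)) \<cdot> \<Delta>(h\<^sub>3) \<cdot> \<Delta>(S(h\<^sub>4))\<close> collapses on the right because \<open>\<Delta>\<close> is multiplicative and
  \<open>h\<^sub>3S(h\<^sub>4) = \<epsilon>(h\<^sub>3)1\<close>, and on the left by absorbing first the inner pair \<open>S(h\<^sub>2)h\<^sub>3\<close> and then the outer one.
\<close>

lemma sw_antipode:
  assumes x: "x \<in> X" and y: "y \<in> X" and h: "h \<in> carrier (H x y)" and P: "module R P"
    and F: "bilinear R (H y x) (H y x) P F"
  shows "sw y x P F (S x y h) = sw x y P (\<lambda>p q. F (S x y q) (S x y p)) h"
proof -
  note lF = hopf_intros linear_comp[OF bilinear_left[OF F]] linear_comp[OF bilinear_right[OF F]]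
      bilinear_closed[OF F]
  interpret P: module R P by (rule P)
  \<comment> \<open>With \<open>p, q, e, f, d\<close> standing for \<open>h\<^sub>1, \<dots>, h\<^sub>5\<close> this is the central expression of the proof.\<close>
  define T where "T p q e f d = sw y x P (\<lambda>s t. F (mul y y x (mul y x y (S x y q) e) s)
      (mul y y x (mul y x y (S x y p) f) t)) (S x y d)" for p q e f d
  have Tlin: "(\<lambda>p. T p q e f d) \<in> linear_maps R (H x y) P"
      "(\<lambda>q. T p q e f d) \<in> linear_maps R (H x y) P" "(\<lambda>e. T p q e f d) \<in> linear_maps R (H x y) P"
      "(\<lambda>f. T p q e f d) \<in> linear_maps R (H x y) P" "(\<lambda>d. T p q e f d) \<in> linear_maps R (H x y) P"
    if "p \<in> carrier (H x y)" "q \<in> carrier (H x y)" "e \<in> carrier (H x y)" "f \<in> carrier (H x y)"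
      "d \<in> carrier (H x y)" for p q e f d
    unfolding T_def by (intro lF x y P that; assumption)+
  have inner: "sw x y P (\<lambda>e g. sw x y P (\<lambda>f d. T p q e f d) g) b = \<epsilon> x y b
      \<odot>\<^bsub>P\<^esub> F (S x y q) (S x y p)"
    if p: "p \<in> carrier (H x y)" and q: "q \<in> carrier (H x y)" and b: "b \<in> carrier (H x y)" for p q b
  proof -
    let ?J = "sw x x P (\<lambda>u v. F (mul y x x (S x y q) u) (mul y x x (S x y p) v))"
    have B: "bilinear R (H x x) (H x x) P (\<lambda>u v. F (mul y x x (S x y q) u) (mul y x x (S x y p) v))"
      by (intro lF x y P p q; assumption)
    have "sw x y P (\<lambda>e g. sw x y P (\<lambda>f d. T p q e f d) g) b
        = sw x y P (\<lambda>c d. sw x y P (\<lambda>e f. T p q e f d) c) b"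
      by (rule sw_coassoc[symmetric, OF x y P _ _ _ b]) (intro Tlin p q; assumption)+
    also have "\<dots> = sw x y P (\<lambda>c d. ?J (mul x y x c (S x y d))) b"
    proof (rule sw_cong[OF x y P _ b], goal_cases)
      case 1
      then show ?case by (intro lF x y P p q; assumption)
    next
      case (2 c d)
      have "?J (mul x y x c (S x y d)) = sw x y P (\<lambda>e f. sw y x P (\<lambda>s t.
          F (mul y x x (S x y q) (mul x y x e s)) (mul y x x (S x y p) (mul x y x f t)))
              (S x y d)) c"
        by (rule sw_mul[OF x y x _ _ P B]) (intro hopf_intros x y 2)+
      also have "\<dots> = sw x y P (\<lambda>e f. T p q e f d) c"
      proof (rule sw_cong[OF x y P _ \<open>c \<in> _\<close>], goal_cases)
        case 1
        then show ?case by (intro bilinearI Tlin p q 2; assumption)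
      next
        case (2 e f)
        show ?case unfolding T_def
        proof (rule sw_cong[OF y x P], goal_cases)
          case 1
          then show ?case by (intro lF x y P p q 2; assumption)
        next
          case 2
          then show ?case by (intro hopf_intros x y \<open>d \<in> _\<close>)
        next
          case (3 s t)
          then show ?case using x y p q 2 by (simp add: mul_assoc antipode_closed)
        qed
      qed
      finally show ?case ..
    qed
    also have "\<dots> = \<epsilon> x y b \<odot>\<^bsub>P\<^esub> ?J (unit x)"
      by (rule sw_cancel_right[OF x y P b linear_sw_arg[OF x x P B linear_id]])
    also have "?J (unit x) = F (S x y q) (S x y p)"
      using x y p q by (simp add: sw_unit[OF x P B] mul_unit_right antipode_closed)
    finally show ?thesis .
  qed
  have "sw x y P (\<lambda>p q. F (S x y q) (S x y p)) h =
      sw x y P (\<lambda>p r. sw x y P (\<lambda>q b. \<epsilon> x y b \<odot>\<^bsub>P\<^esub> F (S x y q) (S x y p)) r) h"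
    by (rule sw_cong[OF x y P _ h], (intro lF x y P; assumption), rule sw_counit_right[symmetric,
        OF x y P])
       (intro lF x y P; assumption)+
  also have "\<dots> = sw x y P (\<lambda>p r. sw x y P (\<lambda>q b. sw x y P (\<lambda>e g. sw x y P (\<lambda>f d. T p q e f d) g)
      b) r) h"
  proof (rule sw_cong[OF x y P _ h], goal_cases)
    case 1
    then show ?case by (intro hopf_intros Tlin x y P; assumption)
  next
    case (2 p r)
    show ?case
    proof (rule sw_cong[OF x y P _ \<open>r \<in> _\<close>], goal_cases)
      case 1
      then show ?case by (intro hopf_intros Tlin x y P 2; assumption)
    qed (rule inner[symmetric, OF \<open>p \<in> _\<close>])
  qed
  also have "\<dots> = sw x y P (\<lambda>p r. sw x y P (\<lambda>f d. sw y x P (\<lambda>s t. F (mul y y x (unit y) s)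
      (mul y y x (mul y x y (S x y p) f) t)) (S x y d)) r) h"
  proof (rule sw_cong[OF x y P _ h], goal_cases)
    case 1
    then show ?case by (intro lF x y P; assumption)
  next
    case (2 p r)
    show ?case unfolding T_def
      by (rule sw_absorb_left[OF x y P \<open>r \<in> _\<close>]) (intro lF x y P \<open>p \<in> _\<close>; assumption)
  qed
  also have "\<dots> = sw y x P (\<lambda>s t. F (mul y y x (unit y) s) (mul y y x (unit y) t)) (S x y h)"
    by (rule sw_absorb_left[OF x y P h]) (intro lF x y P; assumption)
  also have "\<dots> = sw y x P F (S x y h)"
    by (rule sw_cong[OF y x P F]) (use x y h in \<open>simp_all add: antipode_closed mul_unit_left\<close>)
  finally show ?thesis ..
qed

end

section \<open>The algebra of a coalgebra category\<close>

context coalgebra_category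
begin

abbreviation Q where "Q \<equiv> alg X H"
abbreviation incl where "incl \<equiv> alg_inj X H"
abbreviation mulQ where "mulQ f g \<equiv> alg_mult R X H \<mu> (tensor_elt R Q Q f g)"
abbreviation comultQ where "comultQ \<equiv> alg_comult R X H \<Delta>"

lemma pair_module: "i \<in> X \<times> X \<Longrightarrow> module R ((\<lambda>(x, y). H x y) i)"
  by (auto intro: H_module)

lemma Q_module: "module R Q"
  unfolding alg_def by (rule direct_sum_is_module[OF is_cring pair_module])

lemma Q_zero_closed: "\<zero>\<^bsub>Q\<^esub> \<in> carrier Q"
proof -
  interpret Q: module R Q by (rule Q_module)
  show ?thesis by simp
qed

lemma sw_zero:
  assumes "x \<in> X" "y \<in> X" "module R P" "h \<in> carrier (H x y)"
  shows "sw x y P (\<lambda>a b. \<zero>\<^bsub>P\<^esub>) h = \<zero>\<^bsub>P\<^esub>"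
  by (rule linear_sw[where F = "\<lambda>a b. \<zero>\<^bsub>P\<^esub>", OF assms(1-3,3) _ linear_const_zero[OF assms(3)]
      assms(4), symmetric])
     (intro bilinearI linear_const_zero assms)

lemma incl_linear: "\<lbrakk>x \<in> X; y \<in> X\<rbrakk> \<Longrightarrow> incl x y \<in> linear_maps R (H x y) Q"
  using direct_sum_inj_linear[where I = "X \<times> X" and M = "\<lambda>(x, y). H x y"
      and i = "(x, y)", OF is_cring pair_module]
  unfolding alg_def alg_inj_def by simp

lemma linear_incl:
  "\<lbrakk>x \<in> X; y \<in> X; f \<in> linear_maps R K (H x y)\<rbrakk> \<Longrightarrow> (\<lambda>k. incl x y (f k)) \<in> linear_maps R K Q"
  by (rule linear_comp[OF incl_linear])

lemma incl_closed: "\<lbrakk>x \<in> X; y \<in> X; a \<in> carrier (H x y)\<rbrakk> \<Longrightarrow> incl x y a \<in> carrier Q"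
  by (rule linear_closed[OF incl_linear])

text \<open>
  Identities of multilinear maps on the direct sum need to be checked only on homogeneous elements,
  where every structure map reduces to one of the category. The axioms of \<open>Q\<close> are obtained in this way.
\<close>

lemma alg_ext:
  assumes P: "module R P" and f: "f \<in> linear_maps R Q P" and g: "g \<in> linear_maps R Q P"
    and eq: "\<And>x y a. \<lbrakk>x \<in> X; y \<in> X; a \<in> carrier (H x y)\<rbrakk> \<Longrightarrow> f (incl x y a) = g (incl x y a)"
    and q: "q \<in> carrier Q"
  shows "f q = g q"
  using direct_sum_ext[OF is_cring pair_module P f[unfolded alg_def] g[unfolded alg_def] _
      q[unfolded alg_def]] eq
  unfolding alg_inj_def by auto

lemma alg_lift_linear:
  assumes "module R P" "\<And>x y. \<lbrakk>x \<in> X; y \<in> X\<rbrakk> \<Longrightarrow> \<phi> x y \<in> linear_maps R (H x y) P"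
  shows "alg_lift X H P \<phi> \<in> linear_maps R Q P"
  unfolding alg_lift_def alg_def
  by (rule direct_sum_lift_linear[OF is_cring pair_module assms(1)]) (use assms(2) in auto)

lemma alg_lift_incl:
  assumes "module R P" "\<And>x y. \<lbrakk>x \<in> X; y \<in> X\<rbrakk> \<Longrightarrow> \<phi> x y \<in> linear_maps R (H x y) P"
    and "x \<in> X" "y \<in> X" "a \<in> carrier (H x y)"
  shows "alg_lift X H P \<phi> (incl x y a) = \<phi> x y a"
proof -
  have "(case i of (x, y) \<Rightarrow> \<phi> x y) \<in> linear_maps R (case i of (x, y) \<Rightarrow> H x y) P" if "i \<in> X \<times> X"
      for i
    using that assms(2) by auto
  from direct_sum_lift_inj[OF is_cring pair_module assms(1) this, where i = "(x, y)" and a = a]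
  show ?thesis unfolding alg_lift_def alg_inj_def using assms(3-) by simp
qed

lemma linear_alg_lift_param:
  assumes K: "module R K" and P: "module R P"
    and \<phi>: "\<And>k x y. \<lbrakk>k \<in> carrier K; x \<in> X; y \<in> X\<rbrakk> \<Longrightarrow> \<phi> k x y \<in> linear_maps R (H x y) P"
    and l: "\<And>x y a. \<lbrakk>x \<in> X; y \<in> X; a \<in> carrier (H x y)\<rbrakk> \<Longrightarrow> (\<lambda>k. \<phi> k x y a) \<in> linear_maps R K P"
    and f: "f \<in> carrier Q"
  shows "(\<lambda>k. alg_lift X H P (\<phi> k) f) \<in> linear_maps R K P"
  unfolding alg_lift_def
  by (rule linear_direct_sum_lift_param[OF is_cring pair_module K P _ _ f[unfolded alg_def]])
     (use \<phi> l in auto)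

text \<open>
  The bilinear map underlying \<open>alg_mult\<close>, named so that its bilinearity can be stated once.
\<close>

definition alg_mult_map where
  "alg_mult_map = (\<lambda>f g. alg_lift X H Q
      (\<lambda>x y a. alg_lift X H Q
        (\<lambda>w z b. if y = w then incl x z (\<mu> x y z (tensor_elt R (H x y) (H y z) a b)) else \<zero>\<^bsub>Q\<^esub>) g)
            f)"

lemma alg_mult_summand_linear:
  assumes "x \<in> X" "y \<in> X" "a \<in> carrier (H x y)" "w \<in> X" "z \<in> X"
  shows "(\<lambda>b. if y = w then incl x z (\<mu> x y z (tensor_elt R (H x y) (H y z) a b)) else \<zero>\<^bsub>Q\<^esub>)
    \<in> linear_maps R (H w z) Q"
  unfolding mul_def[symmetric]
  using assms linear_const_zero[OF Q_module] by (cases "y = w") (auto intro!: linear_incl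
      multilinear_intros)

lemma alg_mult_row_linear:
  assumes x: "x \<in> X" and y: "y \<in> X" and g: "g \<in> carrier Q"
  shows "(\<lambda>a. alg_lift X H Q
        (\<lambda>w z b. if y = w then incl x z (\<mu> x y z (tensor_elt R (H x y) (H y z) a b)) else \<zero>\<^bsub>Q\<^esub>) g)
    \<in> linear_maps R (H x y) Q"
proof (rule linear_alg_lift_param[OF H_module[OF x y] Q_module _ _ g])
  fix w z b assume "w \<in> X" "z \<in> X" "b \<in> carrier (H w z)"
  then show "(\<lambda>a. if y = w then incl x z (\<mu> x y z (tensor_elt R (H x y) (H y z) a b)) else \<zero>\<^bsub>Q\<^esub>)
      \<in> linear_maps R (H x y) Q"
    unfolding mul_def[symmetric]
    using x y linear_const_zero[OF Q_module] by (cases "y = w") (auto intro!: linear_incl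
        multilinear_intros)
qed (rule alg_mult_summand_linear[OF x y])

lemma alg_mult_map_bilinear: "bilinear R Q Q Q alg_mult_map"
proof (rule bilinearI)
  show "(\<lambda>g. alg_mult_map f g) \<in> linear_maps R Q Q" if f: "f \<in> carrier Q" for f
    unfolding alg_mult_map_def
    by (rule linear_alg_lift_param[OF Q_module Q_module alg_mult_row_linear _ f];
        (assumption | rule alg_lift_linear[OF Q_module alg_mult_summand_linear])+)
  show "(\<lambda>f. alg_mult_map f g) \<in> linear_maps R Q Q" if g: "g \<in> carrier Q" for g
    unfolding alg_mult_map_def
    by (rule alg_lift_linear[OF Q_module alg_mult_row_linear[OF _ _ g]])
qed

lemma alg_mult_linear: "alg_mult R X H \<mu> \<in> linear_maps R (tensor R Q Q) Q"
  unfolding alg_mult_def alg_mult_map_def[symmetric]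
  by (rule tensor_lift_linear[OF Q_module Q_module Q_module alg_mult_map_bilinear])

lemma linear_mulQ_left:
  "\<lbrakk>f \<in> linear_maps R K Q; b \<in> carrier Q\<rbrakk> \<Longrightarrow> (\<lambda>k. mulQ (f k) b) \<in> linear_maps R K Q"
  by (intro linear_comp[OF alg_mult_linear] linear_tensor_elt_left Q_module)

lemma linear_mulQ_right:
  "\<lbrakk>f \<in> linear_maps R K Q; a \<in> carrier Q\<rbrakk> \<Longrightarrow> (\<lambda>k. mulQ a (f k)) \<in> linear_maps R K Q"
  by (intro linear_comp[OF alg_mult_linear] linear_tensor_elt_right Q_module)

lemma mulQ_closed: "\<lbrakk>a \<in> carrier Q; b \<in> carrier Q\<rbrakk> \<Longrightarrow> mulQ a b \<in> carrier Q"
  by (intro linear_closed[OF alg_mult_linear] tensor_elt_closed Q_module)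

lemma mulQ_incl:
  assumes x: "x \<in> X" and y: "y \<in> X" and w: "w \<in> X" and z: "z \<in> X"
    and a: "a \<in> carrier (H x y)" and b: "b \<in> carrier (H w z)"
  shows "mulQ (incl x y a) (incl w z b) = (if y = w then incl x z (mul x y z a b) else \<zero>\<^bsub>Q\<^esub>)"
proof -
  note ia = incl_closed[OF x y a] and ib = incl_closed[OF w z b]
  have "mulQ (incl x y a) (incl w z b) = alg_mult_map (incl x y a) (incl w z b)"
    unfolding alg_mult_def alg_mult_map_def[symmetric]
    by (rule tensor_lift_elt[OF Q_module Q_module Q_module alg_mult_map_bilinear ia ib])
  also have "\<dots> = alg_lift X H Q
        (\<lambda>w z b. if y = w then incl x z (\<mu> x y z (tensor_elt R (H x y) (H y z) a b)) else \<zero>\<^bsub>Q\<^esub>)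
            (incl w z b)"
    unfolding alg_mult_map_def
    by (rule alg_lift_incl[OF Q_module alg_mult_row_linear[OF _ _ ib] x y a])
  also have "\<dots> = (if y = w then incl x z (mul x y z a b) else \<zero>\<^bsub>Q\<^esub>)"
    unfolding mul_def
    by (rule alg_lift_incl[OF Q_module alg_mult_summand_linear[OF x y a] w z b])
  finally show ?thesis .
qed

lemma mulQ_zero_left: "a \<in> carrier Q \<Longrightarrow> mulQ \<zero>\<^bsub>Q\<^esub> a = \<zero>\<^bsub>Q\<^esub>"
  by (rule linear_zero[OF Q_module Q_module linear_mulQ_left[OF linear_id]])

lemma mulQ_zero_right: "a \<in> carrier Q \<Longrightarrow> mulQ a \<zero>\<^bsub>Q\<^esub> = \<zero>\<^bsub>Q\<^esub>"
  by (rule linear_zero[OF Q_module Q_module linear_mulQ_right[OF linear_id]])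

lemma mulQ_assoc:
  assumes f: "f \<in> carrier Q" and g: "g \<in> carrier Q" and h: "h \<in> carrier Q"
  shows "mulQ (mulQ f g) h = mulQ f (mulQ g h)"
proof (rule alg_ext[OF Q_module _ _ _ f])
  show "(\<lambda>f. mulQ (mulQ f g) h) \<in> linear_maps R Q Q" "(\<lambda>f. mulQ f (mulQ g h)) \<in> linear_maps R Q Q"
    by (intro linear_mulQ_left linear_id mulQ_closed g h)+
  fix x y a assume a: "x \<in> X" "y \<in> X" "a \<in> carrier (H x y)"
  note ia = incl_closed[OF a]
  show "mulQ (mulQ (incl x y a) g) h = mulQ (incl x y a) (mulQ g h)"
  proof (rule alg_ext[OF Q_module _ _ _ g])
    show "(\<lambda>g. mulQ (mulQ (incl x y a) g) h) \<in> linear_maps R Q Q"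
        "(\<lambda>g. mulQ (incl x y a) (mulQ g h)) \<in> linear_maps R Q Q"
      by (intro linear_mulQ_left linear_mulQ_right linear_id ia h)+
    fix w z b assume b: "w \<in> X" "z \<in> X" "b \<in> carrier (H w z)"
    note ib = incl_closed[OF b]
    show "mulQ (mulQ (incl x y a) (incl w z b)) h = mulQ (incl x y a) (mulQ (incl w z b) h)"
    proof (rule alg_ext[OF Q_module _ _ _ h])
      show "(\<lambda>h. mulQ (mulQ (incl x y a) (incl w z b)) h) \<in> linear_maps R Q Q"
        "(\<lambda>h. mulQ (incl x y a) (mulQ (incl w z b) h)) \<in> linear_maps R Q Q"
        by (intro linear_mulQ_right linear_id mulQ_closed ia ib)+
      fix u v c assume c: "u \<in> X" "v \<in> X" "c \<in> carrier (H u v)"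
      then show "mulQ (mulQ (incl x y a) (incl w z b)) (incl u v c)
          = mulQ (incl x y a) (mulQ (incl w z b) (incl u v c))"
        using a b by (auto simp: mulQ_incl mul_closed mul_assoc mulQ_zero_left mulQ_zero_right
            incl_closed)
    qed
  qed
qed

lemma comultQ_summand_linear:
  assumes "x \<in> X" "y \<in> X"
  shows "(\<lambda>h. tensor_map R Q Q (incl x y) (incl x y) (\<Delta> x y h))
      \<in> linear_maps R (H x y) (tensor R Q Q)"
  by (intro linear_comp[OF tensor_map_linear coalgebra.comult_linear[OF hom_coalgebra]]
      H_module Q_module incl_linear assms)

lemma comultQ_linear: "comultQ \<in> linear_maps R Q (tensor R Q Q)"
  unfolding alg_comult_def
  by (intro alg_lift_linear tensor_is_module Q_module comultQ_summand_linear)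

lemma comultQ_closed: "q \<in> carrier Q \<Longrightarrow> comultQ q \<in> carrier (tensor R Q Q)"
  by (rule linear_closed[OF comultQ_linear])

abbreviation swQ where "swQ \<equiv> sweedler R comultQ"

lemma swQ_incl:
  assumes x: "x \<in> X" and y: "y \<in> X" and h: "h \<in> carrier (H x y)" and P: "module R P"
    and F: "bilinear R Q Q P F"
  shows "swQ P F (incl x y h) = sw x y P (\<lambda>a b. F (incl x y a) (incl x y b)) h"
proof -
  note H = H_module[OF x y] and i = incl_linear[OF x y]
  have "comultQ (incl x y h) = tensor_map R Q Q (incl x y) (incl x y) (\<Delta> x y h)"
    unfolding alg_comult_def
    by (rule alg_lift_incl[OF tensor_is_module[OF Q_module Q_module] comultQ_summand_linear x y h])
  then show ?thesis
    unfolding sweedler_def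
    using tensor_lift_tensor_map[OF H H Q_module Q_module P i i F coalgebra.comult_closed[OF
        hom_coalgebra[OF x y] h]]
    by simp
qed

lemma swQ_linear:
  assumes "module R P" "bilinear R Q Q P F"
  shows "swQ P F \<in> linear_maps R Q P"
  using linear_comp[OF tensor_lift_linear[OF Q_module Q_module assms] comultQ_linear]
  unfolding sweedler_def[abs_def] by (simp add: eta_contract_eq)

lemma linear_swQ_param:
  assumes "module R K" "module R P" "\<And>k. k \<in> carrier K \<Longrightarrow> bilinear R Q Q P (F k)"
    and "\<And>a b. \<lbrakk>a \<in> carrier Q; b \<in> carrier Q\<rbrakk> \<Longrightarrow> (\<lambda>k. F k a b) \<in> linear_maps R K P"
    and "q \<in> carrier Q"
  shows "(\<lambda>k. swQ P (F k) q) \<in> linear_maps R K P"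
  unfolding sweedler_def
  by (intro linear_tensor_lift_param[OF assms(1) Q_module Q_module] comultQ_closed assms)

lemma linear_swQ:
  assumes "module R P" "module R P'" "bilinear R Q Q P F" "f \<in> linear_maps R P P'" "q \<in> carrier Q"
  shows "f (swQ P F q) = swQ P' (\<lambda>a b. f (F a b)) q"
  unfolding sweedler_def by (intro linear_tensor_lift[OF Q_module Q_module] comultQ_closed assms)

lemma swQ_cong:
  assumes "module R P" "bilinear R Q Q P F'" "q \<in> carrier Q"
    and "\<And>a b. \<lbrakk>a \<in> carrier Q; b \<in> carrier Q\<rbrakk> \<Longrightarrow> F a b = F' a b"
  shows "swQ P F q = swQ P F' q"
  unfolding sweedler_def
  by (rule tensor_lift_cong[OF Q_module Q_module assms(1,2) comultQ_closed[OF assms(3)] assms(4)])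

lemma tensor_map_comultQ:
  assumes "module R P" "module R P'" "f \<in> linear_maps R Q P" "g \<in> linear_maps R Q P'"
      "q \<in> carrier Q"
  shows "tensor_map R P P' f g (comultQ q) = swQ (tensor R P P') (\<lambda>a b. tensor_elt R P P' (f a)
      (g b)) q"
  by (simp add: sweedler_def tensor_map_def)

lemma alg_mult_assoc:
  assumes t: "t \<in> carrier (tensor R (tensor R Q Q) Q)"
  shows "alg_mult R X H \<mu> (tensor_map R Q Q id (alg_mult R X H \<mu>) (tensor_assoc R Q Q Q t)) =
    alg_mult R X H \<mu> (tensor_map R Q Q (alg_mult R X H \<mu>) id t)"
proof -
  note q = Q_module and m = alg_mult_linear
  note qq = tensor_is_module[OF q q]
  have id: "id \<in> linear_maps R Q Q" unfolding id_def by (rule linear_id)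
  have l: "(\<lambda>t. alg_mult R X H \<mu> (tensor_map R Q Q id (alg_mult R X H \<mu>) (tensor_assoc R Q Q Q t)))
      \<in> linear_maps R (tensor R (tensor R Q Q) Q) Q"
    by (intro linear_comp[OF m] linear_comp[OF tensor_map_linear[OF q qq q q id m]]
        tensor_assoc_linear q)
  have r: "(\<lambda>t. alg_mult R X H \<mu> (tensor_map R Q Q (alg_mult R X H \<mu>) id t))
      \<in> linear_maps R (tensor R (tensor R Q Q) Q) Q"
    by (intro linear_comp[OF m] tensor_map_linear[OF qq q q q m id])
  show ?thesis
  proof (rule tensor_ext[OF qq q q l r _ t])
    fix s h assume s: "s \<in> carrier (tensor R Q Q)" and h: "h \<in> carrier Q"
    note e = linear_tensor_elt_left[OF qq q linear_id h]
    show "alg_mult R X H \<mu> (tensor_map R Q Q id (alg_mult R X H \<mu>)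
        (tensor_assoc R Q Q Q (tensor_elt R (tensor R Q Q) Q s h))) =
      alg_mult R X H \<mu> (tensor_map R Q Q (alg_mult R X H \<mu>) id (tensor_elt R (tensor R Q Q) Q s h))"
      by (rule tensor_ext[OF q q q linear_comp[OF l e] linear_comp[OF r e] _ s])
         (simp add: tensor_assoc_elt q h tensor_map_elt[OF q qq q q id m] tensor_map_elt[OF qq q q
             q m id]
           tensor_elt_closed mulQ_assoc)
  qed
qed

text \<open>
  For \<open>a\<close> and \<open>b\<close> homogeneous and composable this is the multiplicativity of the comultiplication of
  the category. Otherwise \<open>ab = 0\<close>, and on the other side every product \<open>a\<^sub>1b\<^sub>1\<close> and \<open>a\<^sub>2b\<^sub>2\<close> vanishes too,
  because the coproduct of a homogeneous element consists of elements of the same degree.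
\<close>

lemma comultQ_mulQ:
  assumes f: "f \<in> carrier Q" and g: "g \<in> carrier Q"
  shows "comultQ (mulQ f g) = tensor_map R Q Q (alg_mult R X H \<mu>) (alg_mult R X H \<mu>)
    (tensor_middle_flip R Q Q Q Q (tensor_elt R (tensor R Q Q) (tensor R Q Q) (comultQ f) (comultQ
        g)))"
proof -
  note q = Q_module and m = alg_mult_linear
  note qq = tensor_is_module[OF q q]
  let ?E = "\<lambda>a1 a2 b1 b2. tensor_elt R Q Q (mulQ a1 b1) (mulQ a2 b2)"
  let ?S = "\<lambda>f g. swQ (tensor R Q Q) (\<lambda>a1 a2. swQ (tensor R Q Q) (?E a1 a2) g) f"
  have B: "bilinear R (tensor R Q Q) (tensor R Q Q) (tensor R Q Q)
      (\<lambda>s t. tensor_elt R Q Q (alg_mult R X H \<mu> s) (alg_mult R X H \<mu> t))"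
    by (rule tensor_map_bilinear[OF q q m m])
  have "tensor_map R Q Q (alg_mult R X H \<mu>) (alg_mult R X H \<mu>)
      (tensor_middle_flip R Q Q Q Q (tensor_elt R (tensor R Q Q) (tensor R Q Q) (comultQ f)
          (comultQ g))) = ?S f g"
    unfolding sweedler_def tensor_map_def
    by (rule tensor_lift_middle_flip[OF q q q q qq B comultQ_closed[OF f] comultQ_closed[OF g]])
  moreover have "comultQ (mulQ f g) = ?S f g"
  proof -
    note E = linear_tensor_elt_left linear_tensor_elt_right linear_mulQ_left linear_mulQ_right
      mulQ_closed linear_id q qq
    have B1: "bilinear R Q Q (tensor R Q Q) (?E a1 a2)" if "a1 \<in> carrier Q" "a2 \<in> carrier Q"
        for a1 a2
      by (intro bilinearI E that; assumption)
    have B2: "bilinear R Q Q (tensor R Q Q) (\<lambda>a1 a2. ?E a1 a2 b1 b2)"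
        if "b1 \<in> carrier Q" "b2 \<in> carrier Q" for b1 b2
      by (intro bilinearI E that; assumption)
    have B3: "bilinear R Q Q (tensor R Q Q) (\<lambda>a1 a2. swQ (tensor R Q Q) (?E a1 a2) g)"
        if "g \<in> carrier Q" for g
      by (intro bilinearI linear_swQ_param bilinear_left[OF B2] bilinear_right[OF B2] B1 q qq
          that; assumption)
    show ?thesis
    proof (rule alg_ext[OF qq _ _ _ f])
      show "(\<lambda>f. comultQ (mulQ f g)) \<in> linear_maps R Q (tensor R Q Q)"
        by (intro linear_comp[OF comultQ_linear] linear_mulQ_left linear_id g)
      show "(\<lambda>f. ?S f g) \<in> linear_maps R Q (tensor R Q Q)" by (rule swQ_linear[OF qq B3[OF g]])
      fix x y a assume a: "x \<in> X" "y \<in> X" "a \<in> carrier (H x y)"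
      note ia = incl_closed[OF a]
      show "comultQ (mulQ (incl x y a) g) = ?S (incl x y a) g"
      proof (rule alg_ext[OF qq _ _ _ g])
        show "(\<lambda>g. comultQ (mulQ (incl x y a) g)) \<in> linear_maps R Q (tensor R Q Q)"
          by (intro linear_comp[OF comultQ_linear] linear_mulQ_right linear_id ia)
        show "(\<lambda>g. ?S (incl x y a) g) \<in> linear_maps R Q (tensor R Q Q)"
          by (intro linear_swQ_param swQ_linear B3 B1 q qq ia)
        fix w z b assume b: "w \<in> X" "z \<in> X" "b \<in> carrier (H w z)"
        note ib = incl_closed[OF b]
        have L: "(\<lambda>a1. ?E (incl x y a1) (incl x y a2) (incl w z b1) (incl w z b2))
            \<in> linear_maps R (H x y) (tensor R Q Q)"
          "(\<lambda>a2. ?E (incl x y a1) (incl x y a2) (incl w z b1) (incl w z b2))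
              \<in> linear_maps R (H x y) (tensor R Q Q)"
          "(\<lambda>b1. ?E (incl x y a1) (incl x y a2) (incl w z b1) (incl w z b2))
              \<in> linear_maps R (H w z) (tensor R Q Q)"
          "(\<lambda>b2. ?E (incl x y a1) (incl x y a2) (incl w z b1) (incl w z b2))
              \<in> linear_maps R (H w z) (tensor R Q Q)"
          if "a1 \<in> carrier (H x y)" "a2 \<in> carrier (H x y)" "b1 \<in> carrier (H w z)"
              "b2 \<in> carrier (H w z)" for a1 a2 b1 b2
          by (intro E linear_incl incl_closed a b that)+
        have "?S (incl x y a) (incl w z b) = sw x y (tensor R Q Q) (\<lambda>a1 a2. swQ (tensor R Q Q)
            (?E (incl x y a1) (incl x y a2)) (incl w z b)) a"
          by (rule swQ_incl[OF a qq B3[OF ib]])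
        also have "\<dots> = sw x y (tensor R Q Q) (\<lambda>a1 a2. sw w z (tensor R Q Q)
            (\<lambda>b1 b2. ?E (incl x y a1) (incl x y a2) (incl w z b1) (incl w z b2)) b) a"
        proof (rule sw_cong[OF a(1,2) qq _ a(3)])
          show "bilinear R (H x y) (H x y) (tensor R Q Q) (\<lambda>a1 a2. sw w z (tensor R Q Q)
            (\<lambda>b1 b2. ?E (incl x y a1) (incl x y a2) (incl w z b1) (incl w z b2)) b)"
            by (intro bilinearI linear_sw_param L H_module qq a b; assumption)
        qed (rule swQ_incl[OF b qq B1], auto intro: incl_closed a)
        also have "\<dots> = comultQ (mulQ (incl x y a) (incl w z b))"
        proof (cases "y = w")
          case True
          note w = b[folded True]
          let ?F = "\<lambda>c d. tensor_elt R Q Q (incl x z c) (incl x z d)"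
          have F: "bilinear R (H x z) (H x z) (tensor R Q Q) ?F"
            by (intro bilinearI E linear_incl incl_closed a b; assumption)
          have ab: "mul x y z a b \<in> carrier (H x z)" by (intro mul_closed a w)
          have "sw x y (tensor R Q Q) (\<lambda>a1 a2. sw w z (tensor R Q Q)
              (\<lambda>b1 b2. ?E (incl x y a1) (incl x y a2) (incl w z b1) (incl w z b2)) b) a =
            sw x y (tensor R Q Q) (\<lambda>a1 a2. sw y z (tensor R Q Q)
              (\<lambda>b1 b2. ?F (mul x y z a1 b1) (mul x y z a2 b2)) b) a"
          proof (rule sw_cong[OF a(1,2) qq _ a(3)], goal_cases)
            case 1
            show ?case
              by (intro multilinear_intros linear_comp[OF bilinear_left[OF F]] linear_comp[OF
                  bilinear_right[OF F]] qq a w; assumption)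
          next
            case (2 a1 a2)
            show ?case unfolding True[symmetric]
            proof (rule sw_cong[OF w(1,2) qq _ w(3)], goal_cases)
              case 1
              show ?case
                by (intro multilinear_intros linear_comp[OF bilinear_left[OF F]] linear_comp[OF
                    bilinear_right[OF F]] qq a w 2; assumption)
            qed (use a w 2 in \<open>simp add: mulQ_incl\<close>)
          qed
          also have "\<dots> = sw x z (tensor R Q Q) ?F (mul x y z a b)"
            by (rule sw_mul[OF a(1,2) w(2) a(3) w(3) qq F, symmetric])
          also have "\<dots> = swQ (tensor R Q Q) (tensor_elt R Q Q) (incl x z (mul x y z a b))"
            by (rule swQ_incl[symmetric, OF a(1) w(2) ab qq tensor_elt_bilinear[OF q q]])
          also have "\<dots> = comultQ (incl x z (mul x y z a b))"
            unfolding sweedler_def by (intro tensor_eta q comultQ_closed incl_closed a w ab)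
          finally show ?thesis using a b True w by (simp add: mulQ_incl)
        next
          case False
          have z: "tensor_elt R Q Q \<zero>\<^bsub>Q\<^esub> \<zero>\<^bsub>Q\<^esub> = \<zero>\<^bsub>tensor R Q Q\<^esub>"
            by (rule linear_zero[OF q qq linear_tensor_elt_left[OF q q linear_id Q_zero_closed]])
          have "sw x y (tensor R Q Q) (\<lambda>a1 a2. sw w z (tensor R Q Q)
              (\<lambda>b1 b2. ?E (incl x y a1) (incl x y a2) (incl w z b1) (incl w z b2)) b) a =
            sw x y (tensor R Q Q) (\<lambda>a1 a2. \<zero>\<^bsub>tensor R Q Q\<^esub>) a"
          proof (rule sw_cong[OF a(1,2) qq _ a(3)], goal_cases)
            case 1
            show ?case by (intro bilinearI linear_const_zero qq)
          next
            case (2 a1 a2)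
            have "sw w z (tensor R Q Q) (\<lambda>b1 b2. ?E (incl x y a1) (incl x y a2) (incl w z b1)
                (incl w z b2)) b =
              sw w z (tensor R Q Q) (\<lambda>b1 b2. \<zero>\<^bsub>tensor R Q Q\<^esub>) b"
              by (rule sw_cong[OF b(1,2) qq _ b(3)], intro bilinearI linear_const_zero qq)
                 (use a b 2 False z in \<open>simp add: mulQ_incl\<close>)
            then show ?case by (simp add: sw_zero b qq)
          qed
          also have "\<dots> = \<zero>\<^bsub>tensor R Q Q\<^esub>" by (rule sw_zero[OF a(1,2) qq a(3)])
          finally show ?thesis
            using a b False by (simp add: mulQ_incl linear_zero[OF q qq comultQ_linear])
        qed
        finally show "comultQ (mulQ (incl x y a) (incl w z b)) = ?S (incl x y a) (incl w z b)" ..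
      qed
    qed
  qed
  ultimately show ?thesis by simp
qed

end

context coalgebra_category
begin

lemma alg_comult_mult:
  assumes t: "t \<in> carrier (tensor R Q Q)"
  shows "comultQ (alg_mult R X H \<mu> t) = tensor_map R Q Q (alg_mult R X H \<mu>) (alg_mult R X H \<mu>)
    (tensor_middle_flip R Q Q Q Q (tensor_map R (tensor R Q Q) (tensor R Q Q) comultQ comultQ t))"
proof -
  note q = Q_module and m = alg_mult_linear and d = comultQ_linear
  note qq = tensor_is_module[OF q q]
  show ?thesis
  proof (rule tensor_ext[OF q q qq linear_comp[OF d m] _ _ t])
    show "(\<lambda>t. tensor_map R Q Q (alg_mult R X H \<mu>) (alg_mult R X H \<mu>)
        (tensor_middle_flip R Q Q Q Q (tensor_map R (tensor R Q Q) (tensor R Q Q) comultQ comultQ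
            t)))
      \<in> linear_maps R (tensor R Q Q) (tensor R Q Q)"
      by (rule linear_comp[OF tensor_map_linear[OF qq qq q q m m]
          linear_comp[OF tensor_middle_flip_linear[OF q q q q] tensor_map_linear[OF q q qq qq d
              d]]])
  qed (simp add: comultQ_mulQ tensor_map_elt[OF q q qq qq d d])
qed

lemma swQ_eta: "q \<in> carrier Q \<Longrightarrow> swQ (tensor R Q Q) (tensor_elt R Q Q) q = comultQ q"
  unfolding sweedler_def by (intro tensor_eta Q_module comultQ_closed)

text \<open>
  Both iterated coproducts are rewritten as nested Sweedler sums of pure triple tensors; on a
  homogeneous element these are related by the coassociativity of the category.
\<close>

lemma alg_coassoc:
  assumes q: "q \<in> carrier Q"
  shows "tensor_assoc R Q Q Q (tensor_map R (tensor R Q Q) Q comultQ id (comultQ q)) =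
    tensor_map R Q (tensor R Q Q) id comultQ (comultQ q)"
proof -
  note M = Q_module and d = comultQ_linear
  note MM = tensor_is_module[OF M M]
  note L = tensor_is_module[OF MM M] and N = tensor_is_module[OF M MM]
  let ?N = "tensor R Q (tensor R Q Q)"
  let ?T = "\<lambda>a b c. tensor_elt R Q (tensor R Q Q) a (tensor_elt R Q Q b c)"
  have id: "id \<in> linear_maps R Q Q" unfolding id_def by (rule linear_id)
  note E = linear_tensor_elt_left linear_tensor_elt_right tensor_elt_closed linear_id M MM
  have T: "(\<lambda>a. ?T (f a) b c) \<in> linear_maps R K ?N" "(\<lambda>a. ?T b (f a) c) \<in> linear_maps R K ?N"
    "(\<lambda>a. ?T b c (f a)) \<in> linear_maps R K ?N"
    if "b \<in> carrier Q" "c \<in> carrier Q" "f \<in> linear_maps R K Q" for b c K f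
    by (intro E that)+
  have B1: "bilinear R Q Q ?N (\<lambda>a b. ?T a b c)" if "c \<in> carrier Q" for c
    by (intro bilinearI T that linear_id; assumption)
  have B2: "bilinear R Q Q ?N (\<lambda>b c. ?T a b c)" if "a \<in> carrier Q" for a
    by (intro bilinearI T that linear_id; assumption)
  have BL: "bilinear R Q Q ?N (\<lambda>a c. swQ ?N (\<lambda>p r. ?T p r c) a)"
    by (intro bilinearI swQ_linear linear_swQ_param[OF M N] B1 N T linear_id; assumption)
  have BR: "bilinear R Q Q ?N (\<lambda>a b. swQ ?N (\<lambda>p r. ?T a p r) b)"
    by (intro bilinearI swQ_linear linear_swQ_param[OF M N] B2 N T linear_id; assumption)
  have "tensor_assoc R Q Q Q (tensor_map R (tensor R Q Q) Q comultQ id (comultQ q)) =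
      tensor_assoc R Q Q Q (swQ (tensor R (tensor R Q Q) Q) (\<lambda>a b. tensor_elt R (tensor R Q Q) Q
          (comultQ a) b) q)"
    by (simp add: tensor_map_comultQ[OF MM M d id q])
  also have "\<dots> = swQ ?N (\<lambda>a b. tensor_assoc R Q Q Q (tensor_elt R (tensor R Q Q) Q (comultQ a) b))
      q"
    by (rule linear_swQ[OF L N _ tensor_assoc_linear[OF M M M] q])
       (use tensor_map_bilinear[OF MM M d linear_id] in simp)
  also have "\<dots> = swQ ?N (\<lambda>a b. swQ ?N (\<lambda>p r. ?T p r b) a) q"
  proof (rule swQ_cong[OF N BL q])
    fix a b assume ab: "a \<in> carrier Q" "b \<in> carrier Q"
    show "tensor_assoc R Q Q Q (tensor_elt R (tensor R Q Q) Q (comultQ a) b)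
        = swQ ?N (\<lambda>p r. ?T p r b) a"
      unfolding tensor_assoc_def Let_def sweedler_def
      by (rule tensor_lift_elt[OF MM M N tensor_assoc_bilinear[OF M M M] comultQ_closed[OF ab(1)]
          ab(2)])
  qed
  also have "\<dots> = swQ ?N (\<lambda>a b. swQ ?N (\<lambda>p r. ?T a p r) b) q"
  proof (rule alg_ext[OF N swQ_linear[OF N BL] swQ_linear[OF N BR] _ q])
    fix x y h assume h: "x \<in> X" "y \<in> X" "h \<in> carrier (H x y)"
    let ?U = "\<lambda>a b c. ?T (incl x y a) (incl x y b) (incl x y c)"
    note i = incl_closed[OF h(1,2)] and il = incl_linear[OF h(1,2)]
    have U: "(\<lambda>a. ?U a b c) \<in> linear_maps R (H x y) ?N" "(\<lambda>a. ?U b a c) \<in> linear_maps R (H x y) ?N"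
      "(\<lambda>a. ?U b c a) \<in> linear_maps R (H x y) ?N" if "b \<in> carrier (H x y)" "c \<in> carrier (H x y)"
          for b c
      by (intro T il i that)+
    have "swQ ?N (\<lambda>a b. swQ ?N (\<lambda>p r. ?T p r b) a) (incl x y h)
        = sw x y ?N (\<lambda>a b. sw x y ?N (\<lambda>p r. ?U p r b) a) h"
      unfolding swQ_incl[OF h N BL]
      by (rule sw_cong[OF h(1,2) N _ h(3)], (intro bilinearI linear_sw_param linear_sw_arg U
          linear_id N H_module h(1,2); assumption))
         (rule swQ_incl[OF h(1,2) _ N B1[OF i]]; assumption)
    also have "\<dots> = sw x y ?N (\<lambda>a b. sw x y ?N (\<lambda>p r. ?U a p r) b) h"
      by (rule sw_coassoc[OF h(1,2) N U h(3)])
    also have "\<dots> = swQ ?N (\<lambda>a b. swQ ?N (\<lambda>p r. ?T a p r) b) (incl x y h)"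
      unfolding swQ_incl[OF h N BR]
      by (rule sw_cong[OF h(1,2) N _ h(3), symmetric], (intro bilinearI linear_sw_param
          linear_sw_arg U linear_id N H_module h(1,2); assumption))
         (rule swQ_incl[OF h(1,2) _ N B2[OF i]]; assumption)
    finally show "swQ ?N (\<lambda>a b. swQ ?N (\<lambda>p r. ?T p r b) a) (incl x y h) =
      swQ ?N (\<lambda>a b. swQ ?N (\<lambda>p r. ?T a p r) b) (incl x y h)" .
  qed
  also have "\<dots> = swQ ?N (\<lambda>a b. tensor_elt R Q (tensor R Q Q) a (comultQ b)) q"
  proof (rule swQ_cong[OF N _ q])
    show "bilinear R Q Q ?N (\<lambda>a b. tensor_elt R Q (tensor R Q Q) a (comultQ b))"
      by (rule tensor_map_bilinear[OF M MM linear_id d])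
    fix a b assume ab: "a \<in> carrier Q" "b \<in> carrier Q"
    have "tensor_elt R Q (tensor R Q Q) a (swQ (tensor R Q Q) (tensor_elt R Q Q) b)
        = swQ ?N (\<lambda>p r. ?T a p r) b"
      by (rule linear_swQ[OF MM N tensor_elt_bilinear[OF M M] linear_tensor_elt_right[OF M MM
          linear_id ab(1)] ab(2)])
    then show "swQ ?N (\<lambda>p r. ?T a p r) b = tensor_elt R Q (tensor R Q Q) a (comultQ b)"
      by (simp add: swQ_eta ab)
  qed
  also have "\<dots> = tensor_map R Q (tensor R Q Q) id comultQ (comultQ q)"
    by (simp add: tensor_map_comultQ[OF M MM id d q])
  finally show ?thesis .
qed

abbreviation counitQ where "counitQ \<equiv> alg_counit R X H \<epsilon>"

lemma hom_counit_linear: "\<lbrakk>x \<in> X; y \<in> X\<rbrakk> \<Longrightarrow> \<epsilon> x y \<in> linear_maps R (H x y) (regular_module R)"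
  by (rule coalgebra.counit_linear[OF hom_coalgebra])

lemma counitQ_linear: "counitQ \<in> linear_maps R Q (regular_module R)"
  unfolding alg_counit_def by (rule alg_lift_linear[OF K_module hom_counit_linear])

lemma counitQ_incl: "\<lbrakk>x \<in> X; y \<in> X; h \<in> carrier (H x y)\<rbrakk> \<Longrightarrow> counitQ (incl x y h) = \<epsilon> x y h"
  unfolding alg_counit_def by (rule alg_lift_incl[OF K_module hom_counit_linear])

lemma counitQ_closed: "q \<in> carrier Q \<Longrightarrow> counitQ q \<in> carrier R"
  using linear_closed[OF counitQ_linear, of q] by (simp add: regular_module_def)

lemma
  assumes q: "q \<in> carrier Q"
  shows alg_counit_left:
      "tensor_lunit R Q (tensor_map R (regular_module R) Q counitQ id (comultQ q)) = q"
    and alg_counit_right: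
        "tensor_runit R Q (tensor_map R Q (regular_module R) id counitQ (comultQ q)) = q"
proof -
  note M = Q_module and K = K_module
  have id: "id \<in> linear_maps R Q Q" unfolding id_def by (rule linear_id)
  have BL: "bilinear R Q Q Q (\<lambda>a b. counitQ a \<odot>\<^bsub>Q\<^esub> b)"
      and BR: "bilinear R Q Q Q (\<lambda>a b. counitQ b \<odot>\<^bsub>Q\<^esub> a)"
    by (intro bilinearI linear_smult_left linear_smult_right counitQ_linear counitQ_closed M
        linear_id; assumption)+
  have "tensor_lunit R Q (tensor_map R (regular_module R) Q counitQ id (comultQ q))
      = swQ Q (\<lambda>a b. counitQ a \<odot>\<^bsub>Q\<^esub> b) q"
    unfolding tensor_lunit_def sweedler_def
    using tensor_lift_tensor_map[OF M M K M M counitQ_linear id tensor_lunit_bilinear[OF M]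
        comultQ_closed[OF q]] by simp
  also have "\<dots> = q"
  proof (rule alg_ext[OF M swQ_linear[OF M BL] linear_id _ q])
    fix x y h assume h: "x \<in> X" "y \<in> X" "h \<in> carrier (H x y)"
    have "swQ Q (\<lambda>a b. counitQ a \<odot>\<^bsub>Q\<^esub> b) (incl x y h) = sw x y Q (\<lambda>a b. \<epsilon> x y a \<odot>\<^bsub>Q\<^esub> incl x y b) h"
      unfolding swQ_incl[OF h M BL]
      by (rule sw_cong[OF h(1,2) M _ h(3)], (intro multilinear_intros linear_incl incl_closed M
          h(1,2); assumption))
         (simp add: counitQ_incl h)
    also have "\<dots> = incl x y h" by (rule sw_counit_left[OF h(1,2) M incl_linear[OF h(1,2)] h(3)])
    finally show "swQ Q (\<lambda>a b. counitQ a \<odot>\<^bsub>Q\<^esub> b) (incl x y h) = incl x y h" .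
  qed
  finally show "tensor_lunit R Q (tensor_map R (regular_module R) Q counitQ id (comultQ q)) = q" .
  have "tensor_runit R Q (tensor_map R Q (regular_module R) id counitQ (comultQ q))
      = swQ Q (\<lambda>a b. counitQ b \<odot>\<^bsub>Q\<^esub> a) q"
    unfolding tensor_runit_def sweedler_def
    using tensor_lift_tensor_map[OF M M M K M id counitQ_linear tensor_runit_bilinear[OF M]
        comultQ_closed[OF q]] by simp
  also have "\<dots> = q"
  proof (rule alg_ext[OF M swQ_linear[OF M BR] linear_id _ q])
    fix x y h assume h: "x \<in> X" "y \<in> X" "h \<in> carrier (H x y)"
    have "swQ Q (\<lambda>a b. counitQ b \<odot>\<^bsub>Q\<^esub> a) (incl x y h) = sw x y Q (\<lambda>a b. \<epsilon> x y b \<odot>\<^bsub>Q\<^esub> incl x y a) h"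
      unfolding swQ_incl[OF h M BR]
      by (rule sw_cong[OF h(1,2) M _ h(3)], (intro multilinear_intros linear_incl incl_closed M
          h(1,2); assumption))
         (simp add: counitQ_incl h)
    also have "\<dots> = incl x y h" by (rule sw_counit_right[OF h(1,2) M incl_linear[OF h(1,2)] h(3)])
    finally show "swQ Q (\<lambda>a b. counitQ b \<odot>\<^bsub>Q\<^esub> a) (incl x y h) = incl x y h" .
  qed
  finally show "tensor_runit R Q (tensor_map R Q (regular_module R) id counitQ (comultQ q)) = q" .
qed

lemma alg_coalgebra: "coalgebra R Q comultQ counitQ"
  by (intro coalgebra.intro coalgebra_axioms.intro Q_module comultQ_linear counitQ_linear
      alg_coassoc alg_counit_left alg_counit_right)

lemma convolution_linear:
  assumes f: "f \<in> linear_maps R Q Q" and g: "g \<in> linear_maps R Q Q"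
  shows "convolution R Q (alg_mult R X H \<mu>) comultQ f g \<in> linear_maps R Q Q"
  unfolding convolution_def
  by (rule linear_comp[OF alg_mult_linear linear_comp[OF tensor_map_linear[OF Q_module Q_module
      Q_module Q_module f g] comultQ_linear]])

lemma convolution_incl:
  assumes f: "f \<in> linear_maps R Q Q" and g: "g \<in> linear_maps R Q Q"
    and h: "x \<in> X" "y \<in> X" "h \<in> carrier (H x y)"
  shows "convolution R Q (alg_mult R X H \<mu>) comultQ f g (incl x y h) =
    sw x y Q (\<lambda>a b. mulQ (f (incl x y a)) (g (incl x y b))) h"
proof -
  note M = Q_module
  note MM = tensor_is_module[OF M M] and ih = incl_closed[OF h]
  note B = tensor_map_bilinear[OF M M f g]
  have "convolution R Q (alg_mult R X H \<mu>) comultQ f g (incl x y h)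
      = swQ Q (\<lambda>a b. mulQ (f a) (g b)) (incl x y h)"
    unfolding convolution_def tensor_map_comultQ[OF M M f g ih]
    by (rule linear_swQ[OF MM M B alg_mult_linear ih])
  also have "\<dots> = sw x y Q (\<lambda>a b. mulQ (f (incl x y a)) (g (incl x y b))) h"
    by (rule swQ_incl[OF h M])
       (intro bilinearI linear_mulQ_left linear_mulQ_right linear_closed[OF f] linear_closed[OF g]
           f g)
  finally show ?thesis .
qed

end

section \<open>The quantum inverse semigroup of a Hopf category\<close>

context hopf_category
begin

abbreviation antipodeQ where "antipodeQ \<equiv> alg_antipode X H S"

lemma antipode_summand_linear:
  "\<lbrakk>x \<in> X; y \<in> X\<rbrakk> \<Longrightarrow> (\<lambda>h. incl y x (S x y h)) \<in> linear_maps R (H x y) Q"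
  by (intro linear_incl antipode_linear)

lemma antipodeQ_linear: "antipodeQ \<in> linear_maps R Q Q"
  unfolding alg_antipode_def by (rule alg_lift_linear[OF Q_module antipode_summand_linear])

lemma antipodeQ_incl: "\<lbrakk>x \<in> X; y \<in> X; h \<in> carrier (H x y)\<rbrakk> \<Longrightarrow> antipodeQ (incl x y h)
    = incl y x (S x y h)"
  unfolding alg_antipode_def by (rule alg_lift_incl[OF Q_module antipode_summand_linear])

lemma antipodeQ_closed: "q \<in> carrier Q \<Longrightarrow> antipodeQ q \<in> carrier Q"
  by (rule linear_closed[OF antipodeQ_linear])

lemma linear_antipodeQ: "f \<in> linear_maps R K Q \<Longrightarrow> (\<lambda>k. antipodeQ (f k)) \<in> linear_maps R K Q"
  by (rule linear_comp[OF antipodeQ_linear])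

abbreviation conv where "conv \<equiv> convolution R Q (alg_mult R X H \<mu>) comultQ"

lemma id_linear: "id \<in> linear_maps R M M"
  unfolding id_def by (rule linear_id)

text \<open>
  The local form of \<open>I \<star> S = \<eta>\<epsilon>\<close>: the value is a multiple of the identity of the source object, and
  dually \<open>S \<star> I\<close> takes its value at the target object. The regularity of \<open>S\<close> and the commutation of
  idempotents follow from these two values.
\<close>

lemma conv_id_antipode:
  assumes h: "x \<in> X" "y \<in> X" "h \<in> carrier (H x y)"
  shows "conv id antipodeQ (incl x y h) = incl x x (\<epsilon> x y h \<odot>\<^bsub>H x x\<^esub> unit x)"
proof -
  have "conv id antipodeQ (incl x y h) = sw x y Q (\<lambda>a b. mulQ (id (incl x y a)) (antipodeQ (incl x
      y b))) h"
    by (rule convolution_incl[OF id_linear antipodeQ_linear h])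
  also have "\<dots> = sw x y Q (\<lambda>a b. incl x x (mul x y x a (S x y b))) h"
    by (rule sw_cong[OF h(1,2) Q_module _ h(3)], (intro hopf_intros linear_incl h(1,2); assumption))
       (use h in \<open>simp add: antipodeQ_incl mulQ_incl antipode_closed\<close>)
  also have "\<dots> = \<epsilon> x y h \<odot>\<^bsub>Q\<^esub> incl x x (unit x)"
    by (rule sw_cancel_right[OF h(1,2) Q_module h(3) incl_linear[OF h(1,1)]])
  also have "\<dots> = incl x x (\<epsilon> x y h \<odot>\<^bsub>H x x\<^esub> unit x)"
    by (rule linear_smult[OF incl_linear[OF h(1,1)] counit_closed[OF h] unit_closed[OF h(1)],
        symmetric])
  finally show ?thesis .
qed

lemma conv_antipode_id:
  assumes h: "x \<in> X" "y \<in> X" "h \<in> carrier (H x y)"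
  shows "conv antipodeQ id (incl x y h) = incl y y (\<epsilon> x y h \<odot>\<^bsub>H y y\<^esub> unit y)"
proof -
  have "conv antipodeQ id (incl x y h) = sw x y Q (\<lambda>a b. mulQ (antipodeQ (incl x y a))
      (id (incl x y b))) h"
    by (rule convolution_incl[OF antipodeQ_linear id_linear h])
  also have "\<dots> = sw x y Q (\<lambda>a b. incl y y (mul y x y (S x y a) b)) h"
    by (rule sw_cong[OF h(1,2) Q_module _ h(3)], (intro hopf_intros linear_incl h(1,2); assumption))
       (use h in \<open>simp add: antipodeQ_incl mulQ_incl antipode_closed\<close>)
  also have "\<dots> = \<epsilon> x y h \<odot>\<^bsub>Q\<^esub> incl y y (unit y)"
    by (rule sw_cancel_left[OF h(1,2) Q_module h(3) incl_linear[OF h(2,2)]])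
  also have "\<dots> = incl y y (\<epsilon> x y h \<odot>\<^bsub>H y y\<^esub> unit y)"
    by (rule linear_smult[OF incl_linear[OF h(2,2)] counit_closed[OF h] unit_closed[OF h(2)],
        symmetric])
  finally show ?thesis .
qed

lemma mul_smult_unit:
  assumes x: "x \<in> X" and y: "y \<in> X" and a: "a \<in> carrier (H x y)" and r: "r \<in> carrier R"
  shows "mul x x y (r \<odot>\<^bsub>H x x\<^esub> unit x) a = r \<odot>\<^bsub>H x y\<^esub> a"
    using linear_smult[OF linear_mul_left[OF x x y linear_id a] r unit_closed[OF x]] x y a
    by (simp add: mul_unit_left)

text \<open>
  With \<open>T = I\<close> this gives \<open>I \<star> S \<star> I = I\<close>, and with \<open>T = S\<close> it gives \<open>S \<star> I \<star> S = S\<close>: the left factor is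
  \<open>\<epsilon>(h\<^sub>1)\<close> times an identity that acts trivially on the right one.
\<close>

lemma conv_left_unit:
  assumes h: "x \<in> X" "y \<in> X" "h \<in> carrier (H x y)" and z: "z \<in> X" "w \<in> X"
    and T: "T \<in> linear_maps R (H x y) (H z w)"
  shows "sw x y Q (\<lambda>a b. mulQ (incl z z (\<epsilon> x y a \<odot>\<^bsub>H z z\<^esub> unit z)) (incl z w (T b))) h
      = incl z w (T h)"
proof -
  note iz = incl_linear[OF z]
  have "sw x y Q (\<lambda>a b. mulQ (incl z z (\<epsilon> x y a \<odot>\<^bsub>H z z\<^esub> unit z)) (incl z w (T b))) h =
      sw x y Q (\<lambda>a b. \<epsilon> x y a \<odot>\<^bsub>Q\<^esub> incl z w (T b)) h"
  proof (rule sw_cong[OF h(1,2) Q_module _ h(3)])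
    show "bilinear R (H x y) (H x y) Q (\<lambda>a b. \<epsilon> x y a \<odot>\<^bsub>Q\<^esub> incl z w (T b))"
      by (intro hopf_intros linear_incl incl_closed Q_module T linear_closed[OF T] h(1,2) z;
          assumption)
    fix a b assume ab: "a \<in> carrier (H x y)" "b \<in> carrier (H x y)"
    have "mulQ (incl z z (\<epsilon> x y a \<odot>\<^bsub>H z z\<^esub> unit z)) (incl z w (T b)) =
        incl z w (mul z z w (\<epsilon> x y a \<odot>\<^bsub>H z z\<^esub> unit z) (T b))"
      by (subst mulQ_incl) (simp_all add: z hopf_intros smult_mem h ab linear_closed[OF T])
    then show "mulQ (incl z z (\<epsilon> x y a \<odot>\<^bsub>H z z\<^esub> unit z)) (incl z w (T b)) = \<epsilon> x y a
        \<odot>\<^bsub>Q\<^esub> incl z w (T b)"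
      using linear_smult[OF iz counit_closed[OF h(1,2) ab(1)] linear_closed[OF T ab(2)]]
      by (simp add: mul_smult_unit z counit_closed[OF h(1,2)] ab linear_closed[OF T])
  qed
  also have "\<dots> = incl z w (T h)"
    by (rule sw_counit_left[OF h(1,2) Q_module linear_incl[OF z T] h(3)])
  finally show ?thesis .
qed

text \<open>
  If the degrees of \<open>f\<close> and \<open>g\<close> do not compose, neither do those of \<open>S(g)\<close> and \<open>S(f)\<close>, so both sides are zero.
\<close>

lemma alg_antipode_antimult:
  assumes f: "f \<in> carrier Q" and g: "g \<in> carrier Q"
  shows "antipodeQ (mulQ f g) = mulQ (antipodeQ g) (antipodeQ f)"
proof (rule alg_ext[OF Q_module _ _ _ f])
  show "(\<lambda>f. antipodeQ (mulQ f g)) \<in> linear_maps R Q Q" "(\<lambda>f. mulQ (antipodeQ g) (antipodeQ f))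
      \<in> linear_maps R Q Q"
    by (intro linear_antipodeQ linear_mulQ_left linear_mulQ_right linear_id antipodeQ_closed g)+
  fix x y a assume a: "x \<in> X" "y \<in> X" "a \<in> carrier (H x y)"
  show "antipodeQ (mulQ (incl x y a) g) = mulQ (antipodeQ g) (antipodeQ (incl x y a))"
  proof (rule alg_ext[OF Q_module _ _ _ g])
    show "(\<lambda>g. antipodeQ (mulQ (incl x y a) g)) \<in> linear_maps R Q Q"
      "(\<lambda>g. mulQ (antipodeQ g) (antipodeQ (incl x y a))) \<in> linear_maps R Q Q"
      by (intro linear_antipodeQ linear_mulQ_left linear_mulQ_right linear_id antipodeQ_closed
          incl_closed a)+
    fix w z b assume b: "w \<in> X" "z \<in> X" "b \<in> carrier (H w z)"
    show "antipodeQ (mulQ (incl x y a) (incl w z b)) = mulQ (antipodeQ (incl w z b)) (antipodeQ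
        (incl x y a))"
      using a b linear_zero[OF Q_module Q_module antipodeQ_linear]
      by (auto simp: mulQ_incl antipodeQ_incl antipode_closed mul_closed antipode_mul)
  qed
qed

lemma alg_id_antipode_id:
  assumes q: "q \<in> carrier Q"
  shows "conv (conv id antipodeQ) id q = q"
proof (rule alg_ext[OF Q_module convolution_linear linear_id _ q])
  show c: "conv id antipodeQ \<in> linear_maps R Q Q" and "id \<in> linear_maps R Q Q"
    by (intro convolution_linear id_linear antipodeQ_linear)+
  fix x y h assume h: "x \<in> X" "y \<in> X" "h \<in> carrier (H x y)"
  have "conv (conv id antipodeQ) id (incl x y h)
      = sw x y Q (\<lambda>a b. mulQ (conv id antipodeQ (incl x y a)) (id (incl x y b))) h"
    by (rule convolution_incl[OF c id_linear h])
  also have "\<dots> = sw x y Q (\<lambda>a b. mulQ (incl x x (\<epsilon> x y a \<odot>\<^bsub>H x x\<^esub> unit x)) (incl x y b)) h"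
    by (rule sw_cong[OF h(1,2) Q_module _ h(3)], (intro bilinearI linear_mulQ_left
        linear_mulQ_right linear_incl incl_closed hopf_intros h(1,2); assumption))
       (simp add: conv_id_antipode h)
  also have "\<dots> = incl x y h" by (rule conv_left_unit[OF h h(1,2) linear_id])
  finally show "conv (conv id antipodeQ) id (incl x y h) = incl x y h" .
qed

lemma alg_antipode_id_antipode:
  assumes q: "q \<in> carrier Q"
  shows "conv (conv antipodeQ id) antipodeQ q = antipodeQ q"
proof (rule alg_ext[OF Q_module convolution_linear antipodeQ_linear _ q])
  show c: "conv antipodeQ id \<in> linear_maps R Q Q" and "antipodeQ \<in> linear_maps R Q Q"
    by (intro convolution_linear id_linear antipodeQ_linear)+
  fix x y h assume h: "x \<in> X" "y \<in> X" "h \<in> carrier (H x y)"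
  have "conv (conv antipodeQ id) antipodeQ (incl x y h)
      = sw x y Q (\<lambda>a b. mulQ (conv antipodeQ id (incl x y a)) (antipodeQ (incl x y b))) h"
    by (rule convolution_incl[OF c antipodeQ_linear h])
  also have "\<dots> = sw x y Q (\<lambda>a b. mulQ (incl y y (\<epsilon> x y a \<odot>\<^bsub>H y y\<^esub> unit y)) (incl y x (S x y b))) h"
    by (rule sw_cong[OF h(1,2) Q_module _ h(3)], (intro bilinearI linear_mulQ_left
        linear_mulQ_right linear_incl incl_closed hopf_intros h(1,2); assumption))
       (simp add: conv_antipode_id antipodeQ_incl h)
  also have "\<dots> = incl y x (S x y h)" by (rule conv_left_unit[OF h h(2,1) antipode_linear[OF
      h(1,2)]])
  finally show "conv (conv antipodeQ id) antipodeQ (incl x y h) = antipodeQ (incl x y h)"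
      by (simp add: antipodeQ_incl h)
qed

text \<open>
  On homogeneous elements the two factors are multiples of identities of objects, and such identities
  are orthogonal idempotents.
\<close>

lemma alg_idempotents_commute:
  assumes f: "f \<in> carrier Q" and g: "g \<in> carrier Q"
  shows "mulQ (conv id antipodeQ f) (conv antipodeQ id g)
      = mulQ (conv antipodeQ id g) (conv id antipodeQ f)"
proof -
  have c: "conv id antipodeQ \<in> linear_maps R Q Q" and d: "conv antipodeQ id \<in> linear_maps R Q Q"
    by (intro convolution_linear id_linear antipodeQ_linear)+
  show ?thesis
  proof (rule alg_ext[OF Q_module _ _ _ f])
    show "(\<lambda>f. mulQ (conv id antipodeQ f) (conv antipodeQ id g)) \<in> linear_maps R Q Q"
      "(\<lambda>f. mulQ (conv antipodeQ id g) (conv id antipodeQ f)) \<in> linear_maps R Q Q"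
      by (intro linear_mulQ_left linear_mulQ_right c linear_closed[OF d] g)+
    fix x y a assume a: "x \<in> X" "y \<in> X" "a \<in> carrier (H x y)"
    show "mulQ (conv id antipodeQ (incl x y a)) (conv antipodeQ id g)
        = mulQ (conv antipodeQ id g) (conv id antipodeQ (incl x y a))"
    proof (rule alg_ext[OF Q_module _ _ _ g])
      show "(\<lambda>g. mulQ (conv id antipodeQ (incl x y a)) (conv antipodeQ id g)) \<in> linear_maps R Q Q"
        "(\<lambda>g. mulQ (conv antipodeQ id g) (conv id antipodeQ (incl x y a))) \<in> linear_maps R Q Q"
        by (intro linear_mulQ_left linear_mulQ_right d linear_closed[OF c] incl_closed a)+
      fix z w b assume b: "z \<in> X" "w \<in> X" "b \<in> carrier (H z w)"
      have e: "\<epsilon> x y a \<in> carrier R" "\<epsilon> z w b \<in> carrier R" by (intro counit_closed a b)+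
      have u: "r \<odot>\<^bsub>H v v\<^esub> unit v \<in> carrier (H v v)" if "v \<in> X" "r \<in> carrier R" for v r
        by (intro smult_mem H_module unit_closed that)
      show "mulQ (conv id antipodeQ (incl x y a)) (conv antipodeQ id (incl z w b))
          = mulQ (conv antipodeQ id (incl z w b)) (conv id antipodeQ (incl x y a))"
      proof (cases "x = w")
        case True
        interpret M: module R "H w w" by (rule H_module[OF b(2,2)])
        show ?thesis
          using a b e u True
          by (simp add: conv_id_antipode conv_antipode_id mulQ_incl mul_smult_unit
              M.smult_assoc1[symmetric]
              unit_closed m_comm)
      qed (use a b e u in \<open>simp add: conv_id_antipode conv_antipode_id mulQ_incl\<close>)
    qed
  qed
qed

lemma alg_counit_antipode:
  assumes q: "q \<in> carrier Q"
  shows "counitQ (antipodeQ q) = counitQ q"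
  by (rule alg_ext[OF K_module linear_comp[OF counitQ_linear antipodeQ_linear] counitQ_linear _ q])
     (simp add: antipodeQ_incl counitQ_incl antipode_closed counit_antipode)

lemma alg_antipode_anticomult:
  assumes q: "q \<in> carrier Q"
  shows "comultQ (antipodeQ q) = tensor_flip R Q Q (tensor_map R Q Q antipodeQ antipodeQ (comultQ
      q))"
proof -
  note M = Q_module
  note MM = tensor_is_module[OF M M]
  have B: "bilinear R Q Q (tensor R Q Q) (\<lambda>a b. tensor_elt R Q Q (antipodeQ b) (antipodeQ a))"
    by (intro bilinearI linear_tensor_elt_left linear_tensor_elt_right antipodeQ_linear
        antipodeQ_closed M)
  have "tensor_flip R Q Q (tensor_map R Q Q antipodeQ antipodeQ (comultQ q)) =
      swQ (tensor R Q Q) (\<lambda>a b. tensor_elt R Q Q (antipodeQ b) (antipodeQ a)) q"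
    unfolding tensor_flip_def sweedler_def
    by (rule tensor_lift_tensor_map[OF M M M M MM antipodeQ_linear antipodeQ_linear
        tensor_flip_bilinear[OF M M] comultQ_closed[OF q]])
  also have "\<dots> = comultQ (antipodeQ q)"
  proof (rule alg_ext[OF MM swQ_linear[OF MM B] linear_comp[OF comultQ_linear antipodeQ_linear] _
      q])
    fix x y h assume h: "x \<in> X" "y \<in> X" "h \<in> carrier (H x y)"
    let ?F = "\<lambda>s t. tensor_elt R Q Q (incl y x s) (incl y x t)"
    have F: "bilinear R (H y x) (H y x) (tensor R Q Q) ?F"
      by (rule tensor_map_bilinear[OF M M incl_linear incl_linear]) (rule h)+
    have "swQ (tensor R Q Q) (\<lambda>a b. tensor_elt R Q Q (antipodeQ b) (antipodeQ a)) (incl x y h) =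
        sw x y (tensor R Q Q) (\<lambda>p q. ?F (S x y q) (S x y p)) h"
      unfolding swQ_incl[OF h MM B]
      by (rule sw_cong[OF h(1,2) MM _ h(3)], (intro hopf_intros linear_comp[OF bilinear_left[OF
          F]] linear_comp[OF bilinear_right[OF F]] MM h(1,2); assumption))
         (simp add: antipodeQ_incl h)
    also have "\<dots> = sw y x (tensor R Q Q) ?F (S x y h)"
      by (rule sw_antipode[OF h MM F, symmetric])
    also have "\<dots> = comultQ (incl y x (S x y h))"
      using swQ_incl[OF h(2,1) antipode_closed[OF h] MM tensor_elt_bilinear[OF M M]]
        swQ_eta[OF incl_closed[OF h(2,1) antipode_closed[OF h]]] by simp
    finally show "swQ (tensor R Q Q) (\<lambda>a b. tensor_elt R Q Q (antipodeQ b) (antipodeQ a)) (incl x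
        y h) = comultQ (antipodeQ (incl x y h))"
      by (simp add: antipodeQ_incl h)
  qed
  finally show ?thesis ..
qed

end

theorem mainTheorem2:
  fixes R :: "('k, 'r) ring_scheme" and X :: "'x set" and H :: "'x \<Rightarrow> 'x \<Rightarrow> ('k, 'm) module"
  assumes "hopf_category R X H \<Delta> \<epsilon> \<mu> \<eta> S"
  defines "Q \<equiv> alg X H"
  shows "counital_quantum_inverse_semigroup R Q
           (alg_mult R X H \<mu>) (alg_comult R X H \<Delta>) (alg_counit R X H \<epsilon>) (alg_antipode X H S)
         \<and> (\<forall>h\<in>carrier Q. alg_comult R X H \<Delta> (alg_antipode X H S h) =
              tensor_flip R Q Q (tensor_map R Q Q (alg_antipode X H S) (alg_antipode X H S)
                (alg_comult R X H \<Delta> h)))"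
proof -
  interpret hopf_category R X H \<Delta> \<epsilon> \<mu> \<eta> S by fact
  have "quantum_inverse_semigroup R Q (alg_mult R X H \<mu>) (alg_comult R X H \<Delta>) (alg_antipode X H S)"
    unfolding Q_def
    by (intro quantum_inverse_semigroup.intro quantum_inverse_semigroup_axioms.intro Q_module
        alg_mult_linear alg_mult_assoc comultQ_linear alg_comult_mult alg_coassoc antipodeQ_linear
        alg_antipode_antimult alg_id_antipode_id alg_antipode_id_antipode alg_idempotents_commute)
  moreover have "coalgebra R Q (alg_comult R X H \<Delta>) (alg_counit R X H \<epsilon>)"
    unfolding Q_def by (rule alg_coalgebra)
  ultimately have "counital_quantum_inverse_semigroup R Q
      (alg_mult R X H \<mu>) (alg_comult R X H \<Delta>) (alg_counit R X H \<epsilon>) (alg_antipode X H S)"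
    unfolding Q_def
    by (intro counital_quantum_inverse_semigroup.intro counital_quantum_inverse_semigroup_axioms.intro
        alg_counit_antipode)
  then show ?thesis unfolding Q_def using alg_antipode_anticomult by blast
qed

end
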